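(* Let $E\subset\mathbb{R}^d$ be the limit set of an iterated function system $\{\varphi_i\}_{i\in I}$ satisfying the standing assumptions listed in the context. Suppose $t=\dim_{\mathrm H}(E)$ and let $l$ be an integer with $0<l<d$. Then either (1) $\mathcal H^t(E\cap M)=0$ for every $l$-dimensional $C^1$-submanifold $M\subset\mathbb R^d$, or (2) $E$ is contained in an $l$-dimensional $C^1$-submanifold of $\mathbb{R}^d$.
   Context: Setting. $I$ is a finite set with at least two elements, $I^*=\bigcup_{n\ge1}I^n$, $I^\infty=I^{\mathbb N}$. For $\mathtt i=(i_1,\dots,i_n)\in I^*$ put $|\mathtt i|=n$ and $\varphi_{\mathtt i}=\varphi_{i_1}\circ\cdots\circ\varphi_{i_n}$; for $\mathtt h\in I^\infty$, $\mathtt h|_n\in I^n$ is the word of the first $n$ terms. $X\subset\mathbb R^d$ is a nonempty compact set, $\Omega'\subset\mathbb R^d$ is open, $\Omega$ is open and bounded with $X\subset\Omega$ and $\overline\Omega\subset\Omega'$. For each $i\in I$ the map $\varphi_i$ belongs to $C^2(\Omega')$, with values in $\mathbb R^d$, and $\varphi_i(X)\subset X$. $|\cdot|$ denotes the Euclidean norm for vectors and the operator norm for linear maps. It is assumed that: (i) there are constants $0<\underline s,\overline s<1$ with $\overline s^{\,2}\le\underline s$ such that $\underline s\le|(\varphi_i'(x))^{-1}|^{-1}\le|\varphi_i'(x)|\le\overline s$ for all $x\in\Omega$, $i\in I$; (ii) $\operatorname{diam}\varphi_{\mathtt i}(X)\to0$ as $|\mathtt i|\to\infty$; the projection $\pi:I^\infty\to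 X$ is defined by $\{\pi(\mathtt h)\}=\bigcap_{n\ge1}\varphi_{\mathtt h|_n}(X)$, and the limit set is the compact set $E=\pi(I^\infty)$; (iii) $|(\varphi_i'(x))^{-1}|^{-1}=|\varphi_i'(x)|$ for all $x\in E$, $i\in I$; (iv) (open set condition) $\varphi_i(\operatorname{int}X)\cap\varphi_j(\operatorname{int}X)=\emptyset$ for $i\ne j$; (v) there is $\varrho_0>0$ with $\inf_{x\in\partial X}\inf_{0<r<\varrho_0}\frac{\mathcal H^d(B(x,r)\cap\operatorname{int}X)}{\mathcal H^d(B(x,r))}>0$. $\mathcal H^s$ is $s$-dimensional Hausdorff measure, $B(x,r)$ the open ball, $\partial X$ the boundary of $X$, and $\dim_{\mathrm H}$ Hausdorff dimension. *)

theory Defs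
  imports "HOL-Analysis.Analysis"
begin

section \<open>Hausdorff measure and dimension\<close>

text \<open>
  The value \<open>diam(U)\<^sup>s\<close>, with the usual conventions \<open>diam(U)\<^sup>0 = 1\<close> for nonempty \<open>U\<close> and
  value \<open>0\<close> for the empty set; the case \<open>s = 0\<close> is separate because \<open>0 powr 0 = 0\<close>.
\<close>
definition hausdorff_gauge :: "real \<Rightarrow> 'a::metric_space set \<Rightarrow> ennreal" where
  "hausdorff_gauge s U =
     (if U = {} then 0 else if s = 0 then 1 else ennreal (diameter U powr s))"

text \<open>
  Boundedness of the covering sets is required because \<^const>\<open>diameter\<close> is real-valued and
  unspecified on unbounded sets.
\<close>
definition hausdorff_premeasure :: "real \<Rightarrow> real \<Rightarrow> 'a::metric_space set \<Rightarrow> ennreal" where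
  "hausdorff_premeasure s \<delta> A =
     (INF U \<in> {U :: nat \<Rightarrow> 'a set. A \<subseteq> (\<Union>n. U n) \<and> (\<forall>n. bounded (U n) \<and> diameter (U n) \<le> \<delta>)}.
        \<Sum>n. hausdorff_gauge s (U n))"

text \<open>
  The Hausdorff outer measure, defined on all sets and meant for \<open>s \<ge> 0\<close>. No normalising
  constant is included.
\<close>
definition hausdorff_measure :: "real \<Rightarrow> 'a::metric_space set \<Rightarrow> ennreal" where
  "hausdorff_measure s A = (SUP \<delta> \<in> {0<..}. hausdorff_premeasure s \<delta> A)"

definition hausdorff_dim :: "'a::metric_space set \<Rightarrow> ereal" where
  "hausdorff_dim A = (INF s \<in> {s::real. 0 \<le> s \<and> hausdorff_measure s A = 0}. ereal s)"


section \<open>Continuously differentiable maps and submanifolds\<close>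

text \<open>Both notions are meant for open \<open>S\<close>.\<close>

definition C1_on :: "('a::real_normed_vector \<Rightarrow> 'b::real_normed_vector) \<Rightarrow> 'a set \<Rightarrow> bool" where
  "C1_on f S \<longleftrightarrow>
     (\<exists>f' :: 'a \<Rightarrow> ('a \<Rightarrow>\<^sub>L 'b).
        (\<forall>x\<in>S. (f has_derivative blinfun_apply (f' x)) (at x)) \<and> continuous_on S f')"

definition C2_on :: "('a::real_normed_vector \<Rightarrow> 'b::real_normed_vector) \<Rightarrow> 'a set \<Rightarrow> bool" where
  "C2_on f S \<longleftrightarrow>
     (\<exists>f' :: 'a \<Rightarrow> ('a \<Rightarrow>\<^sub>L 'b).
        (\<forall>x\<in>S. (f has_derivative blinfun_apply (f' x)) (at x)) \<and> C1_on f' S)"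

text \<open>
  Embedded submanifolds without boundary: near each of its points, \<open>M\<close> is carried to an open
  piece of an \<open>l\<close>-dimensional linear subspace by a \<open>C\<^sup>1\<close>-diffeomorphism between open sets of the
  ambient space. Neither closedness nor connectedness is required.
\<close>
definition C1_submanifold :: "nat \<Rightarrow> 'a::euclidean_space set \<Rightarrow> bool" where
  "C1_submanifold l M \<longleftrightarrow>
     (\<forall>x\<in>M. \<exists>(U::'a set) (V::'a set) f g (L::'a set).
        open U \<and> x \<in> U \<and> open V \<and>
        homeomorphism U V f g \<and> C1_on f U \<and> C1_on g V \<and>
        subspace L \<and> dim L = l \<and> f ` (U \<inter> M) = V \<inter> L)"


section \<open>Iterated function systems\<close>

text \<open>\<open>word_map \<phi> [i\<^sub>1, \<dots>, i\<^sub>n] = \<phi> i\<^sub>1 \<circ> \<dots> \<circ> \<phi> i\<^sub>n\<close>.\<close>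
definition word_map :: "('i \<Rightarrow> 'a \<Rightarrow> 'a) \<Rightarrow> 'i list \<Rightarrow> 'a \<Rightarrow> 'a" where
  "word_map \<phi> w = foldr (\<lambda>i g. \<phi> i \<circ> g) w id"

text \<open>
  An infinite word is a function \<open>h :: nat \<Rightarrow> 'i\<close>, indexed from \<open>0\<close>; its first \<open>n\<close> terms form the
  list \<open>map h [0..<n]\<close>. The projection is meaningful only when the intersection is a singleton.
\<close>
definition ifs_proj :: "('i \<Rightarrow> 'a \<Rightarrow> 'a) \<Rightarrow> 'a set \<Rightarrow> (nat \<Rightarrow> 'i) \<Rightarrow> 'a" where
  "ifs_proj \<phi> X h = the_elem (\<Inter>n\<in>{1..}. word_map \<phi> (map h [0..<n]) ` X)"

definition limit_set :: "'i set \<Rightarrow> ('i \<Rightarrow> 'a \<Rightarrow> 'a) \<Rightarrow> 'a set \<Rightarrow> 'a set" where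
  "limit_set I \<phi> X = ifs_proj \<phi> X ` {h. \<forall>n. h n \<in> I}"

text \<open>
  \<open>|T\<^sup>-\<^sup>1|\<^sup>-\<^sup>1\<close> for an invertible linear map \<open>T\<close> (operator norm).
\<close>
definition conorm :: "('a::real_normed_vector \<Rightarrow> 'a) \<Rightarrow> real" where
  "conorm T = inverse (onorm (inv T))"

end

theory Submission
  imports Defs "HOL-Complex_Analysis.Great_Picard"
begin

text \<open>
  Suppose \<open>H\<^sup>t(E \<inter> M) > 0\<close>. Since \<open>E\<close> contains an almost similar copy of a fixed piece of itself in each
  of its small balls, \<open>t = dim E\<close> forces \<open>H\<^sup>t(E) < \<infinity>\<close> (Falconer's implicit method).
  Hence \<open>E \<inter> M\<close> has a density point \<open>x\<close> relative to \<open>E\<close>, coded by some \<open>h\<close>. Each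
  fixed subcylinder of the cylinder of \<open>h|n\<close> carries a fixed proportion of its measure, so it meets \<open>M\<close>
  once \<open>n\<close> is large. Because the derivatives are similarities on \<open>E\<close>, bounded distortion makes the maps
  \<open>\<phi>\<^bsub>h|n\<^esub>\<close>, recentred at \<open>x\<close> and rescaled by their derivative, precompact in \<open>C\<^sup>1\<close> on a neighbourhood \<open>W\<close>
  of \<open>E\<close>; a limit \<open>f\<close> is a local diffeomorphism and maps \<open>E\<close> into the tangent space \<open>T\<close> of \<open>M\<close> at \<open>x\<close>.
  So \<open>E\<close> lies in the submanifold \<open>{z \<in> W. f z \<in> T}\<close>.
\<close>

section \<open>Hausdorff measure\<close>

text \<open>All that \<open>t = dim E\<close> says from above is that the measure vanishes in every
  exponent larger than \<open>t\<close>. Finiteness is therefore won by contradiction: too many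
  separated copies of a piece at one scale would make the measure positive in an exponent slightly
  above \<open>t\<close>. After that, one-sided estimates suffice: the image of \<open>E\<close>
  under a word with derivative norm \<open>a\<close> has measure at least a constant times
  \<open>a^t\<close> and diameter at most a constant times \<open>a\<close>. So a density point can
  be defined by smallness of the measure of \<open>E - A\<close> in balls against
  \<open>r^t\<close>, with no quotient of measures. Three obstacles shape the details. The
  derivatives are similarities only on \<open>E\<close>, so norms are taken at points of
  \<open>E\<close>, where they multiply along words, and nearby points are compared with these. The
  maps may fail to be injective on \<open>E\<close>, so measures are estimated on small pieces. And
  \<open>M\<close> need not be closed, so \<open>E \<inter> M\<close> is first cut down to a compact
  \<open>A\<close> on which tangency to \<open>M\<close> can be used. Rescaling takes place on a
  whole neighbourhood \<open>W\<close> because a limit known on \<open>E\<close> alone would give no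
  submanifold.\<close>

lemma diameter_le_dist:
  assumes "S \<noteq> {} \<or> 0 \<le> d" "\<And>x y. \<lbrakk>x \<in> S; y \<in> S\<rbrakk> \<Longrightarrow> dist x y \<le> d"
  shows "diameter S \<le> d"
  using assms by (auto simp: diameter_def intro!: cSUP_least)

lemma hausdorff_gauge_empty [simp]: "hausdorff_gauge s {} = 0"
  by (simp add: hausdorff_gauge_def)

lemma hausdorff_gauge_le:
  assumes "0 \<le> s" "bounded U" "diameter U \<le> d" "0 < d"
  shows "hausdorff_gauge s U \<le> ennreal (d powr s)"
  using assms diameter_ge_0[OF assms(2)]
  by (auto simp: hausdorff_gauge_def intro!: ennreal_leI powr_mono2)

lemma hausdorff_gauge_mono:
  assumes "0 \<le> s" "bounded V" "U \<subseteq> V"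
  shows "hausdorff_gauge s U \<le> hausdorff_gauge s V"
proof -
  have "bounded U" using assms bounded_subset by blast
  then show ?thesis
    using assms diameter_subset[OF assms(3,2)] diameter_ge_0[of U]
    by (auto simp: hausdorff_gauge_def intro!: ennreal_leI powr_mono2)
qed

text \<open>The nonemptiness premise is for exponent 0, where the gauge of a nonempty set is 1
  whatever its diameter.\<close>

lemma hausdorff_gauge_scale:
  assumes "0 \<le> s" "0 < c" "bounded U" "bounded V"
    and "V \<noteq> {} \<Longrightarrow> U \<noteq> {}" and "diameter V \<le> c * diameter U"
  shows "hausdorff_gauge s V \<le> ennreal (c powr s) * hausdorff_gauge s U"
proof (cases "V = {} \<or> s = 0")
  case True
  then show ?thesis using assms by (auto simp: hausdorff_gauge_def)
next
  case False
  have "diameter V powr s \<le> (c * diameter U) powr s"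
    using assms diameter_ge_0[OF assms(4)] by (intro powr_mono2) auto
  also have "\<dots> = c powr s * diameter U powr s"
    using assms diameter_ge_0[OF assms(3)] by (simp add: powr_mult)
  finally show ?thesis
    using False assms by (auto simp: hausdorff_gauge_def ennreal_mult[symmetric] intro!: ennreal_leI)
qed

lemma hausdorff_premeasure_le:
  assumes "A \<subseteq> (\<Union>n. U n)" "\<And>n. bounded (U n)" "\<And>n. diameter (U n) \<le> \<delta>"
  shows "hausdorff_premeasure s \<delta> A \<le> (\<Sum>n. hausdorff_gauge s (U n))"
  unfolding hausdorff_premeasure_def by (rule INF_lower) (use assms in auto)

lemma hausdorff_premeasure_ge:
  assumes "\<And>U. \<lbrakk>A \<subseteq> (\<Union>n. U n); \<And>n. bounded (U n); \<And>n. diameter (U n) \<le> \<delta>\<rbrakk>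
             \<Longrightarrow> b \<le> (\<Sum>n. hausdorff_gauge s (U n))"
  shows "b \<le> hausdorff_premeasure s \<delta> A"
  unfolding hausdorff_premeasure_def by (rule INF_greatest) (use assms in auto)

lemma hausdorff_premeasure_less:
  assumes "hausdorff_premeasure s \<delta> A < e"
  obtains U where "A \<subseteq> (\<Union>n. U n)" "\<And>n. bounded (U n)" "\<And>n. diameter (U n) \<le> \<delta>"
    "(\<Sum>n. hausdorff_gauge s (U n)) < e"
  using assms unfolding hausdorff_premeasure_def INF_less_iff by auto

lemma hausdorff_premeasure_mono:
  assumes "A \<subseteq> B"
  shows "hausdorff_premeasure s \<delta> A \<le> hausdorff_premeasure s \<delta> B"
  by (intro hausdorff_premeasure_ge hausdorff_premeasure_le) (use assms in auto)

lemma hausdorff_premeasure_antimono: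
  assumes "\<delta> \<le> \<epsilon>"
  shows "hausdorff_premeasure s \<epsilon> A \<le> hausdorff_premeasure s \<delta> A"
  by (intro hausdorff_premeasure_ge hausdorff_premeasure_le) (use assms order_trans in blast)+

lemma hausdorff_premeasure_le_measure:
  "0 < \<delta> \<Longrightarrow> hausdorff_premeasure s \<delta> A \<le> hausdorff_measure s A"
  unfolding hausdorff_measure_def by (rule SUP_upper) auto

lemma hausdorff_measure_le:
  assumes "\<And>\<delta>. 0 < \<delta> \<Longrightarrow> hausdorff_premeasure s \<delta> A \<le> b"
  shows "hausdorff_measure s A \<le> b"
  unfolding hausdorff_measure_def by (rule SUP_least) (use assms in auto)

lemma hausdorff_measure_mono:
  assumes "A \<subseteq> B"
  shows "hausdorff_measure s A \<le> hausdorff_measure s B"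
  by (rule hausdorff_measure_le)
     (metis assms hausdorff_premeasure_mono hausdorff_premeasure_le_measure order_trans)

lemma hausdorff_measure_eq_SUP_nat:
  "hausdorff_measure s A = (SUP n. hausdorff_premeasure s (1 / real (Suc n)) A)"
proof (rule antisym)
  show "hausdorff_measure s A \<le> (SUP n. hausdorff_premeasure s (1 / real (Suc n)) A)"
  proof (rule hausdorff_measure_le)
    fix \<delta> :: real assume "0 < \<delta>"
    then obtain n where "1 / real (Suc n) < \<delta>"
      using reals_Archimedean by (metis inverse_eq_divide)
    then have "hausdorff_premeasure s \<delta> A \<le> hausdorff_premeasure s (1 / real (Suc n)) A"
      by (intro hausdorff_premeasure_antimono) simp
    also have "\<dots> \<le> (SUP n. hausdorff_premeasure s (1 / real (Suc n)) A)"
      by (rule SUP_upper) simp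
    finally show "hausdorff_premeasure s \<delta> A \<le> (SUP n. hausdorff_premeasure s (1 / real (Suc n)) A)" .
  qed
  show "(SUP n. hausdorff_premeasure s (1 / real (Suc n)) A) \<le> hausdorff_measure s A"
    by (intro SUP_least hausdorff_premeasure_le_measure) simp
qed

lemma hausdorff_premeasure_countable_cover:
  assumes "countable C" "A \<subseteq> (\<Union>i\<in>C. U i)" "0 \<le> \<delta>"
    and "\<And>i. i \<in> C \<Longrightarrow> bounded (U i)" "\<And>i. i \<in> C \<Longrightarrow> diameter (U i) \<le> \<delta>"
    and b: "\<And>F. \<lbrakk>finite F; F \<subseteq> C\<rbrakk> \<Longrightarrow> (\<Sum>i\<in>F. hausdorff_gauge s (U i)) \<le> b"
  shows "hausdorff_premeasure s \<delta> A \<le> b"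
proof -
  define N where "N = to_nat_on C ` C"
  define V where "V n = (if n \<in> N then U (from_nat_into C n) else {})" for n
  have inC: "from_nat_into C n \<in> C" if "n \<in> N" for n
    using that assms(1) by (auto simp: N_def)
  have "A \<subseteq> (\<Union>n. V n)"
  proof
    fix x assume "x \<in> A"
    then obtain i where i: "i \<in> C" "x \<in> U i" using assms by auto
    then have "x \<in> V (to_nat_on C i)" using assms(1) by (auto simp: V_def N_def)
    then show "x \<in> (\<Union>n. V n)" by blast
  qed
  then have "hausdorff_premeasure s \<delta> A \<le> (\<Sum>n. hausdorff_gauge s (V n))"
    by (rule hausdorff_premeasure_le) (use assms inC in \<open>auto simp: V_def\<close>)
  also have "\<dots> \<le> b"
  proof (rule suminf_le_const)
    show "summable (\<lambda>n. hausdorff_gauge s (V n))" by (rule summableI)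
    fix n
    have inj: "inj_on (from_nat_into C) ({..<n} \<inter> N)"
      by (auto simp: inj_on_def N_def assms(1))
    have "(\<Sum>k<n. hausdorff_gauge s (V k)) = (\<Sum>k\<in>{..<n} \<inter> N. hausdorff_gauge s (V k))"
      by (rule sum.mono_neutral_right) (auto simp: V_def)
    also have "\<dots> = (\<Sum>i\<in>from_nat_into C ` ({..<n} \<inter> N). hausdorff_gauge s (U i))"
      by (subst sum.reindex[OF inj]) (auto simp: V_def intro!: sum.cong)
    also have "\<dots> \<le> b" by (rule b) (use inC in auto)
    finally show "(\<Sum>k<n. hausdorff_gauge s (V k)) \<le> b" .
  qed
  finally show ?thesis .
qed

lemma hausdorff_premeasure_UN_le:
  "hausdorff_premeasure s \<delta> (\<Union>n::nat. A n) \<le> (\<Sum>n. hausdorff_premeasure s \<delta> (A n))"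
proof (rule ennreal_le_epsilon)
  fix e :: real
  assume fin: "(\<Sum>n. hausdorff_premeasure s \<delta> (A n)) < top" and e: "0 < e"
  have "\<exists>U. A n \<subseteq> (\<Union>k. U k) \<and> (\<forall>k. bounded (U k)) \<and> (\<forall>k. diameter (U k) \<le> \<delta>) \<and>
      (\<Sum>k. hausdorff_gauge s (U k)) < hausdorff_premeasure s \<delta> (A n) + ennreal (e * (1/2) ^ Suc n)" for n
  proof -
    have "hausdorff_premeasure s \<delta> (A n) < top"
      using ennreal_suminf_lessD[OF fin] .
    moreover have "0 < ennreal (e * (1/2) ^ Suc n)"
      using e by simp
    ultimately have "hausdorff_premeasure s \<delta> (A n) < hausdorff_premeasure s \<delta> (A n) + ennreal (e * (1/2) ^ Suc n)"
      by (simp add: ennreal_add_left_cancel_less[of _ 0, simplified])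
    then show ?thesis by (elim hausdorff_premeasure_less) blast
  qed
  then obtain U where U: "\<And>n. A n \<subseteq> (\<Union>k. U n k)" "\<And>n k. bounded (U n k)" "\<And>n k. diameter (U n k) \<le> \<delta>"
    "\<And>n. (\<Sum>k. hausdorff_gauge s (U n k)) < hausdorff_premeasure s \<delta> (A n) + ennreal (e * (1/2) ^ Suc n)"
    by metis
  define V where "V m = (case prod_decode m of (n, k) \<Rightarrow> U n k)" for m
  have "(\<Union>n. A n) \<subseteq> (\<Union>m. V m)"
  proof
    fix x assume "x \<in> (\<Union>n. A n)"
    then obtain n k where "x \<in> U n k" using U(1) by blast
    then have "x \<in> V (prod_encode (n, k))" by (simp add: V_def)
    then show "x \<in> (\<Union>m. V m)" by blast
  qed
  then have "hausdorff_premeasure s \<delta> (\<Union>n. A n) \<le> (\<Sum>m. hausdorff_gauge s (V m))"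
    by (rule hausdorff_premeasure_le) (use U in \<open>auto simp: V_def split: prod.split\<close>)
  also have "\<dots> = (\<Sum>m. (\<lambda>(n,k). hausdorff_gauge s (U n k)) (prod_decode m))"
    by (simp add: V_def case_prod_unfold)
  also have "\<dots> = (\<Sum>n. \<Sum>k. hausdorff_gauge s (U n k))"
    by (subst suminf_ennreal_2dimen[symmetric, of "\<lambda>n. \<Sum>k. hausdorff_gauge s (U n k)"]) auto
  also have "\<dots> \<le> (\<Sum>n. hausdorff_premeasure s \<delta> (A n) + ennreal (e * (1/2) ^ Suc n))"
    by (intro suminf_le summableI) (use U(4) in \<open>auto intro: less_imp_le\<close>)
  also have "\<dots> = (\<Sum>n. hausdorff_premeasure s \<delta> (A n)) + (\<Sum>n. ennreal (e * (1/2) ^ Suc n))"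
    by (rule suminf_add[symmetric]) auto
  also have "(\<Sum>n. ennreal (e * (1/2) ^ Suc n)) = ennreal e"
    using e sums_mult[OF power_half_series, of e] by (intro suminf_ennreal_eq) auto
  finally show "hausdorff_premeasure s \<delta> (\<Union>n. A n) \<le> (\<Sum>n. hausdorff_premeasure s \<delta> (A n)) + ennreal e" .
qed

lemma hausdorff_measure_UN_le:
  "hausdorff_measure s (\<Union>n::nat. A n) \<le> (\<Sum>n. hausdorff_measure s (A n))"
proof (rule hausdorff_measure_le)
  fix \<delta> :: real assume "0 < \<delta>"
  have "hausdorff_premeasure s \<delta> (\<Union>n. A n) \<le> (\<Sum>n. hausdorff_premeasure s \<delta> (A n))"
    by (rule hausdorff_premeasure_UN_le)
  also have "\<dots> \<le> (\<Sum>n. hausdorff_measure s (A n))"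
    by (intro suminf_le summableI hausdorff_premeasure_le_measure \<open>0 < \<delta>\<close>)
  finally show "hausdorff_premeasure s \<delta> (\<Union>n. A n) \<le> (\<Sum>n. hausdorff_measure s (A n))" .
qed

lemma hausdorff_measure_empty [simp]: "hausdorff_measure s {} = 0"
proof -
  have "hausdorff_measure s ({} :: 'a set) \<le> 0"
  proof (rule hausdorff_measure_le)
    fix \<delta> :: real assume "0 < \<delta>"
    then show "hausdorff_premeasure s \<delta> ({} :: 'a set) \<le> 0"
      using hausdorff_premeasure_le[of "{}" "\<lambda>_. {}" \<delta> s] by simp
  qed
  then show ?thesis by simp
qed

lemma hausdorff_measure_null_UN:
  assumes "countable C" "\<And>i. i \<in> C \<Longrightarrow> hausdorff_measure s (A i) = 0"
  shows "hausdorff_measure s (\<Union>i\<in>C. A i) = 0"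
proof (cases "C = {}")
  case False
  have "hausdorff_measure s (\<Union>i\<in>C. A i) = hausdorff_measure s (\<Union>n. A (from_nat_into C n))"
    using range_from_nat_into[OF False assms(1)] by (metis image_image)
  also have "\<dots> \<le> (\<Sum>n. hausdorff_measure s (A (from_nat_into C n)))"
    by (rule hausdorff_measure_UN_le)
  also have "\<dots> = 0" using assms False by (simp add: from_nat_into)
  finally show ?thesis by simp
qed simp

lemma hausdorff_measure_Un_le:
  "hausdorff_measure s (A \<union> B) \<le> hausdorff_measure s A + hausdorff_measure s B"
proof -
  let ?C = "\<lambda>n::nat. if n = 0 then A else if n = 1 then B else {}"
  have eq: "A \<union> B = (\<Union>n. ?C n)"
    by (auto split: if_splits intro: exI[of _ 0] exI[of _ "Suc 0"])
  have "hausdorff_measure s (A \<union> B) \<le> (\<Sum>n. hausdorff_measure s (?C n))"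
    unfolding eq by (rule hausdorff_measure_UN_le)
  also have "\<dots> = (\<Sum>n\<in>{0,1}. hausdorff_measure s (?C n))"
    by (rule suminf_finite) auto
  finally show ?thesis by simp
qed

lemma hausdorff_measure_finite_UN_less_top:
  assumes "finite F" "\<And>i. i \<in> F \<Longrightarrow> hausdorff_measure s (A i) < top"
  shows "hausdorff_measure s (\<Union>i\<in>F. A i) < top"
  using assms
proof (induction F rule: finite_induct)
  case (insert i F)
  then have "hausdorff_measure s (A i) + hausdorff_measure s (\<Union>i\<in>F. A i) < top" by simp
  then show ?case
    using order_le_less_trans[OF hausdorff_measure_Un_le[of s "A i" "\<Union>i\<in>F. A i"]] by simp
qed simp

section \<open>Additivity on sets at positive distance, and expanding maps\<close>

lemma hausdorff_premeasure_separated: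
  assumes "0 \<le> s" "\<delta> < \<eta>" "0 \<le> \<delta>" "\<And>a b. a \<in> A \<Longrightarrow> b \<in> B \<Longrightarrow> \<eta> \<le> dist a b"
  shows "hausdorff_premeasure s \<delta> A + hausdorff_premeasure s \<delta> B \<le> hausdorff_premeasure s \<delta> (A \<union> B)"
proof (rule hausdorff_premeasure_ge)
  fix U :: "nat \<Rightarrow> 'a set"
  assume U: "A \<union> B \<subseteq> (\<Union>n. U n)" and bd: "\<And>n. bounded (U n)" and d: "\<And>n. diameter (U n) \<le> \<delta>"
  have sub: "bounded (U n \<inter> S)" "diameter (U n \<inter> S) \<le> \<delta>" for n S
    using bd d diameter_subset[of "U n \<inter> S" "U n"] by (auto intro: order_trans bounded_subset)
  have "hausdorff_premeasure s \<delta> S \<le> (\<Sum>n. hausdorff_gauge s (U n \<inter> S))" if "S \<subseteq> A \<union> B" for S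
    by (rule hausdorff_premeasure_le) (use that U sub in auto)
  then have "hausdorff_premeasure s \<delta> A + hausdorff_premeasure s \<delta> B
      \<le> (\<Sum>n. hausdorff_gauge s (U n \<inter> A)) + (\<Sum>n. hausdorff_gauge s (U n \<inter> B))"
    by (intro add_mono) auto
  also have "\<dots> = (\<Sum>n. hausdorff_gauge s (U n \<inter> A) + hausdorff_gauge s (U n \<inter> B))"
    by (rule suminf_add) auto
  also have "\<dots> \<le> (\<Sum>n. hausdorff_gauge s (U n))"
  proof (intro suminf_le summableI)
    fix n
    have "U n \<inter> A = {} \<or> U n \<inter> B = {}"
    proof (rule ccontr)
      assume "\<not> ?thesis"
      then obtain a b where "a \<in> U n" "b \<in> U n" "a \<in> A" "b \<in> B" by blast
      then show False
        using diameter_bounded_bound[OF bd[of n]] d[of n] assms(2) assms(4)[of a b] by force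
    qed
    then show "hausdorff_gauge s (U n \<inter> A) + hausdorff_gauge s (U n \<inter> B) \<le> hausdorff_gauge s (U n)"
      using hausdorff_gauge_mono[OF assms(1) bd[of n]] by (metis Int_lower1 add_0 add.right_neutral hausdorff_gauge_empty)
  qed
  finally show "hausdorff_premeasure s \<delta> A + hausdorff_premeasure s \<delta> B \<le> (\<Sum>n. hausdorff_gauge s (U n))" .
qed

text \<open>Once the mesh is below \<open>\<eta>\<close>, no covering set meets both
  \<open>A\<close> and \<open>B\<close>. This inequality takes the place of measurability in the
  density arguments below.\<close>

lemma hausdorff_measure_separated:
  assumes "0 \<le> s" "0 < \<eta>" "\<And>a b. a \<in> A \<Longrightarrow> b \<in> B \<Longrightarrow> \<eta> \<le> dist a b"
  shows "hausdorff_measure s A + hausdorff_measure s B \<le> hausdorff_measure s (A \<union> B)"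
proof -
  have inc: "incseq (\<lambda>n. hausdorff_premeasure s (1 / real (Suc n)) S)" for S :: "'a set"
    by (intro monoI hausdorff_premeasure_antimono) (simp add: field_simps)
  have "hausdorff_measure s A + hausdorff_measure s B =
      (SUP n. hausdorff_premeasure s (1 / real (Suc n)) A + hausdorff_premeasure s (1 / real (Suc n)) B)"
    unfolding hausdorff_measure_eq_SUP_nat by (rule ennreal_SUP_add[symmetric]) (rule inc)+
  also have "\<dots> \<le> hausdorff_measure s (A \<union> B)"
  proof (rule SUP_least)
    fix n
    define \<delta> where "\<delta> = min (1 / real (Suc n)) (\<eta> / 2)"
    have \<delta>: "0 < \<delta>" "\<delta> < \<eta>" "\<delta> \<le> 1 / real (Suc n)" using assms by (auto simp: \<delta>_def)
    have "hausdorff_premeasure s (1 / real (Suc n)) A + hausdorff_premeasure s (1 / real (Suc n)) B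
        \<le> hausdorff_premeasure s \<delta> A + hausdorff_premeasure s \<delta> B"
      by (intro add_mono hausdorff_premeasure_antimono \<delta>)
    also have "\<dots> \<le> hausdorff_premeasure s \<delta> (A \<union> B)"
      by (rule hausdorff_premeasure_separated) (use assms \<delta> in auto)
    also have "\<dots> \<le> hausdorff_measure s (A \<union> B)"
      by (rule hausdorff_premeasure_le_measure) (rule \<delta>)
    finally show "hausdorff_premeasure s (1 / real (Suc n)) A + hausdorff_premeasure s (1 / real (Suc n)) B
        \<le> hausdorff_measure s (A \<union> B)" .
  qed
  finally show ?thesis .
qed

lemma hausdorff_measure_sum_separated:
  assumes "0 \<le> s" "finite F"
    and "\<And>i j. \<lbrakk>i \<in> F; j \<in> F; i \<noteq> j\<rbrakk> \<Longrightarrow> \<exists>\<eta>>0. \<forall>a\<in>A i. \<forall>b\<in>A j. \<eta> \<le> dist a b"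
  shows "(\<Sum>i\<in>F. hausdorff_measure s (A i)) \<le> hausdorff_measure s (\<Union>i\<in>F. A i)"
  using assms(2,3)
proof (induction F rule: finite_induct)
  case (insert i F)
  have "\<exists>\<eta>>0. \<forall>j\<in>F. \<forall>a\<in>A i. \<forall>b\<in>A j. \<eta> \<le> dist a b"
  proof -
    have "\<forall>j\<in>F. \<exists>\<eta>>0. \<forall>a\<in>A i. \<forall>b\<in>A j. \<eta> \<le> dist a b"
      using insert.prems insert.hyps by (metis insert_iff)
    then obtain \<eta> where \<eta>: "\<And>j. j \<in> F \<Longrightarrow> 0 < \<eta> j" "\<And>j a b. \<lbrakk>j \<in> F; a \<in> A i; b \<in> A j\<rbrakk> \<Longrightarrow> \<eta> j \<le> dist a b"
      by metis
    let ?m = "Min (insert 1 (\<eta> ` F))"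
    have "0 < ?m" using \<eta> insert.hyps by auto
    moreover have "?m \<le> dist a b" if "j \<in> F" "a \<in> A i" "b \<in> A j" for j a b
      using \<eta>(2)[OF that] insert.hyps that by (meson Min_le finite_imageI finite_insert image_eqI insertCI order_trans)
    ultimately show ?thesis by blast
  qed
  then obtain \<eta> where "0 < \<eta>" "\<And>a b. a \<in> A i \<Longrightarrow> b \<in> (\<Union>j\<in>F. A j) \<Longrightarrow> \<eta> \<le> dist a b" by blast
  then have "hausdorff_measure s (A i) + hausdorff_measure s (\<Union>j\<in>F. A j) \<le> hausdorff_measure s (A i \<union> (\<Union>j\<in>F. A j))"
    by (rule hausdorff_measure_separated[OF assms(1)])
  moreover have "(\<Sum>i\<in>F. hausdorff_measure s (A i)) \<le> hausdorff_measure s (\<Union>i\<in>F. A i)"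
    by (rule insert.IH) (use insert.prems in auto)
  ultimately show ?case using insert.hyps by (simp add: order_trans[OF add_left_mono])
qed simp

text \<open>A cover of the image pulls back to a cover of \<open>K\<close> whose diameters grow by
  at most the factor \<open>1/q\<close>. The change of mesh from \<open>\<delta>\<close> to
  \<open>q * \<delta>\<close> disappears in the supremum.\<close>

lemma hausdorff_measure_expanding:
  fixes g :: "'a::metric_space \<Rightarrow> 'b::metric_space"
  assumes "0 \<le> s" "0 < q" and exp: "\<And>x y. \<lbrakk>x \<in> K; y \<in> K\<rbrakk> \<Longrightarrow> q * dist x y \<le> dist (g x) (g y)"
  shows "ennreal (q powr s) * hausdorff_measure s K \<le> hausdorff_measure s (g ` K)"
proof -
  have "hausdorff_measure s K \<le> ennreal ((1/q) powr s) * hausdorff_measure s (g ` K)"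
  proof (rule hausdorff_measure_le)
    fix \<delta> :: real assume \<delta>: "0 < \<delta>"
    have inv: "ennreal ((1/q) powr s) * ennreal (q powr s) = 1" "ennreal (q powr s) * ennreal ((1/q) powr s) = 1"
      using assms by (simp_all add: powr_divide flip: ennreal_mult)
    have "ennreal (q powr s) * hausdorff_premeasure s \<delta> K \<le> hausdorff_premeasure s (q * \<delta>) (g ` K)"
    proof (rule hausdorff_premeasure_ge)
      fix U :: "nat \<Rightarrow> 'b set"
      assume U: "g ` K \<subseteq> (\<Union>n. U n)" and bd: "\<And>n. bounded (U n)" and d: "\<And>n. diameter (U n) \<le> q * \<delta>"
      define V where "V n = {x \<in> K. g x \<in> U n}" for n
      have dV: "dist x y \<le> (1/q) * diameter (U n)" if "x \<in> V n" "y \<in> V n" for x y n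
      proof -
        have "q * dist x y \<le> diameter (U n)"
          using exp[of x y] that diameter_bounded_bound[OF bd[of n], of "g x" "g y"] by (auto simp: V_def)
        then show ?thesis using assms(2) by (simp add: field_simps)
      qed
      have bV: "bounded (V n)" for n
        unfolding bounded_two_points using dV by blast
      have diV: "diameter (V n) \<le> (1/q) * diameter (U n)" for n
        by (rule diameter_le_dist) (use dV diameter_ge_0[OF bd[of n]] assms(2) in auto)
      have "hausdorff_premeasure s \<delta> K \<le> (\<Sum>n. hausdorff_gauge s (V n))"
      proof (rule hausdorff_premeasure_le)
        show "diameter (V n) \<le> \<delta>" for n
          using diV[of n] d[of n] assms(2) by (simp add: field_simps) (metis mult.commute mult_le_cancel_left_pos order_trans)
      qed (use U bV in \<open>auto simp: V_def\<close>)
      also have "\<dots> \<le> (\<Sum>n. ennreal ((1/q) powr s) * hausdorff_gauge s (U n))"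
        by (intro suminf_le summableI hausdorff_gauge_scale bV bd diV) (use assms in \<open>auto simp: V_def\<close>)
      also have "\<dots> = ennreal ((1/q) powr s) * (\<Sum>n. hausdorff_gauge s (U n))"
        by (rule ennreal_suminf_cmult)
      finally have "ennreal (q powr s) * hausdorff_premeasure s \<delta> K \<le>
          ennreal (q powr s) * (ennreal ((1/q) powr s) * (\<Sum>n. hausdorff_gauge s (U n)))"
        by (rule mult_left_mono) simp
      then show "ennreal (q powr s) * hausdorff_premeasure s \<delta> K \<le> (\<Sum>n. hausdorff_gauge s (U n))"
        by (simp add: inv flip: mult.assoc)
    qed
    also have "\<dots> \<le> hausdorff_measure s (g ` K)"
      by (rule hausdorff_premeasure_le_measure) (use \<delta> assms in simp)
    finally have "ennreal ((1/q) powr s) * (ennreal (q powr s) * hausdorff_premeasure s \<delta> K)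
      \<le> ennreal ((1/q) powr s) * hausdorff_measure s (g ` K)" by (rule mult_left_mono) simp
    then show "hausdorff_premeasure s \<delta> K \<le> ennreal ((1/q) powr s) * hausdorff_measure s (g ` K)"
      by (simp add: inv flip: mult.assoc)
  qed
  then have "ennreal (q powr s) * hausdorff_measure s K
     \<le> ennreal (q powr s) * (ennreal ((1/q) powr s) * hausdorff_measure s (g ` K))"
    by (rule mult_left_mono) simp
  also have "\<dots> = hausdorff_measure s (g ` K)"
    using assms by (simp add: powr_divide flip: ennreal_mult mult.assoc)
  finally show ?thesis .
qed

lemma hausdorff_measure_null_mono_dim:
  assumes "0 \<le> s" "s < u" "hausdorff_measure s A = 0"
  shows "hausdorff_measure u A = 0"
proof -
  have "hausdorff_premeasure u \<delta> A \<le> 0" if "0 < \<delta>" for \<delta>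
  proof (rule ennreal_le_epsilon)
    fix e :: real assume e: "0 < e"
    \<comment> \<open>Below diameter 1 a larger exponent gives a smaller gauge.\<close>
    define \<delta>' where "\<delta>' = min \<delta> 1"
    have \<delta>': "0 < \<delta>'" "\<delta>' \<le> \<delta>" "\<delta>' \<le> 1" using that by (auto simp: \<delta>'_def)
    have "hausdorff_premeasure s \<delta>' A \<le> 0"
      using hausdorff_premeasure_le_measure[OF \<delta>'(1), of s A] assms by simp
    then have "hausdorff_premeasure s \<delta>' A < ennreal e" using e by (simp add: order_le_less_trans)
    then obtain U where U: "A \<subseteq> (\<Union>n. U n)" "\<And>n. bounded (U n)" "\<And>n. diameter (U n) \<le> \<delta>'"
      "(\<Sum>n. hausdorff_gauge s (U n)) < ennreal e" by (rule hausdorff_premeasure_less) blast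
    have "hausdorff_premeasure u \<delta> A \<le> (\<Sum>n. hausdorff_gauge u (U n))"
      by (rule hausdorff_premeasure_le) (use U \<delta>' in \<open>auto intro: order_trans\<close>)
    also have "\<dots> \<le> (\<Sum>n. hausdorff_gauge s (U n))"
    proof (intro suminf_le summableI)
      fix n
      have "0 \<le> diameter (U n)" "diameter (U n) \<le> 1"
        using U(2,3)[of n] diameter_ge_0 \<delta>' by (auto intro: order_trans)
      then show "hausdorff_gauge u (U n) \<le> hausdorff_gauge s (U n)"
        using assms by (auto simp: hausdorff_gauge_def intro!: ennreal_leI powr_mono' powr_le1)
    qed
    finally show "hausdorff_premeasure u \<delta> A \<le> 0 + ennreal e" using U(4) by simp
  qed
  then have "hausdorff_measure u A \<le> 0" by (rule hausdorff_measure_le)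
  then show ?thesis by simp
qed

lemma hausdorff_dim_nonneg: "0 \<le> hausdorff_dim A"
  unfolding hausdorff_dim_def by (rule INF_greatest) auto

lemma hausdorff_measure_above_dim:
  assumes "hausdorff_dim A < ereal s"
  shows "hausdorff_measure s A = 0"
proof -
  obtain u where "0 \<le> u" "hausdorff_measure u A = 0" "u < s"
    using assms unfolding hausdorff_dim_def INF_less_iff by auto
  then show ?thesis using hausdorff_measure_null_mono_dim by blast
qed

section \<open>Sets containing small copies of themselves\<close>

text \<open>
  Induction on the number of covering sets: if all of them are shorter than \<open>\<delta>\<close>, each meets at most
  one image \<open>g j ` K\<close>, and those meeting a given image pull back to a cover of \<open>K\<close> by fewer sets.
\<close>
lemma separated_images_cover_bound:
  fixes g :: "'j \<Rightarrow> 'a::metric_space \<Rightarrow> 'a"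
  assumes J: "finite J" "2 \<le> card J" and K: "K \<noteq> {}" and "0 < s" "0 < q" "0 < \<delta>"
    and maps: "\<And>j x. \<lbrakk>j \<in> J; x \<in> K\<rbrakk> \<Longrightarrow> g j x \<in> K"
    and exp: "\<And>j x y. \<lbrakk>j \<in> J; x \<in> K; y \<in> K\<rbrakk> \<Longrightarrow> q * dist x y \<le> dist (g j x) (g j y)"
    and sep: "\<And>i j x y. \<lbrakk>i \<in> J; j \<in> J; i \<noteq> j; x \<in> K; y \<in> K\<rbrakk> \<Longrightarrow> \<delta> \<le> dist (g i x) (g j y)"
    and big: "1 \<le> card J * q powr s"
    and cover: "finite A" "K \<subseteq> (\<Union>a\<in>A. U a)" "\<And>a. a \<in> A \<Longrightarrow> bounded (U a)"
  shows "\<delta> powr s \<le> (\<Sum>a\<in>A. diameter (U a) powr s)"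
  using cover
proof (induction "card A" arbitrary: A U rule: less_induct)
  case less
  show ?case
  proof (cases "\<exists>a\<in>A. \<delta> \<le> diameter (U a)")
    case True
    then obtain a where a: "a \<in> A" "\<delta> \<le> diameter (U a)" by blast
    have "\<delta> powr s \<le> diameter (U a) powr s" using a assms by (intro powr_mono2) auto
    also have "\<dots> \<le> (\<Sum>a\<in>A. diameter (U a) powr s)" using a less.prems by (intro member_le_sum) auto
    finally show ?thesis .
  next
    case False
    define V where "V j a = {x \<in> K. g j x \<in> U a}" for j a
    define B where "B j = {a \<in> A. V j a \<noteq> {}}" for j
    have finB: "finite (B j)" for j using less.prems by (simp add: B_def)
    have disj: "B i \<inter> B j = {}" if "i \<in> J" "j \<in> J" "i \<noteq> j" for i j
    proof (rule ccontr)
      assume "B i \<inter> B j \<noteq> {}"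
      then obtain a x y where *: "a \<in> A" "x \<in> K" "y \<in> K" "g i x \<in> U a" "g j y \<in> U a"
        by (auto simp: B_def V_def)
      then have "\<delta> \<le> diameter (U a)"
        using sep[OF that, of x y] diameter_bounded_bound[OF less.prems(3)[OF *(1)], of "g i x" "g j y"] by auto
      with * False show False by auto
    qed
    have ne: "B j \<noteq> {}" if "j \<in> J" for j
    proof -
      obtain x where x: "x \<in> K" using K by blast
      then have "g j x \<in> (\<Union>a\<in>A. U a)" using maps[OF that x] less.prems by blast
      then show ?thesis using x by (auto simp: B_def V_def)
    qed
    have step: "q powr s * \<delta> powr s \<le> (\<Sum>a\<in>B j. diameter (U a) powr s)" if j: "j \<in> J" for j
    proof -
      \<comment> \<open>A second index is what makes the induction descend: the covering sets
        charged to \<open>i\<close> are not in \<open>B j\<close>, and there is at least one of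
        them, so \<open>B j\<close> is a proper subset of \<open>A\<close>.\<close>
      have "\<exists>i\<in>J. i \<noteq> j"
      proof (rule ccontr)
        assume "\<not> ?thesis" then have "J \<subseteq> {j}" by blast
        then show False using J card_mono[of "{j}" J] by simp
      qed
      then obtain i where "i \<in> J" "i \<noteq> j" by blast
      have "B i \<subseteq> A" by (auto simp: B_def)
      then have "B j \<noteq> A" using disj[of i j] ne[of i] j \<open>i \<in> J\<close> \<open>i \<noteq> j\<close> by blast
      then have card: "card (B j) < card A"
        using less.prems by (intro psubset_card_mono) (auto simp: B_def)
      have dV: "dist x y \<le> diameter (U a) / q" if "a \<in> A" "x \<in> V j a" "y \<in> V j a" for x y a
      proof -
        have "q * dist x y \<le> diameter (U a)"
          using exp[OF j, of x y] that diameter_bounded_bound[OF less.prems(3)[OF that(1)], of "g j x" "g j y"]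
          by (auto simp: V_def)
        then show ?thesis using assms(5) by (simp add: field_simps)
      qed
      have bV: "bounded (V j a)" if "a \<in> A" for a
        unfolding bounded_two_points using dV[OF that] by blast
      have diV: "diameter (V j a) \<le> diameter (U a) / q" if "a \<in> A" for a
        by (rule diameter_le_dist) (use dV that diameter_ge_0[OF less.prems(3)[OF that]] assms(5) in auto)
      have "K \<subseteq> (\<Union>a\<in>B j. V j a)"
      proof
        fix x assume x: "x \<in> K"
        then have "g j x \<in> (\<Union>a\<in>A. U a)" using maps[OF j x] less.prems by blast
        then show "x \<in> (\<Union>a\<in>B j. V j a)" using x by (auto simp: B_def V_def)
      qed
      then have "\<delta> powr s \<le> (\<Sum>a\<in>B j. diameter (V j a) powr s)"
        by (intro less.hyps[OF card]) (use finB bV in \<open>auto simp: B_def\<close>)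
      also have "\<dots> \<le> (\<Sum>a\<in>B j. (diameter (U a) / q) powr s)"
        by (intro sum_mono powr_mono2 diV diameter_ge_0 bV) (use assms in \<open>auto simp: B_def\<close>)
      also have "\<dots> = (\<Sum>a\<in>B j. diameter (U a) powr s) / q powr s"
        by (simp add: sum_divide_distrib powr_divide)
      finally show ?thesis using assms(5) by (simp add: field_simps)
    qed
    \<comment> \<open>Pulling back costs the factor \<open>q powr s\<close> for each
      \<open>j\<close>; the premise \<open>big\<close> says that the number of images makes up for
      it.\<close>
    have "\<delta> powr s \<le> card J * q powr s * \<delta> powr s" using mult_right_mono[OF big, of "\<delta> powr s"] by simp
    also have "\<dots> = (\<Sum>j\<in>J. q powr s * \<delta> powr s)" by simp
    also have "\<dots> \<le> (\<Sum>j\<in>J. \<Sum>a\<in>B j. diameter (U a) powr s)" by (intro sum_mono step)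
    also have "\<dots> = (\<Sum>a\<in>(\<Union>j\<in>J. B j). diameter (U a) powr s)"
      by (rule sum.UNION_disjoint[symmetric]) (use J finB disj in auto)
    also have "\<dots> \<le> (\<Sum>a\<in>A. diameter (U a) powr s)"
      by (rule sum_mono2) (use less.prems in \<open>auto simp: B_def\<close>)
    finally show ?thesis .
  qed
qed

text \<open>Room for open covers: a set of diameter \<open>d\<close> can be replaced by its
  \<open>\<eta>\<close>-neighbourhood at arbitrarily small cost.\<close>

lemma powr_enlarge:
  assumes "0 < s" "0 \<le> d" "0 < (e::real)"
  obtains \<eta> where "0 < \<eta>" "(d + 2 * \<eta>) powr s \<le> d powr s + e"
proof -
  have "((\<lambda>\<eta>. (d + 2 * \<eta>) powr s) \<longlongrightarrow> (d + 2 * 0) powr s) (at_right 0)"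
    by (rule tendsto_powr')
       (use assms in \<open>auto intro!: tendsto_eq_intros eventually_mono[OF eventually_at_right_less[of 0]]\<close>)
  then have "\<forall>\<^sub>F \<eta> in at_right 0. (d + 2 * \<eta>) powr s < d powr s + e"
    by (rule order_tendstoD) (use assms in simp)
  then have "\<forall>\<^sub>F \<eta> in at_right 0. 0 < \<eta> \<and> (d + 2 * \<eta>) powr s < d powr s + e"
    using eventually_at_right_less[of 0] by eventually_elim auto
  then obtain \<eta> where "0 < \<eta>" "(d + 2 * \<eta>) powr s < d powr s + e"
    using eventually_happens[of _ "at_right (0::real)"] by auto
  then show thesis by (intro that) auto
qed

text \<open>Compactness reduces countable covers to the finite ones of
  \<open>separated_images_cover_bound\<close>: once the sets are enlarged to open ones, finitely
  many suffice, and their sum cannot fall below \<open>\<delta> powr s\<close>.\<close>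

lemma hausdorff_measure_pos_of_separated_images:
  fixes g :: "'j \<Rightarrow> 'a::metric_space \<Rightarrow> 'a"
  assumes "compact K" and J: "finite J" "2 \<le> card J" and K: "K \<noteq> {}" and "0 < s" "0 < q" "0 < \<delta>"
    and maps: "\<And>j x. \<lbrakk>j \<in> J; x \<in> K\<rbrakk> \<Longrightarrow> g j x \<in> K"
    and exp: "\<And>j x y. \<lbrakk>j \<in> J; x \<in> K; y \<in> K\<rbrakk> \<Longrightarrow> q * dist x y \<le> dist (g j x) (g j y)"
    and sep: "\<And>i j x y. \<lbrakk>i \<in> J; j \<in> J; i \<noteq> j; x \<in> K; y \<in> K\<rbrakk> \<Longrightarrow> \<delta> \<le> dist (g i x) (g j y)"
    and big: "1 \<le> card J * q powr s"
  shows "hausdorff_measure s K \<noteq> 0"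
proof
  assume "hausdorff_measure s K = 0"
  \<comment> \<open>One half of the threshold is for the cover, the other for its
    enlargement.\<close>
  define e where "e = \<delta> powr s / 2"
  have e: "0 < e" using assms by (simp add: e_def)
  have "hausdorff_premeasure s 1 K < ennreal e"
    using \<open>hausdorff_measure s K = 0\<close> hausdorff_premeasure_le_measure[of 1 s K] e by simp
  then obtain U where U: "K \<subseteq> (\<Union>n. U n)" "\<And>n. bounded (U n)" "\<And>n. diameter (U n) \<le> 1"
    "(\<Sum>n. hausdorff_gauge s (U n)) < ennreal e" by (rule hausdorff_premeasure_less) blast
  have "\<exists>\<eta>>0. (diameter (U n) + 2 * \<eta>) powr s \<le> diameter (U n) powr s + e * (1/2) ^ Suc n" for n
    using powr_enlarge[OF \<open>0 < s\<close> diameter_ge_0[OF U(2)[of n]], of "e * (1/2) ^ Suc n"] e by auto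
  then obtain \<eta> where \<eta>: "\<And>n. 0 < \<eta> n"
    "\<And>n. (diameter (U n) + 2 * \<eta> n) powr s \<le> diameter (U n) powr s + e * (1/2) ^ Suc n" by metis
  define V where "V n = (\<Union>x\<in>U n. ball x (\<eta> n))" for n
  have dV: "dist x y \<le> diameter (U n) + 2 * \<eta> n" if xy: "x \<in> V n" "y \<in> V n" for x y n
  proof -
    obtain x' y' where x': "x' \<in> U n" "dist x' x < \<eta> n" and y': "y' \<in> U n" "dist y' y < \<eta> n"
      using xy by (auto simp: V_def)
    have "dist x y \<le> dist x' x + dist x' y' + dist y' y"
      using dist_triangle[of x y x'] dist_triangle[of x' y y'] by (simp add: dist_commute)
    then show ?thesis using x' y' diameter_bounded_bound[OF U(2), of x' n y'] by linarith
  qed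
  have bV: "bounded (V n)" for n unfolding bounded_two_points using dV by blast
  have diV: "diameter (V n) \<le> diameter (U n) + 2 * \<eta> n" for n
    by (rule diameter_le_dist) (use dV \<eta>(1)[of n] diameter_ge_0[OF U(2)[of n]] in auto)
  have sub: "K \<subseteq> (\<Union>n\<in>UNIV. V n)"
  proof
    fix x assume "x \<in> K"
    then obtain n where "x \<in> U n" using U(1) by blast
    then have "x \<in> V n" using \<eta>(1)[of n] by (auto simp: V_def intro!: bexI[of _ x])
    then show "x \<in> (\<Union>n\<in>UNIV. V n)" by blast
  qed
  have "open (V n)" for n by (auto simp: V_def)
  then obtain F where F: "finite F" "K \<subseteq> (\<Union>n\<in>F. V n)"
    using compactE_image[OF \<open>compact K\<close> _ sub] by metis
  have "\<delta> powr s \<le> (\<Sum>n\<in>F. diameter (V n) powr s)"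
    by (rule separated_images_cover_bound[OF J K \<open>0 < s\<close> \<open>0 < q\<close> \<open>0 < \<delta>\<close> maps exp sep big F]) (auto intro: bV)
  also have "\<dots> \<le> (\<Sum>n\<in>F. diameter (U n) powr s + e * (1/2) ^ Suc n)"
  proof (rule sum_mono)
    fix n
    have "diameter (V n) powr s \<le> (diameter (U n) + 2 * \<eta> n) powr s"
      by (intro powr_mono2 diV diameter_ge_0 bV) (use \<open>0 < s\<close> in auto)
    with \<eta>(2) show "diameter (V n) powr s \<le> diameter (U n) powr s + e * (1/2) ^ Suc n" by (rule order_trans[rotated])
  qed
  also have "\<dots> = (\<Sum>n\<in>F. diameter (U n) powr s) + (\<Sum>n\<in>F. e * (1/2) ^ Suc n)" by (rule sum.distrib)
  also have "\<dots> < e + e"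
  proof (rule add_less_le_mono)
    have "hausdorff_gauge s (U n) = ennreal (diameter (U n) powr s)" for n
      using \<open>0 < s\<close> by (simp add: hausdorff_gauge_def)
    then have "ennreal (\<Sum>n\<in>F. diameter (U n) powr s) = (\<Sum>n\<in>F. hausdorff_gauge s (U n))"
      by simp
    also have "\<dots> \<le> (\<Sum>n. hausdorff_gauge s (U n))" by (rule sum_le_suminf) (use F in auto)
    also have "\<dots> < ennreal e" by (rule U)
    finally show "(\<Sum>n\<in>F. diameter (U n) powr s) < e" using e by (simp add: ennreal_less_iff sum_nonneg)
    have sm: "(\<lambda>n. e * (1/2) ^ Suc n) sums (e * 1)" by (rule sums_mult[OF power_half_series])
    have "(\<Sum>n\<in>F. e * (1/2) ^ Suc n) \<le> (\<Sum>n. e * (1/2) ^ Suc n)"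
      by (rule sum_le_suminf) (use F e sm in \<open>auto simp: sums_iff\<close>)
    then show "(\<Sum>n\<in>F. e * (1/2) ^ Suc n) \<le> e" using sm by (simp add: sums_iff)
  qed
  finally show False by (simp add: e_def)
qed

text \<open>Around the points of an \<open>r\<close>-separated set there are copies of
  \<open>K\<close> with ratio \<open>c * r\<close>, and these copies are
  \<open>r/3\<close>-separated. If the set has at least two points and more than
  \<open>(c * r) powr (- s)\<close> of them, \<open>K\<close> has positive measure in exponent
  \<open>s\<close>, which is impossible for \<open>s > t\<close>. So separated sets are small, and
  the balls around a largest one form an economical cover.\<close>

lemma hausdorff_measure_finite_of_small_copies:
  fixes K :: "'a::metric_space set"
  assumes "compact K" "0 \<le> t" and null: "\<And>s. t < s \<Longrightarrow> hausdorff_measure s K = 0" and "0 < c"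
    and copies: "\<And>x r. \<lbrakk>x \<in> K; 0 < r; r < 1\<rbrakk> \<Longrightarrow>
        \<exists>g. (\<forall>y\<in>K. g y \<in> K \<inter> cball x (r/3)) \<and> (\<forall>y\<in>K. \<forall>z\<in>K. c * r * dist y z \<le> dist (g y) (g z))"
  shows "hausdorff_measure t K < top"
proof (cases "K = {}")
  case False
  define sepset where "sepset r P \<longleftrightarrow> finite P \<and> P \<subseteq> K \<and> (\<forall>x\<in>P. \<forall>y\<in>P. x \<noteq> y \<longrightarrow> r \<le> dist x y)" for r and P :: "'a set"
  have card_bound: "card P * (c * r) powr t \<le> 1" if P: "sepset r P" "2 \<le> card P" and r: "0 < r" "r < 1" for P r
  proof -
    have "\<forall>x\<in>P. \<exists>g. (\<forall>y\<in>K. g y \<in> K \<inter> cball x (r/3)) \<and> (\<forall>y\<in>K. \<forall>z\<in>K. c * r * dist y z \<le> dist (g y) (g z))"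
      using P r copies by (auto simp: sepset_def)
    then obtain g where g: "\<And>x y. \<lbrakk>x \<in> P; y \<in> K\<rbrakk> \<Longrightarrow> g x y \<in> K \<inter> cball x (r/3)"
      "\<And>x y z. \<lbrakk>x \<in> P; y \<in> K; z \<in> K\<rbrakk> \<Longrightarrow> c * r * dist y z \<le> dist (g x y) (g x z)" by metis
    have sep: "r/3 \<le> dist (g i x) (g j y)" if "i \<in> P" "j \<in> P" "i \<noteq> j" "x \<in> K" "y \<in> K" for i j x y
    proof -
      have "r \<le> dist i j" using P that by (auto simp: sepset_def)
      moreover have "dist i (g i x) \<le> r/3" "dist j (g j y) \<le> r/3" using g(1)[of i x] g(1)[of j y] that by auto
      moreover have "dist i j \<le> dist i (g i x) + dist (g i x) (g j y) + dist j (g j y)"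
        using dist_triangle[of i j "g i x"] dist_triangle[of "g i x" j "g j y"] by (simp add: dist_commute)
      ultimately show ?thesis by linarith
    qed
    have lt: "card P * (c * r) powr s \<le> 1" if "t < s" for s
    proof (rule ccontr)
      assume "\<not> ?thesis"
      then have "hausdorff_measure s K \<noteq> 0"
        using that \<open>0 \<le> t\<close> \<open>0 < c\<close> r P False g(2) sep \<open>compact K\<close>
        by (intro hausdorff_measure_pos_of_separated_images[where J = P and g = g and q = "c * r" and \<delta> = "r/3"])
           (use g(1) in \<open>auto simp: sepset_def\<close>)
      then show False using null that by simp
    qed
    \<comment> \<open>The bound holds for every \<open>s\<close> above \<open>t\<close>; letting
      \<open>s\<close> fall to \<open>t\<close> gives it for \<open>t\<close>, about which
      \<open>null\<close> says nothing.\<close>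
    have "((\<lambda>s. card P * (c * r) powr s) \<longlongrightarrow> card P * (c * r) powr t) (at_right t)"
      using \<open>0 < c\<close> r by (intro tendsto_intros) auto
    then show ?thesis
      by (rule tendsto_upperbound) (auto intro: eventually_mono[OF eventually_at_right_less] lt)
  qed
  \<comment> \<open>The first term is for separated sets of at most one point, to which
    \<open>card_bound\<close> does not apply; the second comes from replacing \<open>c * r\<close>
    by the diameter \<open>2 * r\<close> of the balls.\<close>
  define B where "B = max (2 powr t) ((2 / c) powr t)"
  have "hausdorff_premeasure t \<delta> K \<le> ennreal B" if \<delta>: "0 < \<delta>" for \<delta>
  proof -
    define r where "r = min (\<delta> / 2) (1 / 2)"
    have r: "0 < r" "r < 1" "2 * r \<le> \<delta>" using \<delta> by (auto simp: r_def)
    \<comment> \<open>Any bound independent of \<open>P\<close> will do here: it guarantees a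
      separated set with the most elements, whose closed \<open>r\<close>-balls then cover
      \<open>K\<close>.\<close>
    have "card P \<le> nat \<lceil>max 1 (1 / (c * r) powr t)\<rceil>" if "sepset r P" for P
    proof (cases "2 \<le> card P")
      case True
      have "real (card P) \<le> 1 / (c * r) powr t"
        using card_bound[OF that True r(1,2)] r \<open>0 < c\<close> by (simp add: field_simps)
      then show ?thesis by linarith
    qed linarith
    moreover have "sepset r {}" by (simp add: sepset_def)
    ultimately have "\<exists>P. sepset r P \<and> (\<forall>Q. sepset r Q \<longrightarrow> card Q \<le> card P)"
      by (intro ex_has_greatest_nat[where b = "Suc (nat \<lceil>max 1 (1 / (c * r) powr t)\<rceil>)"])
         (auto simp: less_Suc_eq_le)
    then obtain P where P: "sepset r P" and max: "\<And>Q. sepset r Q \<Longrightarrow> card Q \<le> card P" by blast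
    have fin: "finite P" using P by (simp add: sepset_def)
    have "K \<subseteq> (\<Union>x\<in>P. cball x r)"
    proof
      fix y assume y: "y \<in> K"
      show "y \<in> (\<Union>x\<in>P. cball x r)"
      proof (rule ccontr)
        assume *: "y \<notin> (\<Union>x\<in>P. cball x r)"
        then have far: "\<And>x. x \<in> P \<Longrightarrow> r < dist x y" by auto
        have nP: "y \<notin> P" using far[of y] r by auto
        have "sepset r (insert y P)" using P y far by (force simp: sepset_def dist_commute)
        from max[OF this] nP fin show False by simp
      qed
    qed
    moreover have diam: "diameter (cball x r) \<le> 2 * r" for x :: 'a
    proof (rule diameter_le_dist)
      fix y z assume "y \<in> cball x r" "z \<in> cball x r"
      then show "dist y z \<le> 2 * r" using dist_triangle3[of y z x] by auto
    qed (use r in simp)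
    ultimately have "hausdorff_premeasure t (2 * r) K \<le> (\<Sum>x\<in>P. hausdorff_gauge t (cball x r))"
      by (intro hausdorff_premeasure_countable_cover[where C = P and U = "\<lambda>x. cball x r"])
         (use fin r in \<open>auto intro: sum_mono2 countable_finite\<close>)
    also have "\<dots> \<le> (\<Sum>x\<in>P. ennreal ((2 * r) powr t))"
      by (intro sum_mono hausdorff_gauge_le diam) (use r \<open>0 \<le> t\<close> in auto)
    also have "\<dots> = ennreal (card P * (2 * r) powr t)" by (simp add: ennreal_mult ennreal_of_nat_eq_real_of_nat)
    also have "\<dots> \<le> ennreal B"
    proof (rule ennreal_leI)
      show "card P * (2 * r) powr t \<le> B"
      proof (cases "2 \<le> card P")
        case True
        have "card P * (2 * r) powr t = card P * (c * r) powr t * (2 / c) powr t"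
          using r \<open>0 < c\<close> by (simp add: mult.assoc flip: powr_mult) (simp add: mult.commute)
        also have "\<dots> \<le> 1 * (2 / c) powr t"
          by (intro mult_right_mono card_bound[OF P True r(1,2)]) auto
        finally show ?thesis by (simp add: B_def)
      next
        case False
        then have "card P * (2 * r) powr t \<le> 1 * (2 * r) powr t" by (intro mult_right_mono) auto
        also have "\<dots> \<le> 2 powr t" using r \<open>0 \<le> t\<close> by (simp add: powr_mono2)
        finally show ?thesis by (simp add: B_def)
      qed
    qed
    finally show ?thesis using hausdorff_premeasure_antimono[OF r(3), of t K] by (rule order_trans[rotated])
  qed
  then have "hausdorff_measure t K \<le> ennreal B" by (rule hausdorff_measure_le)
  then show ?thesis using ennreal_less_top order_le_less_trans by blast
qed simp

section \<open>Density points\<close>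

text \<open>
  Every second of the annuli \<open>D k\<close> around \<open>A\<close> is separated from the others, so metric additivity bounds the
  sum of their measures and no appeal to measurability is needed.
\<close>
lemma hausdorff_measure_near_closed:
  fixes A B :: "'a::metric_space set"
  assumes "0 \<le> s" "closed A" "A \<noteq> {}" "A \<inter> B = {}" "hausdorff_measure s B < top" "0 < (e::real)"
  obtains \<eta> where "0 < \<eta>" "hausdorff_measure s {x \<in> B. infdist x A < \<eta>} \<le> ennreal e"
proof -
  define D where "D k = {x \<in> B. 1 / real (k + 2) \<le> infdist x A \<and> infdist x A < 1 / real (k + 1)}" for k :: nat
  have sep: "\<exists>\<eta>>0. \<forall>x\<in>D i. \<forall>y\<in>D j. \<eta> \<le> dist x y" if "i + 2 \<le> j" for i j
  proof (intro exI conjI ballI)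
    show "0 < 1 / real (i + 2) - 1 / real (i + 3)"
      using frac_less2[of 1 1 "real (i + 2)" "real (i + 3)"] by simp
    fix x y assume "x \<in> D i" "y \<in> D j"
    then have "1 / real (i + 2) \<le> infdist x A" "infdist y A < 1 / real (j + 1)" by (auto simp: D_def)
    moreover have "1 / real (j + 1) \<le> 1 / real (i + 3)" using that by (simp add: field_simps)
    moreover have "infdist x A \<le> infdist y A + dist x y" by (rule infdist_triangle)
    ultimately show "1 / real (i + 2) - 1 / real (i + 3) \<le> dist x y" by linarith
  qed
  have sum_le: "(\<Sum>k<n. hausdorff_measure s (D (2 * k + p))) \<le> hausdorff_measure s B" for n p
  proof -
    have "(\<Sum>k<n. hausdorff_measure s (D (2 * k + p))) \<le> hausdorff_measure s (\<Union>k<n. D (2 * k + p))"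
    proof (rule hausdorff_measure_sum_separated)
      fix i j :: nat assume "i \<noteq> j"
      then consider "2 * i + p + 2 \<le> 2 * j + p" | "2 * j + p + 2 \<le> 2 * i + p" by linarith
      then show "\<exists>\<eta>>0. \<forall>a\<in>D (2 * i + p). \<forall>b\<in>D (2 * j + p). \<eta> \<le> dist a b"
      proof cases
        case 1 then show ?thesis by (rule sep)
      next
        case 2 from sep[OF this] show ?thesis by (metis dist_commute)
      qed
    qed (use assms in auto)
    also have "\<dots> \<le> hausdorff_measure s B" by (rule hausdorff_measure_mono) (auto simp: D_def)
    finally show ?thesis .
  qed
  have split: "(\<Sum>k<2 * n. f k) = (\<Sum>k<n. f (2 * k)) + (\<Sum>k<n. f (2 * k + 1))" for f :: "nat \<Rightarrow> ennreal" and n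
    by (induction n) (auto simp: algebra_simps)
  have "(\<Sum>k. hausdorff_measure s (D k)) \<le> 2 * hausdorff_measure s B"
  proof (rule suminf_le_const[OF summableI])
    fix n
    have "(\<Sum>k<n. hausdorff_measure s (D k)) \<le> (\<Sum>k<2 * n. hausdorff_measure s (D k))"
      by (rule sum_mono2) auto
    also have "\<dots> \<le> hausdorff_measure s B + hausdorff_measure s B"
      unfolding split using sum_le[of 0 n] sum_le[of 1 n] by (intro add_mono) auto
    finally show "(\<Sum>k<n. hausdorff_measure s (D k)) \<le> 2 * hausdorff_measure s B" by (simp add: mult_2)
  qed
  also have "\<dots> < top" using assms by (simp add: ennreal_mult_less_top)
  finally have fin: "(\<Sum>k. hausdorff_measure s (D k)) < top" .
  define b where "b k = enn2real (hausdorff_measure s (D k))" for k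
  have b: "hausdorff_measure s (D k) = ennreal (b k)" "0 \<le> b k" for k
    using ennreal_suminf_lessD[OF fin, of k] by (auto simp: b_def)
  have sb: "summable b" using fin b by (intro summable_suminf_not_top) auto
  obtain N where N: "norm (\<Sum>i. b (i + N)) < e"
    using suminf_exist_split[OF \<open>0 < e\<close> sb] by blast
  \<comment> \<open>Points of \<open>B\<close> at small distance from \<open>A\<close> lie in annuli
    of large index, whose measures are summed by the tail of a convergent series. Distance 0 is
    excluded because \<open>A\<close> is closed and disjoint from \<open>B\<close>.\<close>
  have sub: "{x \<in> B. infdist x A < 1 / real (N + 1)} \<subseteq> (\<Union>k. D (k + N))"
  proof
    fix x assume "x \<in> {x \<in> B. infdist x A < 1 / real (N + 1)}"
    then have x: "x \<in> B" "infdist x A < 1 / real (N + 1)" by auto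
    have "0 < infdist x A" using x assms infdist_pos_not_in_closed[of A x] by auto
    then obtain m where m: "1 / real (Suc m) < infdist x A"
      using reals_Archimedean by (metis inverse_eq_divide)
    have "1 / real (m + 2) \<le> 1 / real (Suc m)" by (simp add: field_simps)
    with m have ex: "\<exists>k. 1 / real (k + 2) \<le> infdist x A" by (intro exI[of _ m]) linarith
    define k where "k = (LEAST k. 1 / real (k + 2) \<le> infdist x A)"
    have k: "1 / real (k + 2) \<le> infdist x A" unfolding k_def using ex by (rule LeastI_ex)
    have "N \<le> k"
    proof (rule ccontr)
      assume "\<not> ?thesis"
      then have "1 / real (N + 1) \<le> 1 / real (k + 2)" by (simp add: field_simps)
      with k x show False by linarith
    qed
    moreover have "infdist x A < 1 / real (k + 1)"
    proof (cases k)
      case 0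
      have "1 / real (N + 1) \<le> 1" by simp
      with x have "infdist x A < 1" by linarith
      with 0 show ?thesis by simp
    next
      case (Suc j)
      have "\<not> 1 / real (j + 2) \<le> infdist x A"
        by (rule not_less_Least) (use Suc in \<open>simp add: k_def\<close>)
      then show ?thesis using Suc by simp
    qed
    ultimately have "x \<in> D (k - N + N)" using k x by (auto simp: D_def)
    then show "x \<in> (\<Union>k. D (k + N))" by blast
  qed
  have "hausdorff_measure s {x \<in> B. infdist x A < 1 / real (N + 1)} \<le> hausdorff_measure s (\<Union>k. D (k + N))"
    by (rule hausdorff_measure_mono[OF sub])
  also have "\<dots> \<le> (\<Sum>k. hausdorff_measure s (D (k + N)))" by (rule hausdorff_measure_UN_le)
  also have "\<dots> = ennreal (\<Sum>k. b (k + N))"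
    unfolding b by (rule suminf_ennreal2) (use b sb in auto)
  also have "\<dots> \<le> ennreal e" using N by (intro ennreal_leI) auto
  finally show thesis by (intro that[of "1 / real (N + 1)"]) auto
qed

text \<open>Vitali's covering lemma gives disjoint balls around points of \<open>A'\<close>, each
  carrying \<open>B\<close>-measure at least \<open>c * r powr s\<close>. All of this measure sits
  in a thin neighbourhood of \<open>A\<close>, where \<open>B\<close> has little of it, so the sum
  of the \<open>r powr s\<close> is small. The balls enlarged five times cover
  \<open>A'\<close>.\<close>

lemma hausdorff_measure_null_of_density:
  fixes A B :: "'a::euclidean_space set"
  assumes "0 \<le> s" "closed A" "A \<inter> B = {}" "hausdorff_measure s B < top" "0 < c" "A' \<subseteq> A"
    and dens: "\<And>x r0. \<lbrakk>x \<in> A'; 0 < r0\<rbrakk> \<Longrightarrow>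
        \<exists>r. 0 < r \<and> r < r0 \<and> ennreal (c * r powr s) \<le> hausdorff_measure s (B \<inter> cball x r)"
  shows "hausdorff_measure s A' = 0"
proof (cases "A' = {}")
  case False
  have main: "hausdorff_premeasure s \<delta> A' \<le> ennreal (10 powr s / c * e)" if "0 < \<delta>" "0 < e" for \<delta> e :: real
  proof -
    obtain \<eta> where \<eta>: "0 < \<eta>" "hausdorff_measure s {x \<in> B. infdist x A < \<eta>} \<le> ennreal e"
      using hausdorff_measure_near_closed[OF assms(1,2) _ assms(3,4) \<open>0 < e\<close>] False assms(6) by blast
    define K where "K = {(x, r). x \<in> A' \<and> 0 < r \<and> r < min \<eta> (\<delta> / 10) \<and>
        ennreal (c * r powr s) \<le> hausdorff_measure s (B \<inter> cball x r)}"
    have cov: "A' \<subseteq> (\<Union>i\<in>K. cball (fst i) (snd i))"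
    proof
      fix x assume x: "x \<in> A'"
      obtain r where "0 < r" "r < min \<eta> (\<delta> / 10)" "ennreal (c * r powr s) \<le> hausdorff_measure s (B \<inter> cball x r)"
        using dens[OF x, of "min \<eta> (\<delta> / 10)"] \<eta> \<open>0 < \<delta>\<close> by auto
      then have "(x, r) \<in> K" "x \<in> cball x r" using x by (auto simp: K_def)
      then show "x \<in> (\<Union>i\<in>K. cball (fst i) (snd i))" by force
    qed
    have rad: "\<And>i. i \<in> K \<Longrightarrow> 0 < snd i \<and> snd i \<le> \<delta> / 10" by (auto simp: K_def)
    obtain C where C: "countable C" "C \<subseteq> K"
       "pairwise (\<lambda>i j. disjnt (cball (fst i) (snd i)) (cball (fst j) (snd j))) C"
       "A' \<subseteq> (\<Union>i\<in>C. cball (fst i) (5 * snd i))"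
      by (rule Vitali_covering_lemma_cballs[OF cov rad])
    show ?thesis
    proof (rule hausdorff_premeasure_countable_cover[OF C(1,4)])
      have diam: "diameter (cball (fst i) (5 * snd i)) \<le> 10 * snd i" if "i \<in> C" for i
        using that C(2) by (auto simp: K_def)
      show "diameter (cball (fst i) (5 * snd i)) \<le> \<delta>" if "i \<in> C" for i
        using diam[OF that] that C(2) by (auto simp: K_def)
      fix F assume F: "finite F" "F \<subseteq> C"
      have "ennreal (c * (\<Sum>i\<in>F. snd i powr s)) = (\<Sum>i\<in>F. ennreal (c * snd i powr s))"
        using \<open>0 < c\<close> by (simp add: sum_distrib_left)
      also have "\<dots> \<le> (\<Sum>i\<in>F. hausdorff_measure s (B \<inter> cball (fst i) (snd i)))"
        using F C(2) by (intro sum_mono) (auto simp: K_def)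
      also have "\<dots> \<le> hausdorff_measure s (\<Union>i\<in>F. B \<inter> cball (fst i) (snd i))"
      proof (rule hausdorff_measure_sum_separated[OF assms(1) F(1)])
        fix i j assume ij: "i \<in> F" "j \<in> F" "i \<noteq> j"
        have disj: "cball (fst i) (snd i) \<inter> cball (fst j) (snd j) = {}"
          using C(3) F(2) ij by (auto simp: pairwise_def disjnt_def)
        \<comment> \<open>Disjoint closed balls are compact, hence at positive distance, so their
          \<open>B\<close>-measures add up.\<close>
        obtain d where "0 < d" "\<forall>x\<in>cball (fst i) (snd i). \<forall>y\<in>cball (fst j) (snd j). d \<le> dist x y"
          using separate_compact_closed[OF _ _ disj] by auto
        then show "\<exists>\<eta>>0. \<forall>a\<in>B \<inter> cball (fst i) (snd i). \<forall>b\<in>B \<inter> cball (fst j) (snd j). \<eta> \<le> dist a b" by blast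
      qed
      also have "\<dots> \<le> hausdorff_measure s {x \<in> B. infdist x A < \<eta>}"
      proof (rule hausdorff_measure_mono, clarify)
        fix i x assume "i \<in> F" "x \<in> B" "x \<in> cball (fst i) (snd i)"
        moreover have "i \<in> K" using \<open>i \<in> F\<close> F C(2) by blast
        ultimately have "infdist x A \<le> dist x (fst i)" "dist x (fst i) < \<eta>"
          using assms(6) by (auto simp: K_def dist_commute intro!: infdist_le)
        then show "infdist x A < \<eta>" by linarith
      qed
      also have "\<dots> \<le> ennreal e" by (rule \<eta>)
      finally have *: "c * (\<Sum>i\<in>F. snd i powr s) \<le> e" using \<open>0 < e\<close> by simp
      have "(\<Sum>i\<in>F. hausdorff_gauge s (cball (fst i) (5 * snd i))) \<le> (\<Sum>i\<in>F. ennreal ((10 * snd i) powr s))"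
        using F C(2) by (intro sum_mono hausdorff_gauge_le diam) (auto simp: K_def assms(1))
      also have "\<dots> = ennreal (10 powr s * (\<Sum>i\<in>F. snd i powr s))"
        by (simp add: powr_mult sum_distrib_left)
      also have "\<dots> \<le> ennreal (10 powr s / c * e)"
        using \<open>0 < c\<close> mult_left_mono[OF *, of "10 powr s"]
        by (intro ennreal_leI) (simp add: field_simps)
      finally show "(\<Sum>i\<in>F. hausdorff_gauge s (cball (fst i) (5 * snd i))) \<le> ennreal (10 powr s / c * e)" .
    qed (use \<open>0 < \<delta>\<close> in auto)
  qed
  have "hausdorff_measure s A' \<le> 0"
  proof (rule ennreal_le_epsilon)
    fix e :: real assume "0 < e"
    have "hausdorff_measure s A' \<le> ennreal (10 powr s / c * (e * c / 10 powr s))"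
      by (intro hausdorff_measure_le main) (use \<open>0 < e\<close> \<open>0 < c\<close> in auto)
    then show "hausdorff_measure s A' \<le> 0 + ennreal e" using \<open>0 < c\<close> by simp
  qed
  then show ?thesis by simp
qed simp

text \<open>For each constant \<open>1 / Suc k\<close> the exceptional points form a null set, and
  countably many null sets cannot exhaust \<open>A\<close>. Smallness is measured against
  \<open>r powr s\<close>, not against the measure of \<open>A\<close> in the ball: in this form it
  contradicts the presence in \<open>B\<close> of a whole cylinder of size comparable to
  \<open>r\<close>.\<close>

lemma hausdorff_measure_density_point:
  fixes A B :: "'a::euclidean_space set"
  assumes "0 \<le> s" "closed A" "A \<inter> B = {}" "hausdorff_measure s B < top" "hausdorff_measure s A \<noteq> 0"
  obtains x where "x \<in> A"
    "\<And>c. 0 < c \<Longrightarrow> \<exists>r0>0. \<forall>r. 0 < r \<and> r < r0 \<longrightarrow> hausdorff_measure s (B \<inter> cball x r) < ennreal (c * r powr s)"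
proof -
  define P where "P k x \<longleftrightarrow> (\<exists>r0>0. \<forall>r. 0 < r \<and> r < r0 \<longrightarrow>
      hausdorff_measure s (B \<inter> cball x r) < ennreal (1 / real (Suc k) * r powr s))" for k x
  have "hausdorff_measure s {x \<in> A. \<not> P k x} = 0" for k
  proof (rule hausdorff_measure_null_of_density[OF assms(1-4), of "1 / real (Suc k)"])
    fix x r0 assume "x \<in> {x \<in> A. \<not> P k x}" "0 < (r0::real)"
    then show "\<exists>r. 0 < r \<and> r < r0 \<and> ennreal (1 / real (Suc k) * r powr s) \<le> hausdorff_measure s (B \<inter> cball x r)"
      unfolding P_def mem_Collect_eq by (metis linorder_not_less)
  qed auto
  then have "hausdorff_measure s (\<Union>k\<in>UNIV. {x \<in> A. \<not> P k x}) = 0"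
    by (intro hausdorff_measure_null_UN) auto
  moreover have "A \<subseteq> (\<Union>k\<in>UNIV. {x \<in> A. \<not> P k x})" if "\<not> (\<exists>x\<in>A. \<forall>k. P k x)" using that by blast
  ultimately obtain x where x: "x \<in> A" "\<And>k. P k x"
    using hausdorff_measure_mono[of A _ s] assms(5) by (metis le_zero_eq)
  show thesis
  proof (rule that[OF x(1)])
    fix c :: real assume "0 < c"
    then obtain k where k: "1 / real (Suc k) < c" using reals_Archimedean by (metis inverse_eq_divide)
    obtain r0 where r0: "0 < r0" "\<And>r. 0 < r \<Longrightarrow> r < r0 \<Longrightarrow>
        hausdorff_measure s (B \<inter> cball x r) < ennreal (1 / real (Suc k) * r powr s)"
      using x(2)[of k] unfolding P_def by blast
    have "hausdorff_measure s (B \<inter> cball x r) < ennreal (c * r powr s)" if "0 < r" "r < r0" for r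
      using r0(2)[OF that]
      by (rule less_le_trans) (use k in \<open>intro ennreal_leI mult_right_mono, auto\<close>)
    then show "\<exists>r0>0. \<forall>r. 0 < r \<and> r < r0 \<longrightarrow> hausdorff_measure s (B \<inter> cball x r) < ennreal (c * r powr s)"
      using r0(1) by blast
  qed
qed

section \<open>Limit sets and codings\<close>

lemma word_map_Nil [simp]: "word_map \<phi> [] = id"
  by (simp add: word_map_def)

lemma word_map_Cons [simp]: "word_map \<phi> (i # w) = \<phi> i \<circ> word_map \<phi> w"
  by (simp add: word_map_def)

lemma word_map_append: "word_map \<phi> (v @ w) = word_map \<phi> v \<circ> word_map \<phi> w"
  by (induction v) (auto simp: comp_assoc)

locale limit_set_ifs =
  fixes I :: "'i set" and \<phi> :: "'i \<Rightarrow> 'a::euclidean_space \<Rightarrow> 'a" and X E :: "'a set"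
  assumes fin_I: "finite I" and I_ne: "I \<noteq> {}"
    and compact_X: "compact X" and X_ne: "X \<noteq> {}"
    and maps_X: "\<And>i x. i \<in> I \<Longrightarrow> x \<in> X \<Longrightarrow> \<phi> i x \<in> X"
    and cont: "\<And>i. i \<in> I \<Longrightarrow> continuous_on X (\<phi> i)"
    and diam_to_0: "\<And>\<epsilon>::real. 0 < \<epsilon> \<Longrightarrow>
           \<exists>N. \<forall>w \<in> lists I. N \<le> length w \<longrightarrow> diameter (word_map \<phi> w ` X) < \<epsilon>"
    and E_def: "E = limit_set I \<phi> X"
begin

lemma word_maps_X: "w \<in> lists I \<Longrightarrow> x \<in> X \<Longrightarrow> word_map \<phi> w x \<in> X"
  by (induction w) (auto simp: maps_X)

lemma word_cont: "w \<in> lists I \<Longrightarrow> continuous_on X (word_map \<phi> w)"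
proof (induction w)
  case (Cons i w)
  then have "continuous_on (word_map \<phi> w ` X) (\<phi> i)"
    by (intro continuous_on_subset[OF cont] image_subsetI word_maps_X) auto
  with Cons show ?case unfolding word_map_Cons by (intro continuous_on_compose) auto
qed (auto simp: continuous_on_id)

lemma compact_word_image: "w \<in> lists I \<Longrightarrow> compact (word_map \<phi> w ` X)"
  by (rule compact_continuous_image[OF word_cont compact_X])

abbreviation prefix :: "(nat \<Rightarrow> 'i) \<Rightarrow> nat \<Rightarrow> 'i list" where
  "prefix h n \<equiv> map h [0..<n]"

lemma prefix_in_lists: "(\<And>n. h n \<in> I) \<Longrightarrow> prefix h n \<in> lists I"
  by auto

lemma ex1_coded_point:
  assumes h: "\<And>n. h n \<in> I"
  shows "\<exists>x. (\<Inter>n\<in>{1..}. word_map \<phi> (prefix h n) ` X) = {x}"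
proof -
  let ?F = "\<lambda>n. word_map \<phi> (prefix h n) ` X"
  have step: "?F (Suc n) \<subseteq> ?F n" for n
    using maps_X h by (auto simp: word_map_append)
  have dec: "?F n \<subseteq> ?F m" if "m \<le> n" for m n
    using that by (rule lift_Suc_antimono_le[of ?F, OF step])
  have "\<Inter> (range ?F) \<noteq> {}"
    using h X_ne by (intro compact_nest dec compact_word_image) auto
  then obtain x where x: "\<And>n. x \<in> ?F n" by blast
  have "y = x" if y: "\<And>n. 1 \<le> n \<Longrightarrow> y \<in> ?F n" for y
  proof (rule ccontr)
    assume "y \<noteq> x"
    then obtain N where N: "\<And>w. w \<in> lists I \<Longrightarrow> N \<le> length w \<Longrightarrow> diameter (word_map \<phi> w ` X) < dist y x"
      using diam_to_0[of "dist y x"] by auto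
    have "diameter (?F (Suc N)) < dist y x" using h by (intro N) auto
    moreover have "dist y x \<le> diameter (?F (Suc N))"
      using y[of "Suc N"] x[of "Suc N"] h
      by (intro diameter_bounded_bound compact_imp_bounded compact_word_image) auto
    ultimately show False by simp
  qed
  with x have "(\<Inter>n\<in>{1..}. ?F n) = {x}" by fastforce
  then show ?thesis by blast
qed

lemma proj_eqI:
  assumes h: "\<And>n. h n \<in> I" and "\<And>n. x \<in> word_map \<phi> (prefix h n) ` X"
  shows "ifs_proj \<phi> X h = x"
proof -
  obtain y where y: "(\<Inter>n\<in>{1..}. word_map \<phi> (prefix h n) ` X) = {y}"
    using ex1_coded_point[OF h] ..
  have "x \<in> {y}" unfolding y[symmetric] using assms(2) by blast
  then show ?thesis unfolding ifs_proj_def y by simp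
qed

lemma proj_mem:
  assumes h: "\<And>n. h n \<in> I"
  shows "ifs_proj \<phi> X h \<in> word_map \<phi> (prefix h n) ` X"
proof -
  obtain y where y: "(\<Inter>n\<in>{1..}. word_map \<phi> (prefix h n) ` X) = {y}"
    using ex1_coded_point[OF h] ..
  have "y \<in> (\<Inter>n\<in>{1..}. word_map \<phi> (prefix h n) ` X)" unfolding y by simp
  then have "y \<in> word_map \<phi> (prefix h (Suc n)) ` X" by (rule INT_D) simp
  then have "y \<in> word_map \<phi> (prefix h n) ` X"
    using maps_X h by (auto simp: word_map_append)
  then show ?thesis unfolding ifs_proj_def y the_elem_eq .
qed

lemma prefix_Suc: "prefix h (Suc n) = h 0 # prefix (\<lambda>k. h (Suc k)) n"
  by (induction n) auto

lemma proj_shift: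
  assumes h: "\<And>n. h n \<in> I"
  shows "ifs_proj \<phi> X h = \<phi> (h 0) (ifs_proj \<phi> X (\<lambda>k. h (Suc k)))"
proof (rule proj_eqI[OF h])
  fix n
  let ?p = "ifs_proj \<phi> X (\<lambda>k. h (Suc k))"
  show "\<phi> (h 0) ?p \<in> word_map \<phi> (prefix h n) ` X"
  proof (cases n)
    case 0
    have "?p \<in> X" using proj_mem[of "\<lambda>k. h (Suc k)" 0] h by simp
    then show ?thesis using 0 maps_X h by auto
  next
    case (Suc m)
    have "?p \<in> word_map \<phi> (prefix (\<lambda>k. h (Suc k)) m) ` X" by (rule proj_mem) (rule h)
    then have "\<phi> (h 0) ?p \<in> word_map \<phi> (h 0 # prefix (\<lambda>k. h (Suc k)) m) ` X" by auto
    then show ?thesis unfolding Suc prefix_Suc .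
  qed
qed

lemma E_sub_X: "E \<subseteq> X"
  using proj_mem[of _ 0] by (auto simp: E_def limit_set_def)

lemma proj_in_E: "(\<And>n. h n \<in> I) \<Longrightarrow> ifs_proj \<phi> X h \<in> E"
  by (simp add: E_def limit_set_def)

lemma E_ne: "E \<noteq> {}"
proof -
  obtain i where "i \<in> I" using I_ne by blast
  then have "ifs_proj \<phi> X (\<lambda>_. i) \<in> E" by (rule proj_in_E)
  then show ?thesis by blast
qed

lemma maps_E: "i \<in> I \<Longrightarrow> x \<in> E \<Longrightarrow> \<phi> i x \<in> E"
proof -
  assume i: "i \<in> I" and "x \<in> E"
  then obtain h where h: "\<And>n. h n \<in> I" "x = ifs_proj \<phi> X h" by (auto simp: E_def limit_set_def)
  let ?g = "case_nat i h"
  have g: "?g n \<in> I" for n using i h by (cases n) auto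
  have "ifs_proj \<phi> X ?g = \<phi> i x" using proj_shift[of ?g] g h by simp
  then show "\<phi> i x \<in> E" using proj_in_E[of ?g] g by simp
qed

lemma word_maps_E: "w \<in> lists I \<Longrightarrow> x \<in> E \<Longrightarrow> word_map \<phi> w x \<in> E"
  by (induction w) (auto simp: maps_E)

lemma E_split: "x \<in> E \<Longrightarrow> \<exists>i\<in>I. \<exists>y\<in>E. x = \<phi> i y"
proof -
  assume "x \<in> E"
  then obtain h where h: "\<And>n. h n \<in> I" "x = ifs_proj \<phi> X h" by (auto simp: E_def limit_set_def)
  have "ifs_proj \<phi> X (\<lambda>k. h (Suc k)) \<in> E" by (rule proj_in_E) (rule h)
  moreover have "x = \<phi> (h 0) (ifs_proj \<phi> X (\<lambda>k. h (Suc k)))"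
    unfolding h(2) by (rule proj_shift) (rule h)
  ultimately show ?thesis using h(1) by blast
qed

lemma address_of_backward_orbit:
  assumes "\<And>n. h n \<in> I" "\<And>n. x n = \<phi> (h n) (x (Suc n))"
  shows "x 0 = word_map \<phi> (prefix h n) (x n)"
  by (induction n) (auto simp: word_map_append assms(2)[symmetric])

text \<open>Stated for an arbitrary set \<open>S\<close> covered by its own images, so that it
  serves for \<open>E\<close> and, in \<open>compact_E\<close>, for the closure of \<open>E\<close>
  before that is known to be \<open>E\<close>.\<close>

lemma backward_orbit:
  assumes "\<And>x. x \<in> S \<Longrightarrow> \<exists>i\<in>I. \<exists>y\<in>S. x = \<phi> i y" "x \<in> S"
  obtains h y where "\<And>n. h n \<in> I" "\<And>n. y n \<in> S" "\<And>n. x = word_map \<phi> (prefix h n) (y n)"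
proof -
  have "\<exists>f. \<forall>n. (f n \<in> S \<and> (n = 0 \<longrightarrow> f n = x)) \<and> (\<exists>i\<in>I. f n = \<phi> i (f (Suc n)))"
    by (rule dependent_nat_choice) (use assms(2) in blast, metis assms(1) nat.distinct(2))
  then obtain y where y: "\<And>n. y n \<in> S" "y 0 = x" "\<And>n. \<exists>i\<in>I. y n = \<phi> i (y (Suc n))" by metis
  then obtain h where h: "\<And>n. h n \<in> I" "\<And>n. y n = \<phi> (h n) (y (Suc n))" by metis
  show thesis
    using that[of h y] h y address_of_backward_orbit[of h y, OF h] by metis
qed

lemma address:
  assumes "x \<in> E"
  obtains h y where "\<And>n. h n \<in> I" "\<And>n. y n \<in> E" "\<And>n. x = word_map \<phi> (prefix h n) (y n)"
  using backward_orbit[OF E_split assms] by blast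

text \<open>The closure of \<open>E\<close> is still covered by its images under the
  \<open>\<phi> i\<close>, so each of its points has a backward orbit that stays in it. The letters
  chosen along the orbit code the point, which therefore lies in \<open>E\<close>.\<close>

lemma compact_E: "compact E"
proof -
  have sub: "closure E \<subseteq> X"
    using E_sub_X compact_X compact_imp_closed closure_minimal by blast
  then have comp: "compact (closure E)"
    by (metis closed_closure compact_Int_closed compact_X inf.absorb2)
  have "closed (\<Union>i\<in>I. \<phi> i ` closure E)"
    using comp sub cont fin_I
    by (intro closed_UN ballI compact_imp_closed compact_continuous_image) (auto intro: continuous_on_subset)
  moreover have "E \<subseteq> (\<Union>i\<in>I. \<phi> i ` closure E)"
    using E_split closure_subset by fast
  ultimately have split: "closure E \<subseteq> (\<Union>i\<in>I. \<phi> i ` closure E)" by (rule closure_minimal[rotated])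
  have "closure E \<subseteq> E"
  proof
    fix x assume "x \<in> closure E"
    with split obtain h y where h: "\<And>n. h n \<in> I" "\<And>n. y n \<in> closure E" "\<And>n. x = word_map \<phi> (prefix h n) (y n)"
      using backward_orbit[of "closure E" x] by blast
    have "ifs_proj \<phi> X h = x"
      using h sub by (intro proj_eqI) blast+
    then show "x \<in> E" using proj_in_E[of h] h(1) by simp
  qed
  then show ?thesis using comp closure_subset by (metis subset_antisym)
qed

end

section \<open>Derivatives along words\<close>

primrec word_deriv ::
  "('i \<Rightarrow> 'a \<Rightarrow> 'a) \<Rightarrow> ('i \<Rightarrow> 'a \<Rightarrow> 'a \<Rightarrow>\<^sub>L 'a::real_normed_vector) \<Rightarrow> 'i list \<Rightarrow> 'a \<Rightarrow> 'a \<Rightarrow>\<^sub>L 'a" where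
  "word_deriv \<phi> D [] y = id_blinfun"
| "word_deriv \<phi> D (i # w) y = D i (word_map \<phi> w y) o\<^sub>L word_deriv \<phi> D w y"

lemma word_deriv_append:
  "word_deriv \<phi> D (v @ w) y = word_deriv \<phi> D v (word_map \<phi> w y) o\<^sub>L word_deriv \<phi> D w y"
  by (induction v) (auto simp: word_map_append intro!: blinfun_eqI)

text \<open>Identifies the operator norm of a similarity with its ratio, so that norms of
  compositions of similarities multiply exactly and not just up to an inequality.\<close>

lemma norm_blinfun_conformal:
  fixes f :: "'a::euclidean_space \<Rightarrow>\<^sub>L 'b::real_normed_vector"
  assumes "\<And>v. norm (blinfun_apply f v) = c * norm v"
  shows "norm f = c"
proof -
  obtain b :: 'a where "b \<in> Basis" using nonempty_Basis by blast
  then have b: "norm b = 1" by simp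
  show ?thesis
  proof (rule norm_blinfun_eqI)
    show "0 \<le> c" using assms[of b] b by (metis mult.right_neutral norm_ge_zero)
    show "c \<le> norm (blinfun_apply f b) / norm b" using assms b by simp
  qed (simp add: assms)
qed

section \<open>Bounded distortion\<close>

text \<open>The derivative estimates are required on balls around points of \<open>X\<close>, since
  the mean value inequality works on convex sets and \<open>X\<close> is not assumed convex.
  Conformality and the lower bound \<open>\<sigma>\<close> are required on \<open>E\<close>
  alone.\<close>

locale distortion_ifs = limit_set_ifs I \<phi> X E
  for I :: "'i set" and \<phi> :: "'i \<Rightarrow> 'a::euclidean_space \<Rightarrow> 'a" and X E :: "'a set" +
  fixes D :: "'i \<Rightarrow> 'a \<Rightarrow> 'a \<Rightarrow>\<^sub>L 'a" and \<rho> s \<sigma> K :: real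
  assumes \<rho>: "0 < \<rho>" and s: "0 < s" "s < 1" and \<sigma>: "0 < \<sigma>" and K: "0 \<le> K"
    and deriv: "\<And>i x y. \<lbrakk>i \<in> I; x \<in> X; y \<in> ball x \<rho>\<rbrakk> \<Longrightarrow> (\<phi> i has_derivative blinfun_apply (D i y)) (at y)"
    and norm_D: "\<And>i x y. \<lbrakk>i \<in> I; x \<in> X; y \<in> ball x \<rho>\<rbrakk> \<Longrightarrow> norm (D i y) \<le> s"
    and lip_D: "\<And>i x y z. \<lbrakk>i \<in> I; x \<in> X; y \<in> ball x \<rho>; z \<in> ball x \<rho>\<rbrakk> \<Longrightarrow> norm (D i y - D i z) \<le> K * norm (y - z)"
    and conf: "\<And>i x v. \<lbrakk>i \<in> I; x \<in> E\<rbrakk> \<Longrightarrow> norm (blinfun_apply (D i x) v) = norm (D i x) * norm v"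
    and low: "\<And>i x. \<lbrakk>i \<in> I; x \<in> E\<rbrakk> \<Longrightarrow> \<sigma> \<le> norm (D i x)"
begin

abbreviation dw :: "'i list \<Rightarrow> 'a \<Rightarrow> 'a \<Rightarrow>\<^sub>L 'a" where "dw \<equiv> word_deriv \<phi> D"

abbreviation wm :: "'i list \<Rightarrow> 'a \<Rightarrow> 'a" where "wm \<equiv> word_map \<phi>"

abbreviation lam :: "'i list \<Rightarrow> 'a \<Rightarrow> real" where "lam w x \<equiv> norm (dw w x)"

lemma contract:
  assumes "i \<in> I" "x \<in> X" "y \<in> ball x \<rho>" "z \<in> ball x \<rho>"
  shows "dist (\<phi> i y) (\<phi> i z) \<le> s * dist y z"
  unfolding dist_norm
proof (rule differentiable_bound[OF convex_ball])
  fix u assume u: "u \<in> ball x \<rho>"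
  show "(\<phi> i has_derivative blinfun_apply (D i u)) (at u within ball x \<rho>)"
    using deriv[OF assms(1,2) u] by (rule has_derivative_at_withinI)
  show "onorm (blinfun_apply (D i u)) \<le> s"
    using norm_D[OF assms(1,2) u] by (simp add: norm_blinfun.rep_eq)
qed (use assms in auto)

text \<open>Both claims go through one induction: the next map is known to contract only on balls
  around points of \<open>X\<close>, so the image of the ball has to stay in such a ball.\<close>

lemma word_contract:
  assumes "w \<in> lists I" "x \<in> X" "y \<in> ball x \<rho>" "z \<in> ball x \<rho>"
  shows "dist (wm w y) (wm w z) \<le> s ^ length w * dist y z"
    and "wm w y \<in> ball (wm w x) \<rho>"
proof -
  have "(\<forall>y\<in>ball x \<rho>. \<forall>z\<in>ball x \<rho>. dist (wm w y) (wm w z) \<le> s ^ length w * dist y z) \<and>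
        (\<forall>y\<in>ball x \<rho>. wm w y \<in> ball (wm w x) \<rho>)"
    using assms(1)
  proof (induction w)
    case (Cons i w)
    then have i: "i \<in> I" and w: "w \<in> lists I" by auto
    note IH = Cons.IH
    have xX: "wm w x \<in> X" using w assms by (simp add: word_maps_X)
    have A: "dist (wm (i # w) y) (wm (i # w) z) \<le> s ^ length (i # w) * dist y z"
      if "y \<in> ball x \<rho>" "z \<in> ball x \<rho>" for y z
    proof -
      have "dist (wm (i # w) y) (wm (i # w) z) \<le> s * dist (wm w y) (wm w z)"
        using contract[OF i xX, of "wm w y" "wm w z"] IH that by auto
      also have "\<dots> \<le> s * (s ^ length w * dist y z)"
        using IH that s by (intro mult_left_mono) auto
      finally show ?thesis by (simp add: mult.assoc)
    qed
    moreover have "wm (i # w) y \<in> ball (wm (i # w) x) \<rho>" if "y \<in> ball x \<rho>" for y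
    proof -
      have "dist (wm (i # w) x) (wm (i # w) y) \<le> s ^ length (i # w) * dist x y"
        using A[of x y] that \<rho> by simp
      also have "\<dots> \<le> 1 * dist x y" using s by (intro mult_right_mono power_le_one) auto
      finally show ?thesis using that by auto
    qed
    ultimately show ?case by blast
  qed auto
  with assms show "dist (wm w y) (wm w z) \<le> s ^ length w * dist y z" "wm w y \<in> ball (wm w x) \<rho>"
    by auto
qed

lemma word_has_derivative:
  assumes "w \<in> lists I" "x \<in> X" "y \<in> ball x \<rho>"
  shows "(wm w has_derivative blinfun_apply (dw w y)) (at y)"
  using assms(1)
proof (induction w)
  case Nil
  then show ?case by (simp add: id_def)
next
  case (Cons i w)
  then have "(\<phi> i has_derivative blinfun_apply (D i (wm w y))) (at (wm w y))"
    using assms by (intro deriv[of i "wm w x"] word_maps_X word_contract(2)) auto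
  with Cons have "(\<phi> i \<circ> wm w has_derivative blinfun_apply (D i (wm w y)) \<circ> blinfun_apply (dw w y)) (at y)"
    by (intro diff_chain_at) auto
  then show ?case by (simp add: o_def)
qed

text \<open>\<open>E\<close> is invariant, so along the orbit of a point of \<open>E\<close> every
  factor of the chain rule is a similarity.\<close>

lemma dw_conformal:
  assumes "w \<in> lists I" "x \<in> E"
  shows "norm (blinfun_apply (dw w x) v) = lam w x * norm v"
  using assms(1)
proof (induction w arbitrary: v)
  case (Cons i w)
  then have *: "norm (blinfun_apply (dw (i # w) x) v) = norm (D i (wm w x)) * lam w x * norm v" for v
    using assms by (simp add: conf word_maps_E)
  show ?case using norm_blinfun_conformal[OF *] * by simp
qed simp

lemma lam_append:
  assumes "v \<in> lists I" "w \<in> lists I" "x \<in> E"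
  shows "lam (v @ w) x = lam v (wm w x) * lam w x"
  by (rule norm_blinfun_conformal)
     (use assms in \<open>simp add: word_deriv_append dw_conformal word_maps_E\<close>)

lemma lam_Cons:
  assumes "i \<in> I" "w \<in> lists I" "x \<in> E"
  shows "lam (i # w) x = norm (D i (wm w x)) * lam w x"
  by (rule norm_blinfun_conformal)
     (use assms in \<open>simp add: dw_conformal conf word_maps_E\<close>)

lemma lam_bounds:
  assumes "w \<in> lists I" "x \<in> E"
  shows "\<sigma> ^ length w \<le> lam w x" "lam w x \<le> s ^ length w" "0 < lam w x"
proof -
  have "\<sigma> ^ length w \<le> lam w x \<and> lam w x \<le> s ^ length w"
    using assms(1)
  proof (induction w)
    case (Cons i w)
    have E: "wm w x \<in> E" using Cons assms by (simp add: word_maps_E)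
    have "norm (D i (wm w x)) \<le> s" using E Cons E_sub_X \<rho> by (intro norm_D[of i "wm w x"]) auto
    with Cons assms show ?case
      using low[OF _ E, of i] \<sigma> by (auto simp: lam_Cons simp del: word_deriv.simps intro!: mult_mono)
  qed simp
  then show "\<sigma> ^ length w \<le> lam w x" "lam w x \<le> s ^ length w" by auto
  then show "0 < lam w x" using \<sigma> by (meson less_le_trans zero_less_power)
qed

lemma \<sigma>_le_s: "\<sigma> \<le> s"
proof -
  obtain x where "x \<in> E" using E_ne by blast
  moreover obtain i where "i \<in> I" using I_ne by blast
  ultimately show ?thesis using lam_bounds[of "[i]" x] by simp
qed

lemma sum_power_le: "(\<Sum>j<n. s ^ j) \<le> 1 / (1 - s)"
proof -
  have "(\<Sum>j<n. s ^ j) \<le> (\<Sum>j. s ^ j)" using s by (intro sum_le_suminf summable_geometric) auto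
  also have "\<dots> = 1 / (1 - s)" using s by (intro suminf_geometric) auto
  finally show ?thesis .
qed

text \<open>
  The point \<open>x \<in> E\<close> carries a similarity, so the derivative along the orbit of a nearby point \<open>y\<close>
  is a product of matrices \<open>A\<^sub>k + R\<^sub>k\<close> with \<open>A\<^sub>k\<close> conformal and \<open>|R\<^sub>k|\<close> decaying geometrically.
\<close>
lemma distortion:
  obtains C where "1 \<le> C"
    "\<And>w x y. \<lbrakk>w \<in> lists I; x \<in> E; y \<in> ball x \<rho>\<rbrakk> \<Longrightarrow> lam w y \<le> C * lam w x"
    "\<And>w x y z. \<lbrakk>w \<in> lists I; x \<in> E; y \<in> ball x \<rho>; z \<in> ball x \<rho>\<rbrakk> \<Longrightarrow>
       norm (dw w y - dw w z) \<le> C * lam w x * norm (y - z)"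
proof -
  \<comment> \<open>Dividing by the lower bound \<open>\<sigma>\<close> turns the Lipschitz constant
    \<open>K\<close> of the derivatives into one for relative errors. After \<open>n\<close>
    letters, \<open>P n\<close> bounds the accumulated ratio of norms and \<open>S n\<close>
    controls the accumulated Lipschitz constant.\<close>
  define \<gamma> where "\<gamma> = K / \<sigma>"
  have \<gamma>: "0 \<le> \<gamma>" using K \<sigma> by (simp add: \<gamma>_def)
  define P where "P n = (\<Prod>j<n. 1 + \<gamma> * \<rho> * s ^ j)" for n
  define S where "S n = \<gamma> * (\<Sum>j<n. s ^ j)" for n
  have P1: "1 \<le> P n" for n unfolding P_def using \<gamma> \<rho> s by (intro prod_ge_1) auto
  have S0: "0 \<le> S n" for n unfolding S_def using \<gamma> s by (intro mult_nonneg_nonneg sum_nonneg) auto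
  have PS: "P (Suc n) = P n * (1 + \<gamma> * \<rho> * s ^ n)" for n by (simp add: P_def)
  have SS: "S (Suc n) = S n + \<gamma> * s ^ n" for n by (simp add: S_def algebra_simps)
  have Pmax: "P n \<le> exp (\<gamma> * \<rho> / (1 - s))" for n
  proof -
    have "P n \<le> (\<Prod>j<n. exp (\<gamma> * \<rho> * s ^ j))"
      unfolding P_def using \<gamma> \<rho> s by (intro prod_mono) auto
    also have "\<dots> = exp (\<gamma> * \<rho> * (\<Sum>j<n. s ^ j))" by (simp add: exp_sum sum_distrib_left)
    also have "\<dots> \<le> exp (\<gamma> * \<rho> * (1 / (1 - s)))"
      using \<gamma> \<rho> by (simp only: exp_le_cancel_iff) (intro mult_left_mono sum_power_le, auto)
    finally show ?thesis by simp
  qed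
  have near: "wm w x \<in> E" "wm w x \<in> X" "wm w y \<in> ball (wm w x) \<rho>"
      "norm (wm w x - wm w y) \<le> s ^ length w * \<rho>"
    if "w \<in> lists I" "x \<in> E" "y \<in> ball x \<rho>" for w x y
  proof -
    show "wm w x \<in> E" using that by (simp add: word_maps_E)
    then show "wm w x \<in> X" using E_sub_X by blast
    show "wm w y \<in> ball (wm w x) \<rho>" using that E_sub_X by (intro word_contract) auto
    have "norm (wm w x - wm w y) \<le> s ^ length w * dist x y"
      using that E_sub_X \<rho> word_contract(1)[of w x x y] by (auto simp: dist_norm)
    also have "\<dots> \<le> s ^ length w * \<rho>" using that s by (intro mult_left_mono) auto
    finally show "norm (wm w x - wm w y) \<le> s ^ length w * \<rho>" .
  qed
  \<comment> \<open>A letter put in front of \<open>w\<close> acts after \<open>w\<close>, when the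
    two points are already within \<open>s ^ length w * \<rho>\<close> of each other. This is the
    geometric decay that keeps the product \<open>P\<close> bounded.\<close>
  have normD: "norm (D i (wm w y)) \<le> norm (D i (wm w x)) * (1 + \<gamma> * \<rho> * s ^ length w)"
    if "i \<in> I" "w \<in> lists I" "x \<in> E" "y \<in> ball x \<rho>" for i w x y
  proof -
    note n = near[OF that(2-4)]
    have "norm (D i (wm w y) - D i (wm w x)) \<le> K * norm (wm w y - wm w x)"
      using n \<rho> that by (intro lip_D[of i "wm w x"]) auto
    also have "\<dots> \<le> K * (s ^ length w * \<rho>)"
      using n(4) K by (intro mult_left_mono) (simp_all add: norm_minus_commute)
    also have "\<dots> = \<sigma> * (\<gamma> * \<rho> * s ^ length w)" using \<sigma> by (simp add: \<gamma>_def)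
    also have "\<dots> \<le> norm (D i (wm w x)) * (\<gamma> * \<rho> * s ^ length w)"
      using low[OF that(1) n(1)] \<gamma> \<rho> s by (intro mult_right_mono) auto
    finally show ?thesis
      using norm_triangle_sub[of "D i (wm w y)" "D i (wm w x)"] by (simp add: algebra_simps)
  qed
  have B: "lam w y \<le> lam w x * P (length w)" if "w \<in> lists I" "x \<in> E" "y \<in> ball x \<rho>" for w x y
    using that(1)
  proof (induction w)
    case (Cons i w)
    then have i: "i \<in> I" "w \<in> lists I" and IH: "lam w y \<le> lam w x * P (length w)" by auto
    have "lam (i # w) y \<le> norm (D i (wm w y)) * lam w y" by (simp add: norm_blinfun_compose)
    also have "\<dots> \<le> (norm (D i (wm w x)) * (1 + \<gamma> * \<rho> * s ^ length w)) * (lam w x * P (length w))"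
      by (intro mult_mono normD i IH that) (use \<gamma> \<rho> s in auto)
    also have "\<dots> = lam (i # w) x * P (length (i # w))"
      using lam_Cons[OF i that(2)] by (simp add: PS del: word_deriv.simps)
    finally show ?case .
  qed (simp add: P_def)
  have L: "norm (dw w y - dw w z) \<le> lam w x * P (length w) * S (length w) * norm (y - z)"
    if "w \<in> lists I" "x \<in> E" "y \<in> ball x \<rho>" "z \<in> ball x \<rho>" for w x y z
    using that(1)
  proof (induction w)
    case (Cons i w)
    then have i: "i \<in> I" "w \<in> lists I"
      and IH: "norm (dw w y - dw w z) \<le> lam w x * P (length w) * S (length w) * norm (y - z)" by auto
    let ?n = "length w" and ?a = "norm (D i (wm w x))" and ?d = "norm (y - z)"
    \<comment> \<open>Product rule for differences: first the error of the old product, then the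
      error of the new factor.\<close>
    have "dw (i # w) y - dw (i # w) z
        = (D i (wm w y) o\<^sub>L (dw w y - dw w z)) + ((D i (wm w y) - D i (wm w z)) o\<^sub>L dw w z)"
      by (auto intro!: blinfun_eqI simp: blinfun.diff_left blinfun.diff_right blinfun.add_left)
    then have "norm (dw (i # w) y - dw (i # w) z)
        \<le> norm (D i (wm w y)) * norm (dw w y - dw w z) + norm (D i (wm w y) - D i (wm w z)) * lam w z"
      by (metis (no_types, lifting) norm_triangle_mono norm_blinfun_compose)
    also have "\<dots> \<le> (?a * (1 + \<gamma> * \<rho> * s ^ ?n)) * (lam w x * P ?n * S ?n * ?d)
        + (K * (s ^ ?n * ?d)) * (lam w x * P ?n)"
    proof (intro add_mono mult_mono normD i that IH B)
      have "norm (D i (wm w y) - D i (wm w z)) \<le> K * norm (wm w y - wm w z)"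
        using near[OF i(2) that(2)] that i by (intro lip_D[of i "wm w x"]) auto
      also have "\<dots> \<le> K * (s ^ ?n * ?d)"
        using word_contract(1)[OF i(2), of x y z] that E_sub_X K
        by (intro mult_left_mono) (auto simp: dist_norm)
      finally show "norm (D i (wm w y) - D i (wm w z)) \<le> K * (s ^ ?n * ?d)" .
    qed (use \<gamma> \<rho> s K in auto)
    also have "K * (s ^ ?n * ?d) * (lam w x * P ?n) = \<sigma> * (\<gamma> * s ^ ?n * ?d * (lam w x * P ?n))"
      using \<sigma> by (simp add: \<gamma>_def)
    also have "\<dots> \<le> ?a * (\<gamma> * s ^ ?n * ?d * (lam w x * P ?n))"
      using low[OF i(1) near(1)[OF i(2) that(2,3)]] \<gamma> s P1[of ?n]
      by (intro mult_right_mono mult_nonneg_nonneg) auto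
    \<comment> \<open>Passing to \<open>P (Suc ?n)\<close> in the second term gives both terms a
      common factor; what remains adds up to \<open>S (Suc ?n)\<close>.\<close>
    also have "\<dots> \<le> ?a * (\<gamma> * s ^ ?n * ?d * (lam w x * P (Suc ?n)))"
      unfolding PS using \<gamma> \<rho> s P1[of ?n]
      by (intro mult_left_mono mult_nonneg_nonneg) (auto intro!: mult_le_cancel_left1[THEN iffD2])
    also have "(?a * (1 + \<gamma> * \<rho> * s ^ ?n)) * (lam w x * P ?n * S ?n * ?d) + \<dots>
        = (?a * lam w x) * P (Suc ?n) * S (Suc ?n) * ?d"
      unfolding PS SS by (simp add: algebra_simps)
    finally show ?case
      using lam_Cons[OF i that(2)] by (simp del: word_deriv.simps)
  qed (simp add: P_def S_def)
  define C0 where "C0 = exp (\<gamma> * \<rho> / (1 - s))"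
  have C0: "1 \<le> C0" using \<gamma> \<rho> s by (simp add: C0_def)
  define C where "C = C0 * (1 + \<gamma> / (1 - s))"
  have Smax: "S n \<le> \<gamma> / (1 - s)" for n
    unfolding S_def using \<gamma> mult_left_mono[OF sum_power_le, of \<gamma> n] by simp
  have "0 \<le> \<gamma> / (1 - s)" using \<gamma> s by simp
  then have C: "C0 \<le> C" "C0 * (\<gamma> / (1 - s)) \<le> C" 
    using C0 mult_nonneg_nonneg[of C0 "\<gamma> / (1 - s)"] by (auto simp: C_def distrib_left)
  show thesis
  proof (rule that[of C])
    show "1 \<le> C" using C C0 by simp
    show "lam w y \<le> C * lam w x" if "w \<in> lists I" "x \<in> E" "y \<in> ball x \<rho>" for w x y
    proof -
      have "lam w x * P (length w) \<le> lam w x * C"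
        using Pmax[of "length w"] C by (intro mult_left_mono) (auto simp: C0_def)
      with B[OF that] show ?thesis by (simp add: mult.commute)
    qed
    show "norm (dw w y - dw w z) \<le> C * lam w x * norm (y - z)"
      if "w \<in> lists I" "x \<in> E" "y \<in> ball x \<rho>" "z \<in> ball x \<rho>" for w x y z
    proof -
      have "P (length w) * S (length w) \<le> C0 * (\<gamma> / (1 - s))"
        using Pmax[of "length w"] Smax[of "length w"] S0[of "length w"] P1[of "length w"] C0
        by (intro mult_mono) (auto simp: C0_def)
      then have "lam w x * (P (length w) * S (length w)) * norm (y - z) \<le> lam w x * C * norm (y - z)"
        using C by (intro mult_right_mono mult_left_mono) auto
      with L[OF that] show ?thesis by (simp add: mult_ac)
    qed
  qed
qed

text \<open>Two ranges are treated. Within \<open>r0\<close> of a point of \<open>E\<close>, the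
  derivative of a word differs from the similarity at that point by at most a quarter of its norm,
  which makes the word bi-Lipschitz. Distant points of \<open>E\<close> are brought within
  \<open>r0\<close> of each other by the last \<open>N\<close> letters, which act first; those
  letters change norms by a factor bounded in terms of \<open>N\<close>, and the rest of the word is
  compared on one ball.\<close>

lemma geometry:
  obtains r0 C where "0 < r0" "r0 \<le> \<rho>" "1 \<le> C"
    "\<And>w x y. \<lbrakk>w \<in> lists I; x \<in> E; y \<in> ball x r0\<rbrakk> \<Longrightarrow> lam w y \<le> C * lam w x"
    "\<And>w x y z. \<lbrakk>w \<in> lists I; x \<in> E; y \<in> ball x r0; z \<in> ball x r0\<rbrakk> \<Longrightarrow>
       norm (dw w y - dw w z) \<le> C * lam w x * norm (y - z)"
    "\<And>w x y v. \<lbrakk>w \<in> lists I; x \<in> E; y \<in> ball x r0\<rbrakk> \<Longrightarrow> lam w x / 2 * norm v \<le> norm (blinfun_apply (dw w y) v)"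
    "\<And>w x y z. \<lbrakk>w \<in> lists I; x \<in> E; y \<in> ball x r0; z \<in> ball x r0\<rbrakk> \<Longrightarrow>
       lam w x / 2 * dist y z \<le> dist (wm w y) (wm w z) \<and> dist (wm w y) (wm w z) \<le> 2 * lam w x * dist y z"
    "\<And>w x x'. \<lbrakk>w \<in> lists I; x \<in> E; x' \<in> E\<rbrakk> \<Longrightarrow> lam w x \<le> C * lam w x'"
    "\<And>w x x'. \<lbrakk>w \<in> lists I; x \<in> E; x' \<in> E\<rbrakk> \<Longrightarrow> dist (wm w x) (wm w x') \<le> C * lam w x"
proof -
  obtain C where C: "1 \<le> C"
    and Ca: "\<And>w x y. \<lbrakk>w \<in> lists I; x \<in> E; y \<in> ball x \<rho>\<rbrakk> \<Longrightarrow> lam w y \<le> C * lam w x"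
    and Cb: "\<And>w x y z. \<lbrakk>w \<in> lists I; x \<in> E; y \<in> ball x \<rho>; z \<in> ball x \<rho>\<rbrakk> \<Longrightarrow>
       norm (dw w y - dw w z) \<le> C * lam w x * norm (y - z)"
    by (rule distortion) blast
  \<comment> \<open>Chosen so that on the ball the Lipschitz bound \<open>C * lam w x\<close> for
    the derivative amounts to a variation of at most \<open>lam w x / 4\<close>.\<close>
  define r0 where "r0 = min \<rho> (1 / (4 * C))"
  have r0: "0 < r0" "r0 \<le> \<rho>" "r0 \<le> 1 / (4 * C)" using \<rho> C by (auto simp: r0_def)
  have sub: "y \<in> ball x r0 \<Longrightarrow> y \<in> ball x \<rho>" for x y :: 'a using r0 by auto
  have near: "norm (dw w y - dw w x) \<le> lam w x / 4" if "w \<in> lists I" "x \<in> E" "y \<in> ball x r0" for w x y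
  proof -
    have "norm (dw w y - dw w x) \<le> C * lam w x * norm (y - x)"
      using that sub \<rho> by (intro Cb) auto
    also have "\<dots> \<le> C * lam w x * (1 / (4 * C))"
      using that r0 C by (intro mult_left_mono) (auto simp: dist_norm norm_minus_commute)
    finally show ?thesis using C by simp
  qed
  have c: "lam w x / 2 * norm v \<le> norm (blinfun_apply (dw w y) v)"
    if "w \<in> lists I" "x \<in> E" "y \<in> ball x r0" for w x y v
  proof -
    have "lam w x * norm v = norm (blinfun_apply (dw w x) v)" using that by (simp add: dw_conformal)
    also have "\<dots> \<le> norm (blinfun_apply (dw w y) v) + norm (blinfun_apply (dw w y - dw w x) v)"
      by (simp add: blinfun.diff_left norm_triangle_sub norm_minus_commute)
    also have "norm (blinfun_apply (dw w y - dw w x) v) \<le> lam w x / 4 * norm v"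
      using near[OF that] by (intro order_trans[OF norm_blinfun]) (rule mult_right_mono, auto)
    finally have "lam w x * norm v \<le> norm (blinfun_apply (dw w y) v) + lam w x / 4 * norm v" by simp
    moreover have "0 \<le> lam w x * norm v" by simp
    ultimately show ?thesis by linarith
  qed
  have d: "lam w x / 2 * dist y z \<le> dist (wm w y) (wm w z) \<and> dist (wm w y) (wm w z) \<le> 2 * lam w x * dist y z"
    if w: "w \<in> lists I" "x \<in> E" "y \<in> ball x r0" "z \<in> ball x r0" for w x y z
  proof -
    \<comment> \<open>The word minus its linear part at the centre is
      \<open>lam w x / 4\<close>-Lipschitz, so comparison with the similarity gives the ratios 3/4
      and 5/4; the constants 1/2 and 2 leave room to spare.\<close>
    have "norm ((wm w y - blinfun_apply (dw w x) y) - (wm w z - blinfun_apply (dw w x) z)) \<le> lam w x / 4 * norm (y - z)"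
    proof (rule differentiable_bound[OF convex_ball])
      fix u assume u: "u \<in> ball x r0"
      have "(wm w has_derivative blinfun_apply (dw w u)) (at u within ball x r0)"
        using w sub[OF u] E_sub_X by (intro has_derivative_at_withinI[OF word_has_derivative]) auto
      moreover have "(blinfun_apply (dw w x) has_derivative blinfun_apply (dw w x)) (at u within ball x r0)"
        by (rule bounded_linear_imp_has_derivative[OF blinfun.bounded_linear_right])
      ultimately show "((\<lambda>u. wm w u - blinfun_apply (dw w x) u) has_derivative blinfun_apply (dw w u - dw w x)) (at u within ball x r0)"
        unfolding minus_blinfun.rep_eq by (rule has_derivative_diff)
      show "onorm (blinfun_apply (dw w u - dw w x)) \<le> lam w x / 4"
        using near[OF w(1,2) u] by (simp add: norm_blinfun.rep_eq)
    qed (use w in auto)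
    then have *: "norm ((wm w y - wm w z) - blinfun_apply (dw w x) (y - z)) \<le> lam w x / 4 * norm (y - z)"
      by (simp add: blinfun.diff_right algebra_simps)
    have **: "norm (blinfun_apply (dw w x) (y - z)) = lam w x * norm (y - z)" using w by (simp add: dw_conformal)
    have "0 \<le> lam w x * norm (y - z)" by simp
    then show ?thesis
      using * ** norm_triangle_sub[of "wm w y - wm w z" "blinfun_apply (dw w x) (y - z)"]
        norm_triangle_sub[of "blinfun_apply (dw w x) (y - z)" "wm w y - wm w z"]
      by (simp add: dist_norm norm_minus_commute field_simps)
  qed
  \<comment> \<open>A unit vector on which the similarities at two points of \<open>E\<close> are
    compared.\<close>
  obtain u0 :: 'a where "u0 \<in> Basis" using nonempty_Basis by blast
  then have u0: "norm u0 = 1" by simp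
  have loc: "lam w x \<le> 2 * lam w x'" if "w \<in> lists I" "x \<in> E" "x' \<in> E" "x' \<in> ball x r0" for w x x'
    using c[OF that(1,2,4), of u0] that u0 by (simp add: dw_conformal)
  obtain N where N: "\<And>w. w \<in> lists I \<Longrightarrow> N \<le> length w \<Longrightarrow> diameter (wm w ` X) < r0"
    using diam_to_0[OF r0(1)] by blast
  \<comment> \<open>At points of \<open>E\<close>, words of at most \<open>N\<close> letters have
    norm between \<open>1/q\<close> and 1.\<close>
  define q where "q = 1 / \<sigma> ^ N"
  have lam1: "lam w x \<le> 1" if "w \<in> lists I" "x \<in> E" for w x
    using lam_bounds(2)[OF that] s power_le_one[of s "length w"] by linarith
  have lamq: "1 \<le> q * lam w x" if "w \<in> lists I" "x \<in> E" "length w \<le> N" for w x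
  proof -
    have "\<sigma> ^ N \<le> \<sigma> ^ length w" using \<sigma> \<sigma>_le_s s that by (intro power_decreasing) auto
    also have "\<dots> \<le> lam w x" using lam_bounds that by blast
    finally show ?thesis using \<sigma> by (simp add: q_def field_simps)
  qed
  have q: "0 < q" using \<sigma> by (simp add: q_def)
  have split: "\<exists>u v. w = u @ v \<and> u \<in> lists I \<and> v \<in> lists I \<and> length v \<le> N \<and>
      (\<forall>x\<in>E. \<forall>x'\<in>E. wm v x' \<in> ball (wm v x) r0)" if "w \<in> lists I" "N \<le> length w" for w
  proof (intro exI conjI ballI)
    let ?u = "take (length w - N) w" and ?v = "drop (length w - N) w"
    show "w = ?u @ ?v" by simp
    show "?u \<in> lists I" using that(1) by (auto dest: in_set_takeD)
    show v: "?v \<in> lists I" using that(1) by (auto dest: in_set_dropD)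
    show "length ?v \<le> N" using that by simp
    fix x x' assume "x \<in> E" "x' \<in> E"
    then have "dist (wm ?v x) (wm ?v x') \<le> diameter (wm ?v ` X)"
      using E_sub_X v by (intro diameter_bounded_bound compact_imp_bounded compact_word_image) auto
    also have "\<dots> < r0" using that v by (intro N) auto
    finally show "wm ?v x' \<in> ball (wm ?v x) r0" by simp
  qed
  have e1: "lam w x \<le> 2 * q * lam w x'" if w: "w \<in> lists I" "x \<in> E" "x' \<in> E" for w x x'
  proof (cases "N \<le> length w")
    case True
    then obtain u v where uv: "w = u @ v" "u \<in> lists I" "v \<in> lists I" "length v \<le> N"
      "wm v x' \<in> ball (wm v x) r0" using split w by meson
    have "lam w x = lam u (wm v x) * lam v x" using uv w by (simp add: lam_append)
    also have "\<dots> \<le> (2 * lam u (wm v x')) * 1"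
      using uv w by (intro mult_mono loc lam1) (auto simp: word_maps_E)
    also have "\<dots> \<le> (2 * lam u (wm v x')) * (q * lam v x')"
      using lamq[of v x'] uv w by (intro mult_left_mono) auto
    also have "\<dots> = 2 * q * lam w x'" using uv w by (simp add: lam_append)
    finally show ?thesis .
  next
    case False
    then show ?thesis using lam1[of w x] lamq[of w x'] w by auto
  qed
  \<comment> \<open>The first summand is for long words, the second for words shorter than
    \<open>N\<close>.\<close>
  define M where "M = 2 * r0 + diameter X"
  have X: "0 \<le> diameter X" using compact_X by (simp add: compact_imp_bounded diameter_ge_0)
  have e2: "dist (wm w x) (wm w x') \<le> M * q * lam w x" if w: "w \<in> lists I" "x \<in> E" "x' \<in> E" for w x x'
  proof (cases "N \<le> length w")
    case True
    then obtain u v where uv: "w = u @ v" "u \<in> lists I" "v \<in> lists I" "length v \<le> N"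
      "wm v x' \<in> ball (wm v x) r0" using split w by meson
    have "dist (wm w x) (wm w x') \<le> 2 * lam u (wm v x) * dist (wm v x) (wm v x')"
      using d[of u "wm v x" "wm v x" "wm v x'"] uv w r0 by (simp add: word_map_append word_maps_E)
    also have "\<dots> \<le> (2 * lam u (wm v x)) * (r0 * (q * lam v x))"
    proof (intro mult_left_mono)
      have "dist (wm v x) (wm v x') \<le> r0 * 1" using uv by simp
      also have "\<dots> \<le> r0 * (q * lam v x)" using uv w lamq[of v x] r0 by (intro mult_left_mono) auto
      finally show "dist (wm v x) (wm v x') \<le> r0 * (q * lam v x)" .
    qed simp
    also have "\<dots> = 2 * r0 * q * lam w x" using uv w by (simp add: lam_append)
    also have "\<dots> \<le> M * q * lam w x" using X q by (intro mult_right_mono) (auto simp: M_def)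
    finally show ?thesis .
  next
    case False
    have "dist (wm w x) (wm w x') \<le> diameter X"
      using w word_maps_E E_sub_X compact_X
      by (intro diameter_bounded_bound) (auto simp: compact_imp_bounded)
    also have "\<dots> \<le> M * 1" using r0 by (simp add: M_def)
    also have "\<dots> \<le> M * (q * lam w x)" using False w lamq[of w x] r0 X by (intro mult_left_mono) (auto simp: M_def)
    finally show ?thesis by (simp add: mult.assoc)
  qed
  define C' where "C' = max C (max (2 * q) (M * q))"
  have C': "C \<le> C'" "2 * q \<le> C'" "M * q \<le> C'" by (auto simp: C'_def)
  have weaken: "a \<le> C' * b" if "a \<le> c * b" "c \<le> C'" "0 \<le> b" for a b c
    using that by (meson mult_right_mono order_trans)
  show thesis
  proof (rule that[of r0 C'])
    show "lam w y \<le> C' * lam w x" if "w \<in> lists I" "x \<in> E" "y \<in> ball x r0" for w x y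
      by (rule weaken[OF Ca[OF that(1,2) sub[OF that(3)]] C'(1)]) simp
    show "norm (dw w y - dw w z) \<le> C' * lam w x * norm (y - z)"
      if "w \<in> lists I" "x \<in> E" "y \<in> ball x r0" "z \<in> ball x r0" for w x y z
      using weaken[of _ C "lam w x * norm (y - z)"] Cb[OF that(1,2) sub[OF that(3)] sub[OF that(4)]] C'
      by (simp add: mult.assoc)
    show "lam w x \<le> C' * lam w x'" if "w \<in> lists I" "x \<in> E" "x' \<in> E" for w x x'
      by (rule weaken[OF e1[OF that] C'(2)]) simp
    show "dist (wm w x) (wm w x') \<le> C' * lam w x" if "w \<in> lists I" "x \<in> E" "x' \<in> E" for w x x'
      by (rule weaken[OF e2[OF that] C'(3)]) simp
  qed (use r0 C C' c d in auto)
qed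

end

section \<open>Hausdorff measure of the limit set\<close>

text \<open>The assumptions are the conclusions of \<open>geometry\<close>: the locale fixes the
  constants which that lemma produces and restricts the systems no further.\<close>

locale bounded_distortion_ifs = distortion_ifs I \<phi> X E D \<rho> s \<sigma> K
  for I :: "'i set" and \<phi> :: "'i \<Rightarrow> 'a::euclidean_space \<Rightarrow> 'a" and X E :: "'a set"
    and D :: "'i \<Rightarrow> 'a \<Rightarrow> 'a \<Rightarrow>\<^sub>L 'a" and \<rho> s \<sigma> K :: real +
  fixes r0 C :: real
  assumes r0: "0 < r0" "r0 \<le> \<rho>" and C: "1 \<le> C"
    and deriv_le: "\<And>w x y. \<lbrakk>w \<in> lists I; x \<in> E; y \<in> ball x r0\<rbrakk> \<Longrightarrow> lam w y \<le> C * lam w x"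
    and deriv_lip: "\<And>w x y z. \<lbrakk>w \<in> lists I; x \<in> E; y \<in> ball x r0; z \<in> ball x r0\<rbrakk> \<Longrightarrow>
       norm (dw w y - dw w z) \<le> C * lam w x * norm (y - z)"
    and deriv_ge: "\<And>w x y v. \<lbrakk>w \<in> lists I; x \<in> E; y \<in> ball x r0\<rbrakk> \<Longrightarrow>
       lam w x / 2 * norm v \<le> norm (blinfun_apply (dw w y) v)"
    and bilip: "\<And>w x y z. \<lbrakk>w \<in> lists I; x \<in> E; y \<in> ball x r0; z \<in> ball x r0\<rbrakk> \<Longrightarrow>
       lam w x / 2 * dist y z \<le> dist (wm w y) (wm w z) \<and> dist (wm w y) (wm w z) \<le> 2 * lam w x * dist y z"
    and lam_comparable: "\<And>w x x'. \<lbrakk>w \<in> lists I; x \<in> E; x' \<in> E\<rbrakk> \<Longrightarrow> lam w x \<le> C * lam w x'"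
    and dist_word: "\<And>w x x'. \<lbrakk>w \<in> lists I; x \<in> E; x' \<in> E\<rbrakk> \<Longrightarrow> dist (wm w x) (wm w x') \<le> C * lam w x"
begin

lemma word_image_E: "w \<in> lists I \<Longrightarrow> wm w ` E \<subseteq> E"
  using word_maps_E by blast

lemma lam_tendsto_0:
  assumes "\<And>n. h n \<in> I" "\<And>n. y n \<in> E"
  shows "(\<lambda>n. lam (prefix h n) (y n)) \<longlonglongrightarrow> 0"
proof (rule tendsto_sandwich[of "\<lambda>_. 0" _ _ "\<lambda>n. s ^ n"])
  have "lam (prefix h n) (y n) \<le> s ^ n" for n
    using lam_bounds(2)[OF prefix_in_lists[of h n, OF assms(1)] assms(2)[of n]] by simp
  then show "\<forall>\<^sub>F n in sequentially. lam (prefix h n) (y n) \<le> s ^ n" by simp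
  show "(\<lambda>n. s ^ n) \<longlonglongrightarrow> 0" using s by (intro LIMSEQ_realpow_zero) auto
qed auto

text \<open>
  The maps need not be injective on \<open>E\<close>, so \<open>E\<close> is cut into pieces that are small enough for
  every \<^term>\<open>word_map \<phi> w\<close> to be bi-Lipschitz on each piece.
\<close>
lemma pieces:
  obtains U where "finite U" "U \<subseteq> lists I" "E = (\<Union>u\<in>U. wm u ` E)"
    "\<And>u y z. \<lbrakk>u \<in> U; y \<in> wm u ` E; z \<in> wm u ` E\<rbrakk> \<Longrightarrow> dist y z < r0"
proof -
  obtain N where N: "\<And>w. w \<in> lists I \<Longrightarrow> N \<le> length w \<Longrightarrow> diameter (wm w ` X) < r0"
    using diam_to_0[OF r0(1)] by blast
  define U where "U = {u. set u \<subseteq> I \<and> length u = N}"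
  show thesis
  proof (rule that[of U])
    show "finite U" unfolding U_def using fin_I by (rule finite_lists_length_eq)
    show U: "U \<subseteq> lists I" by (auto simp: U_def)
    have "E \<subseteq> (\<Union>u\<in>U. wm u ` E)"
    proof
      fix x assume "x \<in> E"
      then obtain h y where h: "\<And>n. h n \<in> I" "\<And>n. y n \<in> E" "\<And>n. x = wm (prefix h n) (y n)"
        using address by blast
      then have "prefix h N \<in> U" by (auto simp: U_def)
      then show "x \<in> (\<Union>u\<in>U. wm u ` E)" using h by blast
    qed
    then show "E = (\<Union>u\<in>U. wm u ` E)" using U word_image_E by blast
    fix u y z assume u: "u \<in> U" and "y \<in> wm u ` E" "z \<in> wm u ` E"
    then have "dist y z \<le> diameter (wm u ` X)"
      using E_sub_X U by (intro diameter_bounded_bound compact_imp_bounded compact_word_image) auto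
    also have "\<dots> < r0" using u U by (intro N) (auto simp: U_def)
    finally show "dist y z < r0" .
  qed
qed

lemma lam_ge_of_comparable:
  assumes "w \<in> lists I" "x \<in> E" "x' \<in> E"
  shows "lam w x / C \<le> lam w x'"
  using lam_comparable[OF assms] C by (simp add: field_simps)

text \<open>The diameter bound makes \<open>bilip\<close> applicable with a point of the piece as
  centre; measuring with the norm at another point \<open>p\<close> of \<open>E\<close> costs one
  more factor \<open>C\<close>.\<close>

lemma piece_expanding:
  assumes "w \<in> lists I" "u \<in> lists I" "\<And>y z. \<lbrakk>y \<in> wm u ` E; z \<in> wm u ` E\<rbrakk> \<Longrightarrow> dist y z < r0"
    and "p \<in> E" "y \<in> wm u ` E" "z \<in> wm u ` E"
  shows "lam w p / (2 * C) * dist y z \<le> dist (wm w y) (wm w z)"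
proof -
  have y: "y \<in> E" using assms word_image_E by blast
  have "lam w p / (2 * C) * dist y z = (lam w p / C) / 2 * dist y z" by simp
  also have "\<dots> \<le> lam w y / 2 * dist y z"
    by (intro mult_right_mono divide_right_mono lam_ge_of_comparable assms y) auto
  also have "\<dots> \<le> dist (wm w y) (wm w z)"
    using bilip[OF assms(1) y, of y z] assms r0 by auto
  finally show ?thesis .
qed

text \<open>The coding of \<open>x\<close> is stopped at the first \<open>n\<close> at which the
  norm of the word falls to \<open>k * r\<close>. One letter lowers the norm by a bounded factor
  only, so the norm is comparable to \<open>r\<close>. The word begins with \<open>u\<close>, which
  keeps the image in the same piece.\<close>

lemma small_copies:
  assumes u: "u \<in> lists I" and small: "\<And>y z. \<lbrakk>y \<in> wm u ` E; z \<in> wm u ` E\<rbrakk> \<Longrightarrow> dist y z < r0"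
    and x: "x \<in> wm u ` E" and r: "0 < r" "r < 1"
  defines "k \<equiv> \<sigma> ^ length u / (3 * C\<^sup>2)"
  shows "\<exists>g. (\<forall>y\<in>wm u ` E. g y \<in> wm u ` E \<inter> cball x (r/3)) \<and>
             (\<forall>y\<in>wm u ` E. \<forall>z\<in>wm u ` E. \<sigma> * k / (2 * C\<^sup>2) * r * dist y z \<le> dist (g y) (g z))"
proof -
  obtain z0 where z0: "z0 \<in> E" "x = wm u z0" using x by blast
  obtain h y where h: "\<And>n. h n \<in> I" "\<And>n. y n \<in> E" "\<And>n. z0 = wm (prefix h n) (y n)"
    using address[OF z0(1)] by blast
  define W where "W n = u @ prefix h n" for n
  have W: "W n \<in> lists I" for n using u h(1) by (auto simp: W_def)
  have xW: "x = wm (W n) (y n)" for n by (simp add: W_def word_map_append h(3)[symmetric] z0)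
  define L where "L n = lam (W n) z0" for n
  \<comment> \<open>In \<open>k\<close>, the power of \<open>\<sigma>\<close> puts the threshold
    below the norm of \<open>u\<close>, so that at least one letter is read, and
    \<open>3 * C\<^sup>2\<close> brings the image within \<open>r/3\<close> of
    \<open>x\<close>.\<close>
  have k: "0 < k" using \<sigma> C by (simp add: k_def)
  have "k * r < \<sigma> ^ length u"
  proof -
    have "1 \<le> 3 * C\<^sup>2" using C one_le_power[of C 2] by linarith
    then have "k \<le> \<sigma> ^ length u" unfolding k_def using \<sigma> C by (simp add: divide_le_eq mult_le_cancel_left1)
    moreover have "k * r < k * 1" using k r by (intro mult_strict_left_mono) auto
    ultimately show ?thesis by simp
  qed
  also have "\<dots> \<le> L 0" using lam_bounds(1)[OF u z0(1)] by (simp add: L_def W_def)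
  finally have L0: "k * r < L 0" .
  have "(\<lambda>n. s ^ n) \<longlonglongrightarrow> 0" using s by (intro LIMSEQ_realpow_zero) auto
  then obtain n0 where n0: "s ^ n0 < k * r"
    using k r by (metis eventually_sequentially mult_pos_pos order_refl order_tendstoD(2))
  have "L n0 \<le> s ^ length (W n0)" unfolding L_def by (rule lam_bounds[OF W z0(1)])
  also have "\<dots> \<le> s ^ n0" using s by (intro power_decreasing) (auto simp: W_def)
  finally have ex: "\<exists>n. L n \<le> k * r" using n0 by (intro exI[of _ n0]) simp
  define n where "n = (LEAST n. L n \<le> k * r)"
  have n: "L n \<le> k * r" unfolding n_def using ex by (rule LeastI_ex)
  then have "n \<noteq> 0" using L0 by (intro notI) simp
  then obtain m where m: "n = Suc m" using not0_implies_Suc by blast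
  have Lm: "k * r < L m"
    using not_less_Least[of m "\<lambda>n. L n \<le> k * r"] m by (simp add: n_def)
  \<comment> \<open>Minimality of \<open>n\<close> bounds the norm from below: the last letter costs
    at most a factor \<open>\<sigma>\<close>, and moving the base point of the earlier part from
    \<open>z0\<close> to \<open>\<phi> (h m) z0\<close> costs a factor \<open>1/C\<close>.\<close>
  have "\<sigma> / C * (k * r) \<le> L n"
  proof -
    have Wn: "W n = W m @ [h m]" by (simp add: m W_def)
    have hz: "\<phi> (h m) z0 \<in> E" using h z0 maps_E by blast
    have "\<sigma> / C * (k * r) = (k * r / C) * \<sigma>" by simp
    also have "\<dots> \<le> (L m / C) * \<sigma>" using Lm C \<sigma> by (intro mult_right_mono divide_right_mono) auto
    also have "\<dots> \<le> lam (W m) (\<phi> (h m) z0) * lam [h m] z0"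
      using lam_bounds(1)[of "[h m]" z0] h z0 hz C \<sigma>
      by (intro mult_mono) (auto simp: L_def intro!: lam_ge_of_comparable W)
    also have "\<dots> = L n" using lam_append[OF W, of "[h m]" z0 m] h z0 by (simp add: L_def Wn)
    finally show ?thesis .
  qed
  then have low: "\<sigma> * k / (2 * C\<^sup>2) * r \<le> L n / (2 * C)"
    using C by (simp add: field_simps power2_eq_square)
  show ?thesis
  proof (intro exI[of _ "wm (W n)"] conjI ballI IntI)
    fix v assume v: "v \<in> wm u ` E"
    then have vE: "v \<in> E" using u word_image_E by blast
    then have "wm (prefix h n) v \<in> E" using h(1) by (intro word_maps_E) auto
    then show "wm (W n) v \<in> wm u ` E" by (simp add: W_def word_map_append)
    have "dist x (wm (W n) v) \<le> C * lam (W n) (y n)" unfolding xW[of n] by (rule dist_word[OF W h(2) vE])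
    also have "\<dots> \<le> C * (C * L n)" unfolding L_def using C by (intro mult_left_mono lam_comparable W h z0) auto
    also have "\<dots> \<le> C * (C * (k * r))" using n C by (intro mult_left_mono) auto
    also have "\<dots> = \<sigma> ^ length u * (r / 3)" using C by (simp add: k_def power2_eq_square)
    also have "\<dots> \<le> 1 * (r / 3)"
      using r \<sigma> \<sigma>_le_s s by (intro mult_right_mono power_le_one) auto
    finally show "wm (W n) v \<in> cball x (r / 3)" by simp
  next
    fix v v' assume v: "v \<in> wm u ` E" "v' \<in> wm u ` E"
    have "\<sigma> * k / (2 * C\<^sup>2) * r * dist v v' \<le> L n / (2 * C) * dist v v'"
      by (intro mult_right_mono low) auto
    also have "\<dots> \<le> dist (wm (W n) v) (wm (W n) v')"
      unfolding L_def by (rule piece_expanding[OF W u small z0(1) v])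
    finally show "\<sigma> * k / (2 * C\<^sup>2) * r * dist v v' \<le> dist (wm (W n) v) (wm (W n) v')" .
  qed
qed

text \<open>The finiteness criterion is applied to the pieces and not to \<open>E\<close> itself,
  because it asks for maps that expand distances on the whole set, and words are known to do so on
  sets of diameter less than \<open>r0\<close>.\<close>

lemma hausdorff_measure_E_finite:
  assumes t: "ereal t = hausdorff_dim E"
  shows "hausdorff_measure t E < top"
proof -
  have t0: "0 \<le> t" using hausdorff_dim_nonneg[of E] by (simp flip: t)
  obtain U where U: "finite U" "U \<subseteq> lists I" "E = (\<Union>u\<in>U. wm u ` E)"
    "\<And>u y z. \<lbrakk>u \<in> U; y \<in> wm u ` E; z \<in> wm u ` E\<rbrakk> \<Longrightarrow> dist y z < r0" by (rule pieces) blast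
  have "hausdorff_measure t (wm u ` E) < top" if u: "u \<in> U" for u
  proof (rule hausdorff_measure_finite_of_small_copies[OF _ t0])
    have uI: "u \<in> lists I" using u U by blast
    show "compact (wm u ` E)"
      using compact_E E_sub_X uI by (intro compact_continuous_image continuous_on_subset[OF word_cont])
    show "hausdorff_measure r (wm u ` E) = 0" if "t < r" for r
      using hausdorff_measure_above_dim[of E r] hausdorff_measure_mono[OF word_image_E[OF uI], of r] that
      by (simp flip: t)
    show "0 < \<sigma> * (\<sigma> ^ length u / (3 * C\<^sup>2)) / (2 * C\<^sup>2)" using \<sigma> C by simp
    show "\<exists>g. (\<forall>y\<in>wm u ` E. g y \<in> wm u ` E \<inter> cball x (r/3)) \<and>
             (\<forall>y\<in>wm u ` E. \<forall>z\<in>wm u ` E. \<sigma> * (\<sigma> ^ length u / (3 * C\<^sup>2)) / (2 * C\<^sup>2) * r * dist y z \<le> dist (g y) (g z))"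
      if "x \<in> wm u ` E" "0 < r" "r < 1" for x r
      by (rule small_copies[OF uI U(4)[OF u] that])
  qed
  then have "hausdorff_measure t (\<Union>u\<in>U. wm u ` E) < top"
    by (intro hausdorff_measure_finite_UN_less_top U)
  then show ?thesis using U(3) by simp
qed

text \<open>Some piece has positive measure, and on it a word expands by at least
  \<open>lam w p / (2 * C)\<close>; the image of all of \<open>E\<close> can only be larger.
  Finiteness of the measure of \<open>E\<close> makes the constant \<open>m\<close> a real
  number.\<close>

lemma hausdorff_measure_word_image_ge:
  assumes t: "ereal t = hausdorff_dim E" and pos: "hausdorff_measure t E \<noteq> 0"
  obtains m where "0 < m"
    "\<And>w p. \<lbrakk>w \<in> lists I; p \<in> E\<rbrakk> \<Longrightarrow> ennreal (m * lam w p powr t) \<le> hausdorff_measure t (wm w ` E)"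
proof -
  have t0: "0 \<le> t" using hausdorff_dim_nonneg[of E] by (simp flip: t)
  obtain U where U: "finite U" "U \<subseteq> lists I" "E = (\<Union>u\<in>U. wm u ` E)"
    "\<And>u y z. \<lbrakk>u \<in> U; y \<in> wm u ` E; z \<in> wm u ` E\<rbrakk> \<Longrightarrow> dist y z < r0" by (rule pieces) blast
  have "\<exists>u\<in>U. hausdorff_measure t (wm u ` E) \<noteq> 0"
    using hausdorff_measure_null_UN[of U t "\<lambda>u. wm u ` E"] U pos by (auto intro: countable_finite)
  then obtain u where u: "u \<in> U" "u \<in> lists I" and pu: "hausdorff_measure t (wm u ` E) \<noteq> 0" using U by blast
  define m0 where "m0 = enn2real (hausdorff_measure t (wm u ` E))"
  have fin: "hausdorff_measure t (wm u ` E) < top"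
    using hausdorff_measure_mono[OF word_image_E[OF u(2)], of t] hausdorff_measure_E_finite[OF t]
    by (rule order_le_less_trans)
  then have m0: "hausdorff_measure t (wm u ` E) = ennreal m0" "0 < m0"
    using pu by (auto simp: m0_def enn2real_positive_iff zero_less_iff_neq_zero)
  show thesis
  proof (rule that[of "m0 * (1 / (2 * C)) powr t"])
    show "0 < m0 * (1 / (2 * C)) powr t" using m0 C by simp
    fix w p assume w: "w \<in> lists I" and p: "p \<in> E"
    have "ennreal (m0 * (1 / (2 * C)) powr t * lam w p powr t)
        = ennreal ((lam w p / (2 * C)) powr t) * hausdorff_measure t (wm u ` E)"
      unfolding m0 using m0 C lam_bounds(3)[OF w p]
      by (simp add: powr_divide mult_ac flip: ennreal_mult)
    also have "\<dots> \<le> hausdorff_measure t (wm w ` wm u ` E)"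
      using lam_bounds(3)[OF w p] C
      by (intro hausdorff_measure_expanding t0 piece_expanding[OF w u(2) U(4)[OF u(1)] p]) auto
    also have "\<dots> \<le> hausdorff_measure t (wm w ` E)"
      by (intro hausdorff_measure_mono image_mono word_image_E u)
    finally show "ennreal (m0 * (1 / (2 * C)) powr t * lam w p powr t) \<le> hausdorff_measure t (wm w ` E)" .
  qed
qed

text \<open>If the cylinder of \<open>prefix h n @ v\<close> missed \<open>A\<close>, it would lie
  in \<open>E - A\<close> inside the ball of radius \<open>r n\<close> around \<open>x\<close>, with
  measure at least a fixed multiple of \<open>r n powr t\<close>. At a density point this fails for
  large \<open>n\<close>.\<close>

lemma density_point_address:
  assumes t: "ereal t = hausdorff_dim E" and A: "compact A" "A \<subseteq> E" "hausdorff_measure t A \<noteq> 0"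
  obtains h y x where "x \<in> A" "\<And>n. h n \<in> I" "\<And>n. y n \<in> E" "\<And>n. x = wm (prefix h n) (y n)"
    "\<And>v. v \<in> lists I \<Longrightarrow> \<forall>\<^sub>F n in sequentially. wm (prefix h n @ v) ` E \<inter> A \<noteq> {}"
proof -
  have t0: "0 \<le> t" using hausdorff_dim_nonneg[of E] by (simp flip: t)
  have "hausdorff_measure t (E - A) < top"
    using hausdorff_measure_mono[of "E - A" E t] hausdorff_measure_E_finite[OF t]
    by (auto intro: order_le_less_trans)
  then obtain x where x: "x \<in> A" and dens: "\<And>c. 0 < c \<Longrightarrow>
      \<exists>\<delta>>0. \<forall>r. 0 < r \<and> r < \<delta> \<longrightarrow> hausdorff_measure t ((E - A) \<inter> cball x r) < ennreal (c * r powr t)"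
    using hausdorff_measure_density_point[OF t0 compact_imp_closed[OF A(1)], of "E - A"] A(3) by blast
  obtain h y where h: "\<And>n. h n \<in> I" "\<And>n. y n \<in> E" "\<And>n. x = wm (prefix h n) (y n)"
    using address[of x] x A(2) by blast
  have pre: "prefix h n \<in> lists I" for n using h(1) by auto
  have "hausdorff_measure t E \<noteq> 0"
    using hausdorff_measure_mono[OF A(2), of t] A(3) by auto
  then obtain m where m: "0 < m"
    "\<And>w p. \<lbrakk>w \<in> lists I; p \<in> E\<rbrakk> \<Longrightarrow> ennreal (m * lam w p powr t) \<le> hausdorff_measure t (wm w ` E)"
    using hausdorff_measure_word_image_ge[OF t] by blast
  define r where "r n = C * lam (prefix h n) (y n)" for n
  have r: "0 < r n" for n using lam_bounds(3)[OF pre h(2)] C by (simp add: r_def)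
  have "r \<longlonglongrightarrow> C * 0"
    unfolding r_def by (intro tendsto_mult tendsto_const lam_tendsto_0 h)
  then have r_to_0: "\<forall>\<^sub>F n in sequentially. r n < \<delta>" if "0 < \<delta>" for \<delta>
    using that by (intro order_tendstoD(2)[of r 0]) auto
  show thesis
  proof (rule that[OF x h])
    fix v assume v: "v \<in> lists I"
    \<comment> \<open>One \<open>C\<close> comes from the radius \<open>r n\<close>, the other from
      the change of base point in the norm of \<open>prefix h n\<close>; the letters of
      \<open>v\<close> cost at most \<open>\<sigma> ^ length v\<close>.\<close>
    define k where "k = \<sigma> ^ length v / C\<^sup>2"
    have k: "0 < k" using \<sigma> C by (simp add: k_def)
    define c where "c = m * k powr t"
    have "0 < c" using m k by (simp add: c_def)
    then obtain \<delta> where \<delta>: "0 < \<delta>"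
      "\<And>r. 0 < r \<Longrightarrow> r < \<delta> \<Longrightarrow> hausdorff_measure t ((E - A) \<inter> cball x r) < ennreal (c * r powr t)"
      using dens by blast
    obtain p where p: "p \<in> E" using E_ne by blast
    have "wm (prefix h n @ v) ` E \<inter> A \<noteq> {}" if n: "r n < \<delta>" for n
    proof
      assume empty: "wm (prefix h n @ v) ` E \<inter> A = {}"
      have sub: "wm (prefix h n @ v) ` E \<subseteq> (E - A) \<inter> cball x (r n)"
      proof
        fix z assume z: "z \<in> wm (prefix h n @ v) ` E"
        then obtain e where e: "e \<in> E" "z = wm (prefix h n) (wm v e)" by (auto simp: word_map_append)
        have ve: "wm v e \<in> E" using v e word_maps_E by blast
        have "dist x z \<le> r n" unfolding h(3)[of n] e(2) r_def by (rule dist_word[OF pre h(2) ve])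
        moreover have "z \<in> E" unfolding e(2) using pre ve by (rule word_maps_E)
        ultimately show "z \<in> (E - A) \<inter> cball x (r n)" using z empty by auto
      qed
      have "k * r n = lam (prefix h n) (y n) / C * \<sigma> ^ length v"
        using C by (simp add: k_def r_def power2_eq_square)
      also have "\<dots> \<le> lam (prefix h n) (wm v p) * lam v p"
        using v p h(2) pre C \<sigma> by (intro mult_mono lam_ge_of_comparable lam_bounds word_maps_E) auto
      also have "\<dots> = lam (prefix h n @ v) p" using lam_append[OF pre v p] by simp
      finally have le: "k * r n \<le> lam (prefix h n @ v) p" .
      have "c * r n powr t = m * (k * r n) powr t" by (simp add: c_def powr_mult)
      also have "\<dots> \<le> m * lam (prefix h n @ v) p powr t"
        using m k r[of n] t0 le by (intro mult_left_mono powr_mono2) auto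
      finally have "ennreal (c * r n powr t) \<le> ennreal (m * lam (prefix h n @ v) p powr t)" by (rule ennreal_leI)
      also have "\<dots> \<le> hausdorff_measure t (wm (prefix h n @ v) ` E)"
        using pre v p by (intro m) auto
      also have "\<dots> \<le> hausdorff_measure t ((E - A) \<inter> cball x (r n))" by (rule hausdorff_measure_mono[OF sub])
      also have "\<dots> < ennreal (c * r n powr t)" by (rule \<delta>(2)[OF r n])
      finally show False by simp
    qed
    then show "\<forall>\<^sub>F n in sequentially. wm (prefix h n @ v) ` E \<inter> A \<noteq> {}"
      using r_to_0[OF \<delta>(1)] by (auto elim: eventually_mono)
  qed
qed

end

section \<open>Submanifolds\<close>

text \<open>Being a submanifold is a local matter: at each point the inverse function theorem makes
  \<open>f\<close> itself a chart, with \<open>T\<close> as the model subspace. The uniform bound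
  \<open>c\<close> gives injectivity of the derivatives and controls the derivative of the
  inverse.\<close>

lemma C1_submanifold_vimage:
  fixes f :: "'a::euclidean_space \<Rightarrow> 'a" and g :: "'a \<Rightarrow> 'a \<Rightarrow>\<^sub>L 'a"
  assumes W: "open W" and der: "\<And>z. z \<in> W \<Longrightarrow> (f has_derivative blinfun_apply (g z)) (at z)"
    and cont: "continuous_on W g" and "0 < c"
    and exp: "\<And>z v. z \<in> W \<Longrightarrow> c * norm v \<le> norm (blinfun_apply (g z) v)" and T: "subspace T"
  shows "C1_submanifold (dim T) {z \<in> W. f z \<in> T}"
  unfolding C1_submanifold_def
proof
  fix x assume "x \<in> {z \<in> W. f z \<in> T}"
  then have x: "x \<in> W" by simp
  have inj: "inj (blinfun_apply (g z))" if "z \<in> W" for z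
  proof (rule injI)
    fix u v assume "blinfun_apply (g z) u = blinfun_apply (g z) v"
    then have "c * norm (u - v) \<le> 0" using exp[OF that, of "u - v"] by (simp add: blinfun.diff_right)
    then show "u = v" using \<open>0 < c\<close> by (simp add: mult_le_0_iff)
  qed
  obtain B where B: "linear B" "B \<circ> blinfun_apply (g x) = id"
    using linear_injective_left_inverse[OF _ inj[OF x]] blinfun.bounded_linear_right
      bounded_linear.linear by blast
  have "Blinfun B o\<^sub>L g x = id_blinfun"
    using B by (intro blinfun_eqI) (simp add: bounded_linear_Blinfun_apply linear_conv_bounded_linear[symmetric] fun_eq_iff)
  then obtain U V G G' where U: "open U" "U \<subseteq> W" "x \<in> U" and V: "open V" and hom: "homeomorphism U V f G"
    and derG: "\<And>y. y \<in> V \<Longrightarrow> (G has_derivative G' y) (at y)"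
    and G': "\<And>y. y \<in> V \<Longrightarrow> G' y = inv (blinfun_apply (g (G y)))"
    and bij: "\<And>y. y \<in> V \<Longrightarrow> bij (blinfun_apply (g (G y)))"
    using inverse_function_theorem[OF W der cont x] by metis
  have C1f: "C1_on f U"
    unfolding C1_on_def using der U continuous_on_subset[OF cont] by blast
  have "C1_on G V"
    unfolding C1_on_def
  proof (intro exI[of _ "\<lambda>y. Blinfun (G' y)"] conjI ballI)
    have bl: "bounded_linear (G' y)" if "y \<in> V" for y
      using derG[OF that] by (rule has_derivative_bounded_linear)
    then show "(G has_derivative blinfun_apply (Blinfun (G' y))) (at y)" if "y \<in> V" for y
      using derG[OF that] that by (simp add: bounded_linear_Blinfun_apply)
    have GW: "G y \<in> W" if "y \<in> V" for y
      using hom that U by (auto simp: homeomorphism_def)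
    have right_inv: "blinfun_apply (g (G y)) (G' y v) = v" if "y \<in> V" for y v
      using G'[OF that] bij[OF that] by (simp add: bij_is_surj surj_f_inv_f)
    \<comment> \<open>Inverses of two linear maps that are bounded below by \<open>c\<close> differ
      by at most \<open>1 / c\<^sup>2\<close> times the difference of the maps. So the derivative of
      \<open>G\<close> inherits continuity from \<open>g\<close> composed with
      \<open>G\<close>.\<close>
    have bound: "norm (Blinfun (G' y) - Blinfun (G' z)) \<le> norm (g (G y) - g (G z)) / c\<^sup>2"
      if "y \<in> V" "z \<in> V" for y z
    proof (rule norm_blinfun_bound)
      fix v
      have "c * norm (G' z v) \<le> norm v" using exp[OF GW[OF that(2)], of "G' z v"] right_inv[OF that(2)] by simp
      then have z: "norm (G' z v) \<le> norm v / c" using \<open>0 < c\<close> by (simp add: field_simps)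
      have "blinfun_apply (g (G y)) (G' y v - G' z v) = - blinfun_apply (g (G y) - g (G z)) (G' z v)"
        using that by (simp add: blinfun.diff_right blinfun.diff_left right_inv)
      then have "c * norm (G' y v - G' z v) \<le> norm (blinfun_apply (g (G y) - g (G z)) (G' z v))"
        using exp[OF GW[OF that(1)], of "G' y v - G' z v"] by simp
      also have "\<dots> \<le> norm (g (G y) - g (G z)) * norm (G' z v)" by (rule norm_blinfun)
      also have "\<dots> \<le> norm (g (G y) - g (G z)) * (norm v / c)" by (intro mult_left_mono z) auto
      finally show "norm (blinfun_apply (Blinfun (G' y) - Blinfun (G' z)) v) \<le> norm (g (G y) - g (G z)) / c\<^sup>2 * norm v"
        using \<open>0 < c\<close> that by (simp add: blinfun.diff_left bounded_linear_Blinfun_apply bl field_simps power2_eq_square)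
    qed simp
    have "continuous_on V G" using hom by (simp add: homeomorphism_def)
    then have contg: "continuous_on V (\<lambda>y. g (G y))"
      using continuous_on_compose2[OF cont] GW by blast
    show "continuous_on V (\<lambda>y. Blinfun (G' y))"
      unfolding continuous_on_iff
    proof (intro ballI allI impI)
      fix y e :: real and y0 assume y0: "y0 \<in> V" and e: "0 < e"
      then have "0 < e * c\<^sup>2" using \<open>0 < c\<close> by simp
      then obtain d where d: "0 < d" "\<And>y. y \<in> V \<Longrightarrow> dist y y0 < d \<Longrightarrow> dist (g (G y)) (g (G y0)) < e * c\<^sup>2"
        using contg y0 unfolding continuous_on_iff by blast
      have "dist (Blinfun (G' y)) (Blinfun (G' y0)) < e" if "y \<in> V" "dist y y0 < d" for y
      proof -
        have "dist (Blinfun (G' y)) (Blinfun (G' y0)) \<le> dist (g (G y)) (g (G y0)) / c\<^sup>2"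
          using bound[OF that(1) y0] by (simp add: dist_norm)
        also have "\<dots> < e" using d(2)[OF that] \<open>0 < c\<close> by (simp add: field_simps)
        finally show ?thesis .
      qed
      with d(1) show "\<exists>d>0. \<forall>y\<in>V. dist y y0 < d \<longrightarrow> dist (Blinfun (G' y)) (Blinfun (G' y0)) < e" by blast
    qed
  qed
  moreover have "f ` (U \<inter> {z \<in> W. f z \<in> T}) = V \<inter> T"
    using hom U(2) by (auto simp: homeomorphism_def image_iff)
  ultimately show "\<exists>(U::'a set) (V::'a set) f' g' (L::'a set). open U \<and> x \<in> U \<and> open V \<and> homeomorphism U V f' g' \<and> C1_on f' U \<and> C1_on g' V \<and>
      subspace L \<and> dim L = dim T \<and> f' ` (U \<inter> {z \<in> W. f z \<in> T}) = V \<inter> L"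
    using U(1,3) V hom C1f T 
    by - (rule exI[of _ U], rule exI[of _ V], rule exI[of _ f], rule exI[of _ G], rule exI[of _ T],
        intro conjI; (assumption | rule refl))
qed

text \<open>The tangent space is the image of \<open>L\<close> under the derivative of the inverse
  chart. To first order, \<open>z - x\<close> is that derivative applied to
  \<open>f z - f x\<close>, which is a vector of \<open>L\<close> for \<open>z\<close> in
  \<open>A\<close>.\<close>

lemma tangent_space_of_chart:
  fixes f :: "'a::euclidean_space \<Rightarrow> 'a"
  assumes U: "open U" "open V" and hom: "homeomorphism U V f g" and C1: "C1_on f U" "C1_on g V"
    and L: "subspace L" and x: "x \<in> U" and A: "\<And>z. z \<in> A \<Longrightarrow> f z \<in> L" and "f x \<in> L"
  obtains T where "subspace T" "dim T = dim L"
    "\<And>\<epsilon>. 0 < \<epsilon> \<Longrightarrow> \<exists>\<delta>>0. \<forall>z\<in>A. norm (z - x) < \<delta> \<longrightarrow> (\<exists>\<tau>\<in>T. norm (z - x - \<tau>) \<le> \<epsilon> * norm (z - x))"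
proof -
  obtain f' g' where f': "(f has_derivative blinfun_apply f') (at x)"
    and g': "(g has_derivative blinfun_apply g') (at (f x))"
    using C1 x hom unfolding C1_on_def homeomorphism_def by (metis imageI)
  have "(g \<circ> f has_derivative blinfun_apply g' \<circ> blinfun_apply f') (at x)"
    by (rule diff_chain_at[OF f' g'])
  then have "(id has_derivative blinfun_apply g' \<circ> blinfun_apply f') (at x)"
    by (rule has_derivative_transform_within_open[OF _ U(1) x]) (use hom in \<open>auto simp: homeomorphism_def\<close>)
  then have gf: "blinfun_apply g' \<circ> blinfun_apply f' = id"
    using has_derivative_unique has_derivative_id by (metis id_def)
  have fx: "f x \<in> V" "g (f x) = x" using hom x by (auto simp: homeomorphism_def)
  \<comment> \<open>Both orders of composition matter: this one makes \<open>g'\<close> injective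
    and so preserves the dimension, the other one rewrites \<open>z - x\<close>.\<close>
  have "(f \<circ> g has_derivative blinfun_apply f' \<circ> blinfun_apply g') (at (f x))"
    by (rule diff_chain_at[OF g']) (use f' fx in simp)
  then have "(id has_derivative blinfun_apply f' \<circ> blinfun_apply g') (at (f x))"
    by (rule has_derivative_transform_within_open[OF _ U(2) fx(1)]) (use hom in \<open>auto simp: homeomorphism_def\<close>)
  then have fg: "blinfun_apply f' \<circ> blinfun_apply g' = id"
    using has_derivative_unique has_derivative_id by (metis id_def)
  have lin: "linear (blinfun_apply g')"
    using blinfun.bounded_linear_right bounded_linear.linear by blast
  define T where "T = blinfun_apply g' ` L"
  have "inj (blinfun_apply g')" using fg by (metis inj_on_id inj_on_imageI2)
  then have dim: "dim T = dim L" unfolding T_def using lin by (intro dim_image_eq) (auto simp: inj_on_def)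
  show thesis
  proof (rule that[of T])
    show "subspace T" unfolding T_def using lin L by (rule linear_subspace_image)
    show "dim T = dim L" by (rule dim)
    fix \<epsilon> :: real assume \<epsilon>: "0 < \<epsilon>"
    define e where "e = \<epsilon> / (norm g' + 1)"
    have e: "0 < e" unfolding e_def using \<epsilon> by (simp add: add_nonneg_pos)
    obtain \<delta> where \<delta>: "0 < \<delta>" "\<And>z. norm (z - x) < \<delta> \<Longrightarrow> norm (f z - f x - blinfun_apply f' (z - x)) \<le> e * norm (z - x)"
      using f' e unfolding has_derivative_at_alt by blast
    show "\<exists>\<delta>>0. \<forall>z\<in>A. norm (z - x) < \<delta> \<longrightarrow> (\<exists>\<tau>\<in>T. norm (z - x - \<tau>) \<le> \<epsilon> * norm (z - x))"
    proof (intro exI[of _ \<delta>] conjI ballI impI \<delta>(1))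
      fix z assume z: "z \<in> A" "norm (z - x) < \<delta>"
      let ?\<tau> = "blinfun_apply g' (f z - f x)"
      have "?\<tau> \<in> T" unfolding T_def using L A[OF z(1)] \<open>f x \<in> L\<close> by (intro imageI subspace_diff)
      moreover have "norm (z - x - ?\<tau>) \<le> \<epsilon> * norm (z - x)"
      proof -
        have "z - x = blinfun_apply g' (blinfun_apply f' (z - x))" using gf by (simp add: fun_eq_iff)
        then have "norm (z - x - ?\<tau>) = norm (blinfun_apply g' (f z - f x - blinfun_apply f' (z - x)))"
          by (metis blinfun.diff_right norm_minus_commute)
        also have "\<dots> \<le> norm g' * norm (f z - f x - blinfun_apply f' (z - x))" by (rule norm_blinfun)
        also have "\<dots> \<le> norm g' * (e * norm (z - x))" by (intro mult_left_mono \<delta>(2) z) auto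
        also have "\<dots> \<le> (norm g' + 1) * (e * norm (z - x))" using e by (intro mult_right_mono) auto
        also have "\<dots> = \<epsilon> * norm (z - x)"
          unfolding e_def using add_nonneg_pos[OF norm_ge_zero[of g'] zero_less_one] by simp
        finally show ?thesis .
      qed
      ultimately show "\<exists>\<tau>\<in>T. norm (z - x - \<tau>) \<le> \<epsilon> * norm (z - x)" by blast
    qed
  qed
qed

lemma C1_submanifold_chart:
  fixes M :: "'a::euclidean_space set"
  assumes "C1_submanifold l M" "x \<in> M"
  obtains U V :: "'a set" and f g and L :: "'a set"
  where "open U" "x \<in> U" "open V" "homeomorphism U V f g" "C1_on f U" "C1_on g V"
    "subspace L" "dim L = l" "f ` (U \<inter> M) = V \<inter> L"
  using bspec[OF assms(1)[unfolded C1_submanifold_def] assms(2)]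
  by (elim exE conjE) (rule that; assumption)

text \<open>The part of \<open>M\<close> in a small closed ball inside a chart domain is closed,
  being the set where \<open>f\<close> takes values in \<open>L\<close>. By Lindelof's theorem
  countably many such balls cover \<open>M\<close>, so the part of \<open>E \<inter> M\<close> in
  one of them has positive measure.\<close>

lemma compact_piece_of_submanifold:
  fixes M E :: "'a::euclidean_space set"
  assumes M: "C1_submanifold l M" and E: "compact E" and pos: "hausdorff_measure t (E \<inter> M) \<noteq> 0"
  obtains A where "compact A" "A \<subseteq> E \<inter> M" "hausdorff_measure t A \<noteq> 0"
    "\<forall>x\<in>A. \<exists>T. subspace T \<and> dim T = l \<and>
       (\<forall>\<epsilon>>0. \<exists>\<delta>>0. \<forall>z\<in>A. norm (z - x) < \<delta> \<longrightarrow> (\<exists>\<tau>\<in>T. norm (z - x - \<tau>) \<le> \<epsilon> * norm (z - x)))"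
proof -
  have "\<exists>e>0. compact (cball x e \<inter> M) \<and> (\<forall>y\<in>cball x e \<inter> M. \<exists>T. subspace T \<and> dim T = l \<and>
       (\<forall>\<epsilon>>0. \<exists>\<delta>>0. \<forall>z\<in>cball x e \<inter> M. norm (z - y) < \<delta> \<longrightarrow> (\<exists>\<tau>\<in>T. norm (z - y - \<tau>) \<le> \<epsilon> * norm (z - y))))"
    if xM: "x \<in> M" for x
  proof -
    obtain U V :: "'a set" and f g and L :: "'a set" where U: "open U" "x \<in> U" "open V" and hom: "homeomorphism U V f g"
      and C1: "C1_on f U" "C1_on g V" and L: "subspace L" "dim L = l" and img: "f ` (U \<inter> M) = V \<inter> L"
      by (rule C1_submanifold_chart[OF M xM])
    obtain e where e: "0 < e" "cball x e \<subseteq> U" using U open_contains_cball by blast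
    have inL: "f z \<in> L" if "z \<in> cball x e \<inter> M" for z using that e img by blast
    have "cball x e \<inter> M = cball x e \<inter> f -` L"
    proof (intro subset_antisym subsetI)
      fix z assume "z \<in> cball x e \<inter> f -` L"
      then have z: "z \<in> cball x e" "f z \<in> L" "z \<in> U" using e by auto
      then have "f z \<in> V \<inter> L" using hom by (auto simp: homeomorphism_def)
      then obtain z' where z': "z' \<in> U" "z' \<in> M" "f z = f z'" unfolding img[symmetric] by blast
      then have "z = z'" using hom z(3) unfolding homeomorphism_def by metis
      then show "z \<in> cball x e \<inter> M" using z z' by simp
    qed (use inL in auto)
    moreover have "continuous_on U f" using hom by (simp add: homeomorphism_def)
    then have "continuous_on (cball x e) f" using e(2) by (rule continuous_on_subset)
    then have "closed (cball x e \<inter> f -` L)"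
      by (rule continuous_closed_preimage) (use closed_subspace[OF L(1)] in auto)
    ultimately have "closed (cball x e \<inter> M)" by simp
    then have "compact (cball x e \<inter> (cball x e \<inter> M))" by (intro compact_Int_closed compact_cball)
    then have "compact (cball x e \<inter> M)" by (simp add: Int_assoc[symmetric])
    moreover have "\<exists>T. subspace T \<and> dim T = l \<and>
       (\<forall>\<epsilon>>0. \<exists>\<delta>>0. \<forall>z\<in>cball x e \<inter> M. norm (z - y) < \<delta> \<longrightarrow> (\<exists>\<tau>\<in>T. norm (z - y - \<tau>) \<le> \<epsilon> * norm (z - y)))"
      if y: "y \<in> cball x e \<inter> M" for y
    proof -
      have yU: "y \<in> U" using y e by blast
      show ?thesis
        by (rule tangent_space_of_chart[OF U(1,3) hom C1 L(1) yU inL inL[OF y], of "cball x e \<inter> M"])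
           (use L(2) in blast)+
    qed
    ultimately show ?thesis using e(1) by blast
  qed
  then obtain e where e: "\<And>x. x \<in> M \<Longrightarrow> 0 < e x" "\<And>x. x \<in> M \<Longrightarrow> compact (cball x (e x) \<inter> M)"
    and T: "\<And>x y. \<lbrakk>x \<in> M; y \<in> cball x (e x) \<inter> M\<rbrakk> \<Longrightarrow> \<exists>T. subspace T \<and> dim T = l \<and>
       (\<forall>\<epsilon>>0. \<exists>\<delta>>0. \<forall>z\<in>cball x (e x) \<inter> M. norm (z - y) < \<delta> \<longrightarrow> (\<exists>\<tau>\<in>T. norm (z - y - \<tau>) \<le> \<epsilon> * norm (z - y)))"
    by metis
  obtain \<F> where \<F>: "\<F> \<subseteq> (\<lambda>x. ball x (e x)) ` M" "countable \<F>" "\<Union>\<F> = \<Union>((\<lambda>x. ball x (e x)) ` M)"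
    using Lindelof[of "(\<lambda>x. ball x (e x)) ` M"] by auto
  obtain D where D: "countable D" "D \<subseteq> M" "\<F> = (\<lambda>x. ball x (e x)) ` D"
    using iffD1[OF countable_subset_image conjI[OF \<F>(2,1)]] by metis
  have "E \<inter> M \<subseteq> (\<Union>x\<in>D. E \<inter> (cball x (e x) \<inter> M))"
  proof
    fix z assume z: "z \<in> E \<inter> M"
    then have "z \<in> \<Union>\<F>" unfolding \<F>(3) using e(1) by (auto intro!: bexI[of _ z])
    then obtain x where "x \<in> D" "z \<in> ball x (e x)" unfolding D(3) by blast
    then show "z \<in> (\<Union>x\<in>D. E \<inter> (cball x (e x) \<inter> M))"
      using z by (auto intro!: bexI[of _ x])
  qed
  then have "hausdorff_measure t (\<Union>x\<in>D. E \<inter> (cball x (e x) \<inter> M)) \<noteq> 0"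
    using hausdorff_measure_mono pos by (metis le_zero_eq)
  then obtain x where x: "x \<in> D" "hausdorff_measure t (E \<inter> (cball x (e x) \<inter> M)) \<noteq> 0"
    using hausdorff_measure_null_UN[OF D(1), of t "\<lambda>x. E \<inter> (cball x (e x) \<inter> M)"] by blast
  have xM: "x \<in> M" using x D by blast
  show thesis
  proof (rule that[of "E \<inter> (cball x (e x) \<inter> M)"])
    show "compact (E \<inter> (cball x (e x) \<inter> M))" using E e(2)[OF xM] by (rule compact_Int)
    show "\<forall>y\<in>E \<inter> (cball x (e x) \<inter> M). \<exists>T. subspace T \<and> dim T = l \<and> (\<forall>\<epsilon>>0. \<exists>\<delta>>0. \<forall>z\<in>E \<inter> (cball x (e x) \<inter> M).
        norm (z - y) < \<delta> \<longrightarrow> (\<exists>\<tau>\<in>T. norm (z - y - \<tau>) \<le> \<epsilon> * norm (z - y)))"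
    proof
    fix y assume "y \<in> E \<inter> (cball x (e x) \<inter> M)"
    then have "y \<in> cball x (e x) \<inter> M" by blast
    from T[OF xM this] obtain T0 where T0: "subspace T0" "dim T0 = l"
      and tan: "\<forall>\<epsilon>>0. \<exists>\<delta>>0. \<forall>z\<in>cball x (e x) \<inter> M. norm (z - y) < \<delta> \<longrightarrow>
          (\<exists>\<tau>\<in>T0. norm (z - y - \<tau>) \<le> \<epsilon> * norm (z - y))"
      by (elim exE conjE)
    show "\<exists>T. subspace T \<and> dim T = l \<and> (\<forall>\<epsilon>>0. \<exists>\<delta>>0. \<forall>z\<in>E \<inter> (cball x (e x) \<inter> M).
        norm (z - y) < \<delta> \<longrightarrow> (\<exists>\<tau>\<in>T. norm (z - y - \<tau>) \<le> \<epsilon> * norm (z - y)))"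
    proof (intro exI[of _ T0] conjI allI impI T0)
      fix \<epsilon> :: real assume "0 < \<epsilon>"
      then obtain \<delta> where \<delta>: "0 < \<delta>" "\<forall>z\<in>cball x (e x) \<inter> M. norm (z - y) < \<delta> \<longrightarrow>
          (\<exists>\<tau>\<in>T0. norm (z - y - \<tau>) \<le> \<epsilon> * norm (z - y))" using tan by auto
      then show "\<exists>\<delta>>0. \<forall>z\<in>E \<inter> (cball x (e x) \<inter> M). norm (z - y) < \<delta> \<longrightarrow>
          (\<exists>\<tau>\<in>T0. norm (z - y - \<tau>) \<le> \<epsilon> * norm (z - y))"
        by (intro exI[of _ \<delta>] conjI ballI) auto
    qed
    qed
  qed (use x in \<open>simp_all add: le_infI2\<close>)
qed

section \<open>Blowing up along a coding\<close>

text \<open>The rescaled maps are controlled for pairs of points in a common ball around a point of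
  \<open>E\<close>. Hence the Lipschitz bound is asked for at distances below \<open>r\<close> only,
  which still gives equicontinuity.\<close>

lemma Arzela_Ascoli_locally_lipschitz:
  fixes F :: "nat \<Rightarrow> 'a::euclidean_space \<Rightarrow> 'b::{real_normed_vector,heine_borel}"
  assumes S: "compact S" and bd: "\<And>n x. x \<in> S \<Longrightarrow> norm (F n x) \<le> M"
    and "0 < r" "0 \<le> L"
    and lip: "\<And>n x y. \<lbrakk>x \<in> S; y \<in> S; norm (x - y) < r\<rbrakk> \<Longrightarrow> norm (F n x - F n y) \<le> L * norm (x - y)"
  obtains g k where "continuous_on S g" "strict_mono (k :: nat \<Rightarrow> nat)" "uniform_limit S (F \<circ> k) g sequentially"
proof (rule Arzela_Ascoli[OF S bd])
  show "\<exists>d. 0 < d \<and> (\<forall>n y. y \<in> S \<and> norm (x - y) < d \<longrightarrow> norm (F n x - F n y) < e)"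
    if "x \<in> S" "0 < e" for x e
  proof (intro exI[of _ "min r (e / (L + 1))"] conjI allI impI)
    show "0 < min r (e / (L + 1))" using that assms by simp
    fix n y assume y: "y \<in> S \<and> norm (x - y) < min r (e / (L + 1))"
    then have "norm (F n x - F n y) \<le> L * norm (x - y)" using that by (intro lip) auto
    also have "\<dots> \<le> (L + 1) * norm (x - y)" by (intro mult_right_mono) auto
    also have "\<dots> < e" using y \<open>0 \<le> L\<close> by (simp add: field_simps)
    finally show "norm (F n x - F n y) < e" .
  qed
  fix g and k :: "nat \<Rightarrow> nat"
  assume g: "continuous_on S g" "strict_mono k"
    and conv: "\<And>e. 0 < e \<Longrightarrow> \<exists>N. \<forall>n x. N \<le> n \<and> x \<in> S \<longrightarrow> norm (F (k n) x - g x) < e"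
  have "uniform_limit S (F \<circ> k) g sequentially"
    unfolding uniform_limit_sequentially_iff using conv by (simp add: dist_norm) blast
  with g show thesis by (rule that)
qed auto

lemma norm_inverse_scaleR_le:
  fixes v :: "'a::real_normed_vector"
  assumes "0 < a" "norm v \<le> c * a"
  shows "norm (v /\<^sub>R a) \<le> c"
  using assms by (simp add: divide_inverse_commute[symmetric] divide_le_eq)

context bounded_distortion_ifs begin

text \<open>Division by \<open>\<Lambda> n\<close> makes the derivatives uniformly bounded and
  uniformly Lipschitz at small distances, so a subsequence converges together with its derivatives.
  Their lower bound survives in the limit and will make \<open>f\<close> a local
  diffeomorphism.\<close>

lemma blow_up_limit:
  assumes h: "\<And>n. h n \<in> I" and y: "\<And>n. y n \<in> E" and x: "\<And>n. x = wm (prefix h n) (y n)"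
  defines "\<Lambda> \<equiv> \<lambda>n. lam (prefix h n) (y n)" and "W \<equiv> (\<Union>z\<in>E. ball z (r0 / 2))"
  obtains f g k where "strict_mono (k :: nat \<Rightarrow> nat)"
    "\<forall>z\<in>W. (f has_derivative blinfun_apply (g z)) (at z)" "continuous_on W g"
    "\<forall>z\<in>W. \<forall>v. norm v / (2 * C) \<le> norm (blinfun_apply (g z) v)"
    "uniform_limit W (\<lambda>n z. (wm (prefix h (k n)) z - x) /\<^sub>R \<Lambda> (k n)) f sequentially"
proof -
  \<comment> \<open>A compact neighbourhood of radius \<open>r0 / 2\<close>: two of its points at
    distance less than \<open>r0 / 2\<close> lie in one ball of radius \<open>r0\<close> around a
    point of \<open>E\<close>, where the distortion estimates apply.\<close>
  define S where "S = {z. infdist z E \<le> r0 / 2}"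
  have S: "compact S" unfolding S_def using compact_E E_ne r0 by (intro compact_infdist_le) auto
  have near: "\<exists>p\<in>E. dist p z \<le> r0 / 2" if "z \<in> S" for z
  proof -
    obtain p where "p \<in> E" "infdist z E = dist z p"
      by (rule infdist_attains_inf[OF compact_imp_closed[OF compact_E] E_ne])
    then show ?thesis using that by (intro bexI[of _ p]) (auto simp: S_def dist_commute)
  qed
  have W_S: "W \<subseteq> S"
  proof
    fix z assume "z \<in> W"
    then obtain p where "p \<in> E" "dist p z < r0 / 2" by (auto simp: W_def)
    then show "z \<in> S" using infdist_le[of p E z] by (simp add: S_def dist_commute)
  qed
  have pre: "prefix h n \<in> lists I" for n using h by auto
  have \<Lambda>: "0 < \<Lambda> n" for n unfolding \<Lambda>_def by (rule lam_bounds(3)[OF pre y])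
  have lam_le: "lam (prefix h n) p \<le> C * \<Lambda> n" "\<Lambda> n / C \<le> lam (prefix h n) p" if "p \<in> E" for n p
    unfolding \<Lambda>_def by (rule lam_comparable[OF pre that y]) (rule lam_ge_of_comparable[OF pre y that])
  define F where "F n z = (wm (prefix h n) z - x) /\<^sub>R \<Lambda> n" for n z
  define G where "G n z = dw (prefix h n) z /\<^sub>R \<Lambda> n" for n z
  have near2: "\<exists>p\<in>E. z \<in> ball p r0 \<and> z' \<in> ball p r0" if "z \<in> S" "z' \<in> S" "norm (z - z') < r0 / 2" for z z'
  proof -
    obtain p where "p \<in> E" "dist p z \<le> r0 / 2" using near \<open>z \<in> S\<close> by blast
    then show ?thesis using that r0 dist_triangle[of p z' z] by (auto simp: dist_norm intro!: bexI[of _ p])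
  qed
  have G_bd: "norm (G n z) \<le> C * C" if z: "z \<in> S" for n z
  proof -
    obtain p where p: "p \<in> E" "z \<in> ball p r0" using near2[OF z z] r0 by auto
    have "lam (prefix h n) z \<le> C * lam (prefix h n) p" by (rule deriv_le[OF pre p])
    also have "\<dots> \<le> C * (C * \<Lambda> n)" using C by (intro mult_left_mono lam_le p) auto
    finally show ?thesis unfolding G_def by (intro norm_inverse_scaleR_le \<Lambda>) (simp add: mult.assoc)
  qed
  have G_lip: "norm (G n z - G n z') \<le> C * C * norm (z - z')" if zz: "z \<in> S" "z' \<in> S" "norm (z - z') < r0 / 2" for n z z'
  proof -
    obtain p where p: "p \<in> E" "z \<in> ball p r0" "z' \<in> ball p r0" using near2[OF zz] by blast
    have "norm (dw (prefix h n) z - dw (prefix h n) z') \<le> C * lam (prefix h n) p * norm (z - z')"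
      by (rule deriv_lip[OF pre p])
    also have "\<dots> \<le> C * (C * \<Lambda> n) * norm (z - z')" using C by (intro mult_left_mono mult_right_mono lam_le p) auto
    finally have "norm ((dw (prefix h n) z - dw (prefix h n) z') /\<^sub>R \<Lambda> n) \<le> C * C * norm (z - z')"
      by (intro norm_inverse_scaleR_le \<Lambda>) (simp add: mult_ac)
    moreover have "G n z - G n z' = (dw (prefix h n) z - dw (prefix h n) z') /\<^sub>R \<Lambda> n"
      by (simp add: G_def scaleR_diff_right)
    ultimately show ?thesis by simp
  qed
  have F_lip: "norm (F n z - F n z') \<le> 2 * C * norm (z - z')" if zz: "z \<in> S" "z' \<in> S" "norm (z - z') < r0 / 2" for n z z'
  proof -
    obtain p where p: "p \<in> E" "z \<in> ball p r0" "z' \<in> ball p r0" using near2[OF zz] by blast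
    have "norm (wm (prefix h n) z - wm (prefix h n) z') \<le> 2 * lam (prefix h n) p * norm (z - z')"
      using bilip[OF pre p] by (simp add: dist_norm)
    also have "\<dots> \<le> 2 * (C * \<Lambda> n) * norm (z - z')" using C by (intro mult_left_mono mult_right_mono lam_le p) auto
    finally have "norm ((wm (prefix h n) z - wm (prefix h n) z') /\<^sub>R \<Lambda> n) \<le> 2 * C * norm (z - z')"
      by (intro norm_inverse_scaleR_le \<Lambda>) (simp add: mult_ac)
    moreover have "F n z - F n z' = (wm (prefix h n) z - wm (prefix h n) z') /\<^sub>R \<Lambda> n"
      by (simp add: F_def flip: scaleR_diff_right)
    ultimately show ?thesis by simp
  qed
  have F_bd: "norm (F n z) \<le> 2 * C * r0 + C" if z: "z \<in> S" for n z
  proof -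
    obtain p where p: "p \<in> E" "z \<in> ball p r0" using near2[OF z z] r0 by auto
    have "dist (wm (prefix h n) z) x \<le> dist (wm (prefix h n) p) (wm (prefix h n) z) + dist (wm (prefix h n) (y n)) (wm (prefix h n) p)"
      unfolding x[of n] by (metis dist_commute dist_triangle2 add.commute)
    also have "\<dots> \<le> 2 * lam (prefix h n) p * r0 + C * \<Lambda> n"
    proof (intro add_mono)
      have "dist (wm (prefix h n) p) (wm (prefix h n) z) \<le> 2 * lam (prefix h n) p * dist p z"
        using bilip[OF pre p(1) _ p(2), of p] r0 by simp
      also have "\<dots> \<le> 2 * lam (prefix h n) p * r0" using p by (intro mult_left_mono) auto
      finally show "dist (wm (prefix h n) p) (wm (prefix h n) z) \<le> 2 * lam (prefix h n) p * r0" .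
      show "dist (wm (prefix h n) (y n)) (wm (prefix h n) p) \<le> C * \<Lambda> n"
        unfolding \<Lambda>_def by (rule dist_word[OF pre y p(1)])
    qed
    also have "\<dots> \<le> 2 * (C * \<Lambda> n) * r0 + C * \<Lambda> n"
      using r0 C less_imp_le[OF \<Lambda>[of n]] by (intro add_mono mult_right_mono mult_left_mono lam_le p) auto
    finally show ?thesis
      unfolding F_def by (intro norm_inverse_scaleR_le \<Lambda>) (simp add: algebra_simps dist_norm)
  qed
  have nonneg: "0 < r0 / 2" "0 \<le> C * C" "0 \<le> 2 * C" using r0 C by auto
  \<comment> \<open>A subsequence is chosen for the derivatives first, then a further one for the
    maps.\<close>
  obtain g k1 where g: "continuous_on S g" "strict_mono (k1 :: nat \<Rightarrow> nat)" "uniform_limit S (G \<circ> k1) g sequentially"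
    by (rule Arzela_Ascoli_locally_lipschitz[OF S G_bd nonneg(1,2) G_lip])
  obtain f k2 where f: "continuous_on S f" "strict_mono (k2 :: nat \<Rightarrow> nat)"
      "uniform_limit S ((\<lambda>n. F (k1 n)) \<circ> k2) f sequentially"
    by (rule Arzela_Ascoli_locally_lipschitz[OF S F_bd nonneg(1,3) F_lip])
  define k where "k = k1 \<circ> k2"
  have k: "strict_mono k" unfolding k_def using g f by (intro strict_mono_o)
  have limG: "uniform_limit S (\<lambda>n. G (k n)) g sequentially"
    using filterlim_compose[OF g(3) filterlim_subseq[OF f(2)]] by (simp add: k_def o_def)
  have limF: "uniform_limit S (\<lambda>n. F (k n)) f sequentially" using f(3) by (simp add: k_def o_def)
  have derF: "(F n has_derivative blinfun_apply (G n z)) (at z)" if "p \<in> E" "z \<in> ball p r0" for n p z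
  proof -
    have "(wm (prefix h n) has_derivative blinfun_apply (dw (prefix h n) z)) (at z)"
      using that E_sub_X r0 by (intro word_has_derivative[OF pre, of p]) auto
    then show ?thesis unfolding F_def G_def
      by (auto intro!: derivative_eq_intros simp: scaleR_blinfun.rep_eq)
  qed
  have W: "(f has_derivative blinfun_apply (g z)) (at z) \<and> (\<forall>v. norm v / (2 * C) \<le> norm (blinfun_apply (g z) v))"
    if zW: "z \<in> W" for z
  proof -
    obtain p where p: "p \<in> E" "z \<in> ball p (r0 / 2)" using zW by (auto simp: W_def)
    have sub: "ball p (r0 / 2) \<subseteq> S" using W_S p by (auto simp: W_def)
    have "\<exists>f'. \<forall>u\<in>ball p (r0/2). (\<lambda>n. F (k n) u) \<longlonglongrightarrow> f' u \<and> (f' has_derivative blinfun_apply (g u)) (at u within ball p (r0/2))"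
    proof (rule has_derivative_sequence[where f = "\<lambda>n. F (k n)" and f' = "\<lambda>n u. blinfun_apply (G (k n) u)"
          and g' = "\<lambda>u. blinfun_apply (g u)", OF convex_ball _ _ p(2)])
      show "(F (k n) has_derivative blinfun_apply (G (k n) u)) (at u within ball p (r0/2))"
        if "u \<in> ball p (r0/2)" for n u
        by (rule has_derivative_at_withinI[OF derF[OF p(1)]]) (use that r0 in auto)
      show "(\<lambda>n. F (k n) z) \<longlonglongrightarrow> f z"
        by (rule tendsto_uniform_limitI[OF limF]) (use sub p in blast)
      show "\<forall>\<^sub>F n in sequentially. \<forall>u\<in>ball p (r0/2). \<forall>v. norm (blinfun_apply (G (k n) u) v - blinfun_apply (g u) v) \<le> e * norm v"
        if "0 < e" for e
        using uniform_limitD[OF limG \<open>0 < e\<close>]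
      proof eventually_elim
        case (elim n)
        show ?case
        proof (intro ballI allI)
          fix u v assume "u \<in> ball p (r0/2)"
          then have "norm (G (k n) u - g u) \<le> e" using elim sub by (force simp: dist_norm)
          then have "norm (blinfun_apply (G (k n) u - g u) v) \<le> e * norm v"
            by (intro order_trans[OF norm_blinfun] mult_right_mono) auto
          then show "norm (blinfun_apply (G (k n) u) v - blinfun_apply (g u) v) \<le> e * norm v"
            by (simp add: blinfun.diff_left)
        qed
      qed
    qed
    then obtain f' where f': "\<And>u. u \<in> ball p (r0/2) \<Longrightarrow> (\<lambda>n. F (k n) u) \<longlonglongrightarrow> f' u"
      "(f' has_derivative blinfun_apply (g z)) (at z within ball p (r0/2))" using p by blast
    \<comment> \<open>\<open>has_derivative_sequence\<close> produces a limit of its own on the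
      ball; uniqueness of pointwise limits identifies it with \<open>f\<close>.\<close>
    have eq: "f' u = f u" if "u \<in> ball p (r0/2)" for u
      using LIMSEQ_unique[OF f'(1)[OF that] tendsto_uniform_limitI[OF limF]] sub that by blast
    have "(f' has_derivative blinfun_apply (g z)) (at z)"
      using f'(2) p by (simp add: at_within_open[OF _ open_ball])
    then have f_der: "(f has_derivative blinfun_apply (g z)) (at z)"
      by (rule has_derivative_transform_within_open[OF _ open_ball p(2) eq])
    have low: "norm v / (2 * C) \<le> norm (blinfun_apply (G (k n) z) v)" for n v
    proof -
      have "\<Lambda> (k n) / C / 2 * norm v \<le> lam (prefix h (k n)) p / 2 * norm v"
        by (intro mult_right_mono divide_right_mono lam_le p) auto
      also have "\<dots> \<le> norm (blinfun_apply (dw (prefix h (k n)) z) v)"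
        using p r0 by (intro deriv_ge[OF pre]) auto
      finally show ?thesis using \<Lambda>[of "k n"] by (simp add: G_def scaleR_blinfun.rep_eq field_simps)
    qed
    have "(\<lambda>n. norm (blinfun_apply (G (k n) z) v)) \<longlonglongrightarrow> norm (blinfun_apply (g z) v)" for v
      using tendsto_uniform_limitI[OF limG, of z] sub p
      by (intro tendsto_intros) auto
    then have "norm v / (2 * C) \<le> norm (blinfun_apply (g z) v)" for v
      by (rule LIMSEQ_le_const) (use low in auto)
    with f_der show ?thesis by blast
  qed
  show thesis
  proof (rule that[OF k])
    show "\<forall>z\<in>W. (f has_derivative blinfun_apply (g z)) (at z)"
      "\<forall>z\<in>W. \<forall>v. norm v / (2 * C) \<le> norm (blinfun_apply (g z) v)"
      using W by blast+
    show "continuous_on W g" using g(1) W_S by (rule continuous_on_subset)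
    show "uniform_limit W (\<lambda>n z. (wm (prefix h (k n)) z - x) /\<^sub>R \<Lambda> (k n)) f sequentially"
      using uniform_limit_on_subset[OF limF W_S] by (simp add: F_def[abs_def])
  qed
qed

text \<open>A point \<open>p\<close> of \<open>E\<close> is approached through its cylinders. Once
  the cylinder of \<open>v\<close> is fixed, its image under a long \<open>prefix h n\<close>
  contains a point \<open>a\<close> of \<open>A\<close>, and tangency puts \<open>a - x\<close>,
  rescaled, near \<open>T\<close>. The same vector is close to the value of \<open>f\<close> at a
  point of the cylinder, hence to \<open>f p\<close>.\<close>

lemma blow_up_limit_in_tangent_space:
  assumes h: "\<And>n. h n \<in> I" and y: "\<And>n. y n \<in> E" and x: "\<And>n. x = wm (prefix h n) (y n)"
    and meets: "\<And>v. v \<in> lists I \<Longrightarrow> \<forall>\<^sub>F n in sequentially. wm (prefix h n @ v) ` E \<inter> A \<noteq> {}"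
    and T: "subspace T"
    and tangent: "\<And>\<epsilon>. 0 < \<epsilon> \<Longrightarrow>
        \<exists>\<delta>>0. \<forall>z\<in>A. norm (z - x) < \<delta> \<longrightarrow> (\<exists>\<tau>\<in>T. norm (z - x - \<tau>) \<le> \<epsilon> * norm (z - x))"
    and k: "strict_mono (k :: nat \<Rightarrow> nat)" and W: "E \<subseteq> W"
    and lim: "uniform_limit W (\<lambda>n z. (wm (prefix h (k n)) z - x) /\<^sub>R lam (prefix h (k n)) (y (k n))) f sequentially"
    and p: "p \<in> E" and cont: "isCont f p"
  shows "f p \<in> T"
proof -
  define \<Lambda> where "\<Lambda> n = lam (prefix h n) (y n)" for n
  have pre: "prefix h n \<in> lists I" for n using h by auto
  have \<Lambda>: "0 < \<Lambda> n" for n unfolding \<Lambda>_def by (rule lam_bounds(3)[OF pre y])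
  have "infdist (f p) T \<le> 0 + e" if e: "0 < e" for e
  proof -
    \<comment> \<open>In the final triangle inequality, continuity of \<open>f\<close> and uniform
      convergence contribute one \<open>\<epsilon>\<close> each, and tangency contributes
      \<open>\<epsilon> * C\<close>.\<close>
    define \<epsilon> where "\<epsilon> = e / (C + 2)"
    have \<epsilon>: "0 < \<epsilon>" using e C by (simp add: \<epsilon>_def)
    obtain d where d: "0 < d" "\<And>z. dist z p < d \<Longrightarrow> dist (f z) (f p) < \<epsilon>"
      using cont \<epsilon> unfolding continuous_at_eps_delta by (auto simp: dist_commute)
    obtain h' y' where h': "\<And>n. h' n \<in> I" "\<And>n. y' n \<in> E" "\<And>n. p = wm (prefix h' n) (y' n)"
      using address[OF p] by blast
    have "(\<lambda>n. C * lam (prefix h' n) (y' n)) \<longlonglongrightarrow> C * 0"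
      by (intro tendsto_mult tendsto_const lam_tendsto_0 h')
    then have "\<forall>\<^sub>F n in sequentially. C * lam (prefix h' n) (y' n) < d"
      using d(1) by (intro order_tendstoD(2)) auto
    then obtain j where j: "C * lam (prefix h' j) (y' j) < d" by (auto simp: eventually_sequentially)
    \<comment> \<open>\<open>v\<close> has to be fixed before \<open>n\<close>, since the index from
      which \<open>meets\<close> holds depends on it.\<close>
    define v where "v = prefix h' j"
    have v: "v \<in> lists I" using h'(1) by (auto simp: v_def)
    obtain \<delta> where \<delta>: "0 < \<delta>" "\<And>z. z \<in> A \<Longrightarrow> norm (z - x) < \<delta> \<Longrightarrow> \<exists>\<tau>\<in>T. norm (z - x - \<tau>) \<le> \<epsilon> * norm (z - x)"
      using tangent[OF \<epsilon>] by blast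
    have "(\<lambda>n. C * \<Lambda> n) \<longlonglongrightarrow> C * 0"
      unfolding \<Lambda>_def by (intro tendsto_mult tendsto_const lam_tendsto_0 h y)
    then have "\<forall>\<^sub>F n in sequentially. C * \<Lambda> n < \<delta>"
      using \<delta>(1) by (intro order_tendstoD(2)) auto
    then have "\<forall>\<^sub>F n in sequentially. C * \<Lambda> (k n) < \<delta>" by (rule eventually_subseq[OF k])
    moreover have "\<forall>\<^sub>F n in sequentially. wm (prefix h (k n) @ v) ` E \<inter> A \<noteq> {}"
      by (rule eventually_subseq[OF k meets[OF v]])
    moreover have "\<forall>\<^sub>F n in sequentially. \<forall>z\<in>W. dist ((wm (prefix h (k n)) z - x) /\<^sub>R \<Lambda> (k n)) (f z) < \<epsilon>"
      using uniform_limitD[OF lim \<epsilon>] by (simp add: \<Lambda>_def)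
    ultimately have "\<forall>\<^sub>F n in sequentially. C * \<Lambda> (k n) < \<delta> \<and> wm (prefix h (k n) @ v) ` E \<inter> A \<noteq> {} \<and>
        (\<forall>z\<in>W. dist ((wm (prefix h (k n)) z - x) /\<^sub>R \<Lambda> (k n)) (f z) < \<epsilon>)"
      by eventually_elim simp
    then have "\<exists>n. C * \<Lambda> n < \<delta> \<and> wm (prefix h n @ v) ` E \<inter> A \<noteq> {} \<and>
        (\<forall>z\<in>W. dist ((wm (prefix h n) z - x) /\<^sub>R \<Lambda> n) (f z) < \<epsilon>)"
      unfolding eventually_sequentially by (metis order_refl)
    then obtain n where n: "C * \<Lambda> n < \<delta>" "wm (prefix h n @ v) ` E \<inter> A \<noteq> {}"
      "\<And>z. z \<in> W \<Longrightarrow> dist ((wm (prefix h n) z - x) /\<^sub>R \<Lambda> n) (f z) < \<epsilon>"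
      by metis
    from n(2) obtain q where q: "q \<in> E" "wm (prefix h n) (wm v q) \<in> A" by (auto simp: word_map_append)
    define z where "z = wm v q"
    define a where "a = wm (prefix h n) z"
    have z: "z \<in> E" unfolding z_def by (rule word_maps_E[OF v q(1)])
    have "dist p z \<le> C * lam v (y' j)"
      unfolding h'(3)[of j] z_def v_def by (rule dist_word[OF v[unfolded v_def] h'(2) q(1)])
    then have "dist z p < d" using j by (simp add: v_def dist_commute)
    then have fz: "dist (f z) (f p) < \<epsilon>" by (rule d(2))
    have "dist x a \<le> C * \<Lambda> n"
      unfolding x[of n] a_def \<Lambda>_def by (rule dist_word[OF pre y z])
    then have ax: "norm (a - x) \<le> C * \<Lambda> n" by (simp add: dist_norm norm_minus_commute)
    then obtain \<tau> where \<tau>: "\<tau> \<in> T" "norm (a - x - \<tau>) \<le> \<epsilon> * norm (a - x)"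
      using \<delta>(2)[of a] q(2) n(1) by (force simp: a_def z_def)
    have "norm (a - x - \<tau>) \<le> \<epsilon> * (C * \<Lambda> n)"
      by (rule order_trans[OF \<tau>(2) mult_left_mono[OF ax less_imp_le[OF \<epsilon>]]])
    then have "norm ((a - x - \<tau>) /\<^sub>R \<Lambda> n) \<le> \<epsilon> * C"
      by (intro norm_inverse_scaleR_le \<Lambda>) (simp add: mult.assoc)
    then have "dist ((a - x) /\<^sub>R \<Lambda> n) (\<tau> /\<^sub>R \<Lambda> n) \<le> \<epsilon> * C"
      by (simp add: dist_norm scaleR_diff_right)
    moreover have "dist ((a - x) /\<^sub>R \<Lambda> n) (f z) < \<epsilon>" using n(3)[of z] W z by (auto simp: a_def)
    moreover have "dist (f p) (\<tau> /\<^sub>R \<Lambda> n) \<le> dist (f z) (f p) + dist ((a - x) /\<^sub>R \<Lambda> n) (f z) + dist ((a - x) /\<^sub>R \<Lambda> n) (\<tau> /\<^sub>R \<Lambda> n)"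
      using dist_triangle[of "f p" "\<tau> /\<^sub>R \<Lambda> n" "f z"] dist_triangle[of "f z" "\<tau> /\<^sub>R \<Lambda> n" "(a - x) /\<^sub>R \<Lambda> n"]
      by (simp add: dist_commute)
    ultimately have "dist (f p) (\<tau> /\<^sub>R \<Lambda> n) \<le> \<epsilon> * (C + 2)" using fz by (simp add: algebra_simps)
    also have "\<dots> = e" using C by (simp add: \<epsilon>_def)
    finally have le: "dist (f p) (\<tau> /\<^sub>R \<Lambda> n) \<le> e" .
    have "\<tau> /\<^sub>R \<Lambda> n \<in> T" using T \<tau>(1) by (rule subspace_scale)
    from infdist_le[OF this, of "f p"] le show ?thesis by simp
  qed
  then have "infdist (f p) T \<le> 0" by (rule field_le_epsilon)
  then have "infdist (f p) T = 0" using infdist_nonneg[of "f p" T] by linarith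
  moreover have "T \<noteq> {}" using subspace_0[OF T] by blast
  ultimately show ?thesis using in_closed_iff_infdist_zero[OF closed_subspace[OF T]] by blast
qed

lemma contained_in_submanifold:
  assumes t: "ereal t = hausdorff_dim E" and M: "C1_submanifold l M" "hausdorff_measure t (E \<inter> M) \<noteq> 0"
  shows "\<exists>M'. C1_submanifold l M' \<and> E \<subseteq> M'"
proof -
  obtain A where A: "compact A" "A \<subseteq> E \<inter> M" "hausdorff_measure t A \<noteq> 0"
    and tan: "\<forall>x\<in>A. \<exists>T. subspace T \<and> dim T = l \<and>
       (\<forall>\<epsilon>>0. \<exists>\<delta>>0. \<forall>z\<in>A. norm (z - x) < \<delta> \<longrightarrow> (\<exists>\<tau>\<in>T. norm (z - x - \<tau>) \<le> \<epsilon> * norm (z - x)))"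
    by (rule compact_piece_of_submanifold[OF M(1) compact_E M(2)])
  have "A \<subseteq> E" using A(2) by blast
  then obtain h y x where x: "x \<in> A" and h: "\<And>n. h n \<in> I" "\<And>n. y n \<in> E" "\<And>n. x = wm (prefix h n) (y n)"
    and meets: "\<And>v. v \<in> lists I \<Longrightarrow> \<forall>\<^sub>F n in sequentially. wm (prefix h n @ v) ` E \<inter> A \<noteq> {}"
    using density_point_address[OF t A(1) _ A(3)] by metis
  obtain T where T: "subspace T" "dim T = l"
    and tanT: "\<forall>\<epsilon>>0. \<exists>\<delta>>0. \<forall>z\<in>A. norm (z - x) < \<delta> \<longrightarrow> (\<exists>\<tau>\<in>T. norm (z - x - \<tau>) \<le> \<epsilon> * norm (z - x))"
    using bspec[OF tan x] by (elim exE conjE)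
  define W where "W = (\<Union>z\<in>E. ball z (r0 / 2))"
  have E_W: "E \<subseteq> W" using r0 by (auto simp: W_def)
  obtain f g k where k: "strict_mono (k :: nat \<Rightarrow> nat)"
    and der: "\<forall>z\<in>W. (f has_derivative blinfun_apply (g z)) (at z)" and cont: "continuous_on W g"
    and exp: "\<forall>z\<in>W. \<forall>v. norm v / (2 * C) \<le> norm (blinfun_apply (g z) v)"
    and lim: "uniform_limit W (\<lambda>n z. (wm (prefix h (k n)) z - x) /\<^sub>R lam (prefix h (k n)) (y (k n))) f sequentially"
    by (rule blow_up_limit[OF h, folded W_def]) (rule that, assumption+)
  have "f p \<in> T" if p: "p \<in> E" for p
  proof (rule blow_up_limit_in_tangent_space[OF h meets T(1) _ k E_W lim p])
    show "isCont f p" using has_derivative_continuous[OF bspec[OF der]] p E_W by blast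
    show "\<exists>\<delta>>0. \<forall>z\<in>A. norm (z - x) < \<delta> \<longrightarrow> (\<exists>\<tau>\<in>T. norm (z - x - \<tau>) \<le> \<epsilon> * norm (z - x))" if "0 < \<epsilon>" for \<epsilon>
      using tanT[rule_format, OF that] .
  qed
  then have "E \<subseteq> {z \<in> W. f z \<in> T}" using E_W by blast
  moreover have "C1_submanifold (dim T) {z \<in> W. f z \<in> T}"
  proof (rule C1_submanifold_vimage[OF _ _ cont _ _ T(1)])
    show "open W" by (auto simp: W_def)
    show "0 < 1 / (2 * C)" using C by simp
    show "1 / (2 * C) * norm v \<le> norm (blinfun_apply (g z) v)" if "z \<in> W" for z v
      using exp that by simp
  qed (use der in auto)
  ultimately show ?thesis using T(2) by blast
qed

end

section \<open>From the hypotheses of the theorem to the abstract setting\<close>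

lemma conorm_le_norm:
  fixes f :: "'a::euclidean_space \<Rightarrow> 'a"
  assumes f: "linear f" "bij f" and pos: "0 < conorm f"
  shows "conorm f * norm v \<le> norm (f v)"
proof -
  have "linear (inv f)" using f by (intro inj_linear_imp_inv_linear bij_is_inj)
  then have bl: "bounded_linear (inv f)" by (simp add: linear_conv_bounded_linear)
  have "norm v = norm (inv f (f v))" using f by (simp add: bij_is_inj)
  also have "\<dots> \<le> onorm (inv f) * norm (f v)" by (rule onorm[OF bl])
  finally have le: "norm v \<le> onorm (inv f) * norm (f v)" .
  have "0 < onorm (inv f)" using pos by (simp add: conorm_def)
  then show ?thesis using le by (simp add: conorm_def field_simps)
qed

text \<open>A bound on the second derivative yields a Lipschitz constant through the mean value
  inequality, hence on convex sets. Quantifying over all convex \<open>B\<close> in \<open>K\<close>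
  lets one constant serve all the balls used later.\<close>

lemma C2_on_Lipschitz_derivative:
  fixes f :: "'a::euclidean_space \<Rightarrow> 'a"
  assumes "C2_on f S" "compact K" "K \<subseteq> S"
  shows "\<exists>D L. (\<forall>x\<in>S. (f has_derivative blinfun_apply (D x)) (at x)) \<and> 0 \<le> L \<and>
    (\<forall>B. convex B \<longrightarrow> B \<subseteq> K \<longrightarrow> (\<forall>x\<in>B. \<forall>y\<in>B. norm (D x - D y) \<le> L * norm (x - y)))"
proof -
  obtain D where D: "\<And>x. x \<in> S \<Longrightarrow> (f has_derivative blinfun_apply (D x)) (at x)" and "C1_on D S"
    using assms(1) unfolding C2_on_def by blast
  then obtain D2 where D2: "\<And>x. x \<in> S \<Longrightarrow> (D has_derivative blinfun_apply (D2 x)) (at x)" "continuous_on S D2"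
    unfolding C1_on_def by blast
  have "compact (D2 ` K)"
    by (rule compact_continuous_image[OF continuous_on_subset[OF D2(2) assms(3)] assms(2)])
  then have "bounded (D2 ` K)" by (rule compact_imp_bounded)
  then obtain L where L: "0 < L" "\<And>x. x \<in> K \<Longrightarrow> norm (D2 x) \<le> L"
    unfolding bounded_pos by auto
  show ?thesis
  proof (intro exI[of _ D] exI[of _ L] conjI allI ballI impI)
    fix B x y assume B: "convex B" "B \<subseteq> K" "x \<in> B" "y \<in> B"
    show "norm (D x - D y) \<le> L * norm (x - y)"
    proof (rule differentiable_bound[OF B(1) _ _ B(3,4)])
      fix u assume u: "u \<in> B"
      show "(D has_derivative blinfun_apply (D2 u)) (at u within B)"
        by (rule has_derivative_at_withinI[OF D2(1)]) (use u B assms in blast)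
      show "onorm (blinfun_apply (D2 u)) \<le> L"
        using L(2) u B by (auto simp: norm_blinfun.rep_eq)
    qed
  qed (use L D in auto)
qed

theorem corollary3p5:
  fixes I :: "'i set"
    and \<phi> :: "'i \<Rightarrow> 'a::euclidean_space \<Rightarrow> 'a"
    and X \<Omega> \<Omega>' E :: "'a set"
    and s_lo s_hi \<rho>\<^sub>0 t :: real
    and l :: nat
  assumes "finite I" and "2 \<le> card I"
    and "compact X" and "X \<noteq> {}"
    and "open \<Omega>'" and "open \<Omega>" and "bounded \<Omega>" and "X \<subseteq> \<Omega>" and "closure \<Omega> \<subseteq> \<Omega>'"
    and "\<And>i. i \<in> I \<Longrightarrow> C2_on (\<phi> i) \<Omega>'"
    and "\<And>i. i \<in> I \<Longrightarrow> \<phi> i ` X \<subseteq> X"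
    and "0 < s_lo" and "s_lo < 1" and "0 < s_hi" and "s_hi < 1" and "s_hi\<^sup>2 \<le> s_lo"
    and "\<And>i x. i \<in> I \<Longrightarrow> x \<in> \<Omega> \<Longrightarrow>
           bij (frechet_derivative (\<phi> i) (at x)) \<and>
           s_lo \<le> conorm (frechet_derivative (\<phi> i) (at x)) \<and>
           conorm (frechet_derivative (\<phi> i) (at x)) \<le> onorm (frechet_derivative (\<phi> i) (at x)) \<and>
           onorm (frechet_derivative (\<phi> i) (at x)) \<le> s_hi"
    and "\<And>\<epsilon>::real. 0 < \<epsilon> \<Longrightarrow>
           \<exists>N. \<forall>w \<in> lists I. N \<le> length w \<longrightarrow> diameter (word_map \<phi> w ` X) < \<epsilon>"
    and "E = limit_set I \<phi> X"
    and "\<And>i x. i \<in> I \<Longrightarrow> x \<in> E \<Longrightarrow>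
           conorm (frechet_derivative (\<phi> i) (at x)) = onorm (frechet_derivative (\<phi> i) (at x))"
    and "\<And>i j. i \<in> I \<Longrightarrow> j \<in> I \<Longrightarrow> i \<noteq> j \<Longrightarrow>
           \<phi> i ` interior X \<inter> \<phi> j ` interior X = {}"
    and "0 < \<rho>\<^sub>0"
    and "0 < (INF x \<in> frontier X. INF r \<in> {0<..<\<rho>\<^sub>0}.
               hausdorff_measure (real DIM('a)) (ball x r \<inter> interior X) /
               hausdorff_measure (real DIM('a)) (ball x r))"
    and "ereal t = hausdorff_dim E"
    and "0 < l" and "l < DIM('a)"
  shows "(\<forall>M. C1_submanifold l M \<longrightarrow> hausdorff_measure t (E \<inter> M) = 0) \<or>
         (\<exists>M. C1_submanifold l M \<and> E \<subseteq> M)"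
proof (rule disjCI)
  assume "\<not> (\<exists>M. C1_submanifold l M \<and> E \<subseteq> M)"
  note fin_I = assms(1) and card_I = assms(2) and comp_X = assms(3) and X_ne = assms(4)
    and open_\<Omega> = assms(6) and bdd_\<Omega> = assms(7) and X_\<Omega> = assms(8) and cl_\<Omega> = assms(9)
    and C2 = assms(10) and inv_X = assms(11) and s_lo = assms(12) and s_hi = assms(14,15)
    and der_bounds = assms(17) and diam = assms(18) and E = assms(19) and conf_E = assms(20)
    and t = assms(24)
  have I_ne: "I \<noteq> {}" using card_I by auto
  \<comment> \<open>Compactness of \<open>X\<close> gives one radius for all its points.\<close>
  obtain \<rho> where \<rho>: "0 < \<rho>" "(\<Union>x\<in>X. ball x \<rho>) \<subseteq> \<Omega>"
    using compact_subset_open_imp_ball_epsilon_subset[OF comp_X open_\<Omega> X_\<Omega>] by blast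
  have ball_\<Omega>: "ball x \<rho> \<subseteq> \<Omega>" if "x \<in> X" for x using \<rho> that by blast
  have "compact (closure \<Omega>)" using bdd_\<Omega> by (simp add: compact_closure)
  then have "\<forall>i\<in>I. \<exists>D L. (\<forall>x\<in>\<Omega>'. (\<phi> i has_derivative blinfun_apply (D x)) (at x)) \<and> 0 \<le> L \<and>
      (\<forall>B. convex B \<longrightarrow> B \<subseteq> closure \<Omega> \<longrightarrow> (\<forall>x\<in>B. \<forall>y\<in>B. norm (D x - D y) \<le> L * norm (x - y)))"
    using C2_on_Lipschitz_derivative[OF C2 _ cl_\<Omega>] by (intro ballI)
  from bchoice[OF this] obtain D where "\<forall>i\<in>I. \<exists>L. (\<forall>x\<in>\<Omega>'. (\<phi> i has_derivative blinfun_apply (D i x)) (at x)) \<and> 0 \<le> L \<and>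
      (\<forall>B. convex B \<longrightarrow> B \<subseteq> closure \<Omega> \<longrightarrow> (\<forall>x\<in>B. \<forall>y\<in>B. norm (D i x - D i y) \<le> L * norm (x - y)))" ..
  from bchoice[OF this] obtain L where DL: "\<forall>i\<in>I. (\<forall>x\<in>\<Omega>'. (\<phi> i has_derivative blinfun_apply (D i x)) (at x)) \<and> 0 \<le> L i \<and>
      (\<forall>B. convex B \<longrightarrow> B \<subseteq> closure \<Omega> \<longrightarrow> (\<forall>x\<in>B. \<forall>y\<in>B. norm (D i x - D i y) \<le> L i * norm (x - y)))" ..
  then have D: "\<And>i x. \<lbrakk>i \<in> I; x \<in> \<Omega>'\<rbrakk> \<Longrightarrow> (\<phi> i has_derivative blinfun_apply (D i x)) (at x)"
    and L: "\<And>i. i \<in> I \<Longrightarrow> 0 \<le> L i"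
    and lip: "\<And>i B x y. \<lbrakk>i \<in> I; convex B; B \<subseteq> closure \<Omega>; x \<in> B; y \<in> B\<rbrakk> \<Longrightarrow> norm (D i x - D i y) \<le> L i * norm (x - y)"
    by blast+
  have \<Omega>_sub: "\<Omega> \<subseteq> \<Omega>'" using cl_\<Omega> closure_subset by blast
  have fd: "frechet_derivative (\<phi> i) (at x) = blinfun_apply (D i x)" if "i \<in> I" "x \<in> \<Omega>" for i x
    using frechet_derivative_at[OF D[OF that(1)]] that(2) \<Omega>_sub by auto
  have X_sub: "X \<subseteq> \<Omega>'" using X_\<Omega> \<Omega>_sub by blast
  have base: "limit_set_ifs I \<phi> X E"
  proof
    show "continuous_on X (\<phi> i)" if "i \<in> I" for i
      by (rule has_derivative_continuous_on[OF has_derivative_at_withinI[OF D[OF that]]]) (use X_sub in blast)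
  qed (use fin_I I_ne comp_X X_ne inv_X diam E in auto)
  interpret limit_set_ifs I \<phi> X E by (rule base)
  have E_\<Omega>: "x \<in> \<Omega>" if "x \<in> E" for x using that E_sub_X X_\<Omega> by blast
  \<comment> \<open>The sum of the constants is a common Lipschitz constant for the finitely many
    derivatives.\<close>
  have L_le: "L i \<le> (\<Sum>i\<in>I. L i)" if "i \<in> I" for i
    using that L fin_I by (intro member_le_sum) auto
  have "distortion_ifs I \<phi> X E D \<rho> s_hi s_lo (\<Sum>i\<in>I. L i)"
  proof (intro distortion_ifs.intro base distortion_ifs_axioms.intro)
    show "0 \<le> (\<Sum>i\<in>I. L i)" using L by (rule sum_nonneg)
    fix i x assume i: "i \<in> I"
    show "(\<phi> i has_derivative blinfun_apply (D i y)) (at y)" if "x \<in> X" "y \<in> ball x \<rho>" for y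
      using D[OF i] ball_\<Omega>[OF that(1)] that(2) \<Omega>_sub by blast
    show "norm (D i y) \<le> s_hi" if "x \<in> X" "y \<in> ball x \<rho>" for y
    proof -
      have "y \<in> \<Omega>" using ball_\<Omega>[OF that(1)] that(2) by blast
      then show ?thesis using der_bounds[OF i] fd[OF i] by (simp add: norm_blinfun.rep_eq)
    qed
    show "norm (D i y - D i z) \<le> (\<Sum>i\<in>I. L i) * norm (y - z)" if "x \<in> X" "y \<in> ball x \<rho>" "z \<in> ball x \<rho>" for y z
    proof -
      have "ball x \<rho> \<subseteq> closure \<Omega>" using ball_\<Omega>[OF that(1)] closure_subset by blast
      then have "norm (D i y - D i z) \<le> L i * norm (y - z)"
        by (rule lip[OF i convex_ball _ that(2,3)])
      also have "\<dots> \<le> (\<Sum>i\<in>I. L i) * norm (y - z)" by (intro mult_right_mono L_le i) auto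
      finally show ?thesis .
    qed
    assume x: "x \<in> E"
    let ?f = "blinfun_apply (D i x)"
    have f: "bij ?f" "s_lo \<le> conorm ?f" "conorm ?f = norm (D i x)"
      using der_bounds[OF i E_\<Omega>[OF x]] conf_E[OF i x] by (simp_all add: fd[OF i E_\<Omega>[OF x]] norm_blinfun.rep_eq)
    show "s_lo \<le> norm (D i x)" using f by simp
    fix v
    \<comment> \<open>On \<open>E\<close> the conorm equals the operator norm, so the lower and the
      upper bound of \<open>norm (?f v)\<close> coincide and the derivative is a similarity.\<close>
    have "norm (D i x) * norm v \<le> norm (?f v)"
      using conorm_le_norm[of ?f v] f s_lo blinfun.bounded_linear_right bounded_linear.linear by fastforce
    then show "norm (?f v) = norm (D i x) * norm v" using norm_blinfun[of "D i x" v] by simp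
  qed (use \<rho> s_lo s_hi in auto)
  then interpret distortion_ifs I \<phi> X E D \<rho> s_hi s_lo "\<Sum>i\<in>I. L i" .
  obtain r0 C where "bounded_distortion_ifs I \<phi> X E D \<rho> s_hi s_lo (\<Sum>i\<in>I. L i) r0 C"
  proof (rule geometry, goal_cases)
    case (1 r0 C)
    have "bounded_distortion_ifs I \<phi> X E D \<rho> s_hi s_lo (\<Sum>i\<in>I. L i) r0 C"
      by (unfold_locales; (rule 1; assumption)?)
    then show ?case by (rule 1(1))
  qed
  then interpret bounded_distortion_ifs I \<phi> X E D \<rho> s_hi s_lo "\<Sum>i\<in>I. L i" r0 C .
  show "\<forall>M. C1_submanifold l M \<longrightarrow> hausdorff_measure t (E \<inter> M) = 0"
    using contained_in_submanifold[OF t] \<open>\<not> (\<exists>M. C1_submanifold l M \<and> E \<subseteq> M)\<close> by blast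
qed

end
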